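(* Let $X$ be a mixed-exponential jump-diffusion process with Lévy exponent $G$, let $h<H$ be real numbers, and let $\alpha>0$, $\rho>0$ and $\gamma$ be real numbers with $0\le\gamma<\min(\eta_1,\theta_1)$ and $G(\gamma)<\alpha$. Assume that the root assumption $\mathrm{(R}_a)$ described in the context holds for $a=\alpha$ and for $a=\alpha+\rho$. Then there are real coefficients $\omega_i^L,\omega_i^0$ ($1\le i\le m+1$) and $\nu_j^0,\nu_j^U$ ($1\le j\le n+1$), not depending on $x$, such that for all $x\in\mathbb{R}$ $$ \int_0^\infty \alpha e^{-\alpha T}\,\mathbb{E}_x\!\left[e^{-\rho\int_0^T \mathbf 1_{\{h<X_t<H\}}\,dt+\gamma X_T}\right]dT =\begin{cases} \sum_{i=1}^{m+1}\omega_i^L e^{\beta_{i,\alpha}(x-h)}-c_L e^{\gamma x}, & x\le h,\\[2pt] -\sum_{i=1}^{m+1}\omega_i^0 e^{\beta_{i,\alpha+\rho}(x-H)}-\sum_{j=1}^{n+1}\nu_j^0 e^{-\gamma_{j,\alpha+\rho}(x-h)}-c_0e^{\gamma x}, & h<x<H,\\[2pt] \sum_{j=1}^{n+1}\nu_j^U e^{-\gamma_{j,\alpha}(x-H)}-c_Ue^{\gamma x}, & x\ge H, \end{cases} $$ where $$c_L=c_U=\frac{\alpha}{G(\gamma)-\alpha},\qquad c_0=\frac{\alpha}{G(\gamma)-(\alpha+\rho)},$$ and the column vector of coefficients $$Q=\left(\omega_1^L,\dots,\omega_{m+1}^L,\ \nu_1^0,\dots,\nu_{n+1}^0,\ \nu_1^U,\dots,\nu_{n+1}^U,\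 \omega_1^0,\dots,\omega_{m+1}^0\right)^{\top}\in\mathbb{R}^{2S},\qquad S=m+n+2,$$ satisfies the linear system $BQ=V$. Here $$V=(c_U-c_0)\begin{pmatrix} e^{\gamma h}\,v(\gamma)\\ e^{\gamma H}\,v(\gamma)\end{pmatrix},\qquad B=\begin{pmatrix} M & NZ_\beta\\ MZ_\gamma & N\end{pmatrix},$$ $v(a)$ is the column vector $$v(a)=\left(1,\ a,\ \tfrac{1}{\eta_1-a},\dots,\tfrac1{\eta_m-a},\ \tfrac1{\theta_1+a},\dots,\tfrac1{\theta_n+a}\right)^{\top}\in\mathbb{R}^S,$$ $M$ is the $S\times S$ matrix with successive columns $v(\beta_{1,\alpha}),\dots,v(\beta_{m+1,\alpha}),v(-\gamma_{1,\alpha+\rho}),\dots,v(-\gamma_{n+1,\alpha+\rho})$, $N$ is the $S\times S$ matrix with successive columns $v(-\gamma_{1,\alpha}),\dots,v(-\gamma_{n+1,\alpha}),v(\beta_{1,\alpha+\rho}),\dots,v(\beta_{m+1,\alpha+\rho})$, and $Z_\beta$, $Z_\gamma$ are the $S\times S$ diagonal matrices with diagonal entries, respectively, $$\big(\underbrace{0,\dots,0}_{n+1},e^{\beta_{1,\alpha+\rho}(h-H)},\dots,e^{\beta_{m+1,\alpha+\rho}(h-H)}\big)\quad\text{and}\quad \big(\underbrace{0,\dots,0}_{m+1},e^{\gamma_{1,\alpha+\rho}(h-H)},\dots,e^{\gamma_{n+1,\alpha+\rho}(h-H)}\big).$$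
   Context: Mixed-exponential jump-diffusion (MEJD) process: $X_t=X_0+\mu t+\sigma W_t+\sum_{i=1}^{N_t}Y_i$, $t\ge0$, where $\mu\in\mathbb{R}$, $\sigma\ge0$, $W$ is a standard Brownian motion, $N$ is a homogeneous Poisson process with rate $\lambda$, and $Y_1,Y_2,\dots$ are i.i.d. with probability density function $$f_Y(y)=p_u\sum_{i=1}^m p_i\eta_ie^{-\eta_iy}\mathbf 1_{\{y\ge0\}}+q_d\sum_{j=1}^n q_j\theta_je^{\theta_jy}\mathbf 1_{\{y<0\}},$$ with $W$, $N$, $(Y_i)$ mutually independent. Here $p_u,q_d\ge0$, $p_u+q_d=1$, $p_i,q_j\in\mathbb{R}$ (possibly negative, but such that $f_Y$ is a probability density), $\sum_{i=1}^m p_i=1$, $\sum_{j=1}^n q_j=1$, $0<\eta_1<\dots<\eta_m$ and $0<\theta_1<\dots<\theta_n$. $\mathbb{P}_x$ and $\mathbb{E}_x$ denote the law of $X$ with $X_0=x$ and its expectation. The Lévy exponent is $$G(\zeta)=\mu\zeta+\frac{\sigma^2}{2}\zeta^2+\lambda\left(p_u\sum_{i=1}^m\frac{p_i\eta_i}{\eta_i-\zeta}+q_d\sum_{j=1}^n\frac{q_j\theta_j}{\theta_j+\zeta}-1\right),$$ so that $\mathbb{E}_0[e^{\zeta X_t}]=e^{tG(\zeta)}$ for $\zeta\in(-\theta_1,\eta_1)$; $G$ is also regarded as a rational function on $\mathbb{R}$ minus its poles. Root assumption $\mathrm{(R}_a)$, for $a>0$: the equation $G(\zeta)=a$ has exactly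 $m+n+2$ distinct real solutions, namely $m+1$ positive ones $\beta_{1,a},\dots,\beta_{m+1,a}$ and $n+1$ negative ones, written $-\gamma_{1,a},\dots,-\gamma_{n+1,a}$ with $\gamma_{j,a}>0$, satisfying $$0<\beta_{1,a}<\eta_1<\beta_{2,a}<\dots<\eta_m<\beta_{m+1,a}<\infty,\qquad 0<\gamma_{1,a}<\theta_1<\gamma_{2,a}<\dots<\theta_n<\gamma_{n+1,a}<\infty.$$ *)

theory Defs
  imports "HOL-Probability.Probability" "Jordan_Normal_Form.Matrix"
begin

text \<open>Parameters of a mixed-exponential jump-diffusion. All finite families are indexed from 1, and
  only the indices \<open>1, \<dots>, num_up\<close> (resp. \<open>1, \<dots>, num_down\<close>) are meaningful.\<close>

record mejd =
  drift :: real                    (* mu *)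
  volatility :: real               (* sigma *)
  rate :: real                     (* lambda *)
  prob_up :: real                  (* p_u *)
  prob_down :: real                (* q_d *)
  num_up :: nat                    (* m *)
  num_down :: nat                  (* n *)
  weight_up :: "nat \<Rightarrow> real"       (* p_i *)
  weight_down :: "nat \<Rightarrow> real"     (* q_j *)
  eta :: "nat \<Rightarrow> real"
  theta :: "nat \<Rightarrow> real"

definition jump_density :: "mejd \<Rightarrow> real \<Rightarrow> real" where
  "jump_density P y =
     prob_up P * (\<Sum>i=1..num_up P. weight_up P i * eta P i * exp (- eta P i * y)) * indicator {0..} y
   + prob_down P * (\<Sum>j=1..num_down P. weight_down P j * theta P j * exp (theta P j * y)) * indicator {..<0} y"

text \<open>The weights may be negative, so nonnegativity of the jump density is a genuine restriction.
  Its total mass is \<open>1\<close> by the normalisations. These also force \<open>num_up P \<ge> 1\<close> and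
  \<open>num_down P \<ge> 1\<close>.\<close>

definition mejd_parameters :: "mejd \<Rightarrow> bool" where
  "mejd_parameters P \<longleftrightarrow>
     0 \<le> volatility P \<and> 0 < rate P \<and>
     0 \<le> prob_up P \<and> 0 \<le> prob_down P \<and> prob_up P + prob_down P = 1 \<and>
     (\<Sum>i=1..num_up P. weight_up P i) = 1 \<and> (\<Sum>j=1..num_down P. weight_down P j) = 1 \<and>
     0 < eta P 1 \<and> strict_mono_on {1..num_up P} (eta P) \<and>
     0 < theta P 1 \<and> strict_mono_on {1..num_down P} (theta P) \<and>
     (\<forall>y. 0 \<le> jump_density P y)"

text \<open>Processes are functions of a real time of which only times \<open>t \<ge> 0\<close> matter. Path
  regularity is required for every sample point, so that path functionals are measurable without
  completing the probability space.\<close>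

definition independent_increments :: "'a measure \<Rightarrow> (real \<Rightarrow> 'a \<Rightarrow> real) \<Rightarrow> bool" where
  "independent_increments M Z \<longleftrightarrow>
     (\<forall>k t. mono t \<and> 0 \<le> t (0::nat) \<longrightarrow>
        prob_space.indep_vars M (\<lambda>_. borel) (\<lambda>i \<omega>. Z (t (Suc i)) \<omega> - Z (t i) \<omega>) {..<k::nat})"

definition standard_brownian_motion :: "'a measure \<Rightarrow> (real \<Rightarrow> 'a \<Rightarrow> real) \<Rightarrow> bool" where
  "standard_brownian_motion M W \<longleftrightarrow>
     (\<forall>t\<ge>0. W t \<in> borel_measurable M) \<and>
     (\<forall>\<omega>\<in>space M. W 0 \<omega> = 0 \<and> continuous_on {0..} (\<lambda>t. W t \<omega>)) \<and>
     independent_increments M W \<and>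
     (\<forall>s t. 0 \<le> s \<and> s < t \<longrightarrow>
        distributed M lborel (\<lambda>\<omega>. W t \<omega> - W s \<omega>) (normal_density 0 (sqrt (t - s))))"

definition homogeneous_poisson_process :: "'a measure \<Rightarrow> real \<Rightarrow> (real \<Rightarrow> 'a \<Rightarrow> nat) \<Rightarrow> bool" where
  "homogeneous_poisson_process M r N \<longleftrightarrow>
     (\<forall>t\<ge>0. N t \<in> measurable M (count_space UNIV)) \<and>
     (\<forall>\<omega>\<in>space M. N 0 \<omega> = 0 \<and> mono_on {0..} (\<lambda>t. N t \<omega>) \<and>
        (\<forall>t\<ge>0. continuous (at_right t) (\<lambda>s. N s \<omega>))) \<and>
     independent_increments M (\<lambda>t \<omega>. real (N t \<omega>)) \<and>
     (\<forall>s t. 0 \<le> s \<and> s < t \<longrightarrow>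
        distr M (count_space UNIV) (\<lambda>\<omega>. N t \<omega> - N s \<omega>) = measure_pmf (poisson_pmf (r * (t - s))))"

text \<open>The events of the sigma-algebra generated by the family \<open>(Z i)\<^bsub>i \<in> I\<^esub>\<close>.\<close>

definition generated_events ::
    "'a measure \<Rightarrow> 'i set \<Rightarrow> 'b measure \<Rightarrow> ('i \<Rightarrow> 'a \<Rightarrow> 'b) \<Rightarrow> 'a set set" where
  "generated_events M I S Z = sigma_sets (space M) (\<Union>i\<in>I. {Z i -` A \<inter> space M |A. A \<in> sets S})"

definition mejd_drivers ::
    "mejd \<Rightarrow> 'a measure \<Rightarrow> (real \<Rightarrow> 'a \<Rightarrow> real) \<Rightarrow> (real \<Rightarrow> 'a \<Rightarrow> nat) \<Rightarrow> (nat \<Rightarrow> 'a \<Rightarrow> real) \<Rightarrow> bool" where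
  "mejd_drivers P M W N Y \<longleftrightarrow>
     prob_space M \<and>
     standard_brownian_motion M W \<and>
     homogeneous_poisson_process M (rate P) N \<and>
     (\<forall>i\<ge>1. distributed M lborel (Y i) (jump_density P)) \<and>
     prob_space.indep_vars M (\<lambda>_. borel) Y {1..} \<and>
     prob_space.indep_sets M
       (\<lambda>k. [generated_events M {0..} borel W,
             generated_events M {0..} (count_space UNIV) N,
             generated_events M {1..} borel Y] ! k) {..<3}"

text \<open>The process started at \<open>x\<close>. Expectations under the law \<open>P\<^sub>x\<close> are expectations
  over \<open>M\<close> of functionals of this process.\<close>

definition mejd_process ::
    "mejd \<Rightarrow> (real \<Rightarrow> 'a \<Rightarrow> real) \<Rightarrow> (real \<Rightarrow> 'a \<Rightarrow> nat) \<Rightarrow> (nat \<Rightarrow> 'a \<Rightarrow> real) \<Rightarrow>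
     real \<Rightarrow> real \<Rightarrow> 'a \<Rightarrow> real" where
  "mejd_process P W N Y x t \<omega> =
     x + drift P * t + volatility P * W t \<omega> + (\<Sum>i=1..N t \<omega>. Y i \<omega>)"

definition levy_exponent :: "mejd \<Rightarrow> real \<Rightarrow> real" where
  "levy_exponent P \<zeta> = drift P * \<zeta> + (volatility P)\<^sup>2 / 2 * \<zeta>\<^sup>2
     + rate P * (prob_up P * (\<Sum>i=1..num_up P. weight_up P i * eta P i / (eta P i - \<zeta>))
               + prob_down P * (\<Sum>j=1..num_down P. weight_down P j * theta P j / (theta P j + \<zeta>)) - 1)"

definition levy_poles :: "mejd \<Rightarrow> real set" where
  "levy_poles P = eta P ` {1..num_up P} \<union> (\<lambda>j. - theta P j) ` {1..num_down P}"

text \<open>\<open>\<beta> 1, \<dots>, \<beta> (m + 1)\<close> and \<open>- \<gamma> 1, \<dots>, - \<gamma> (n + 1)\<close> are all the solutions of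
  \<open>G(\<zeta>) = a\<close>, interlaced with the poles of \<open>G\<close>. The poles are excluded explicitly because
  division by zero is total in HOL. The interlacing makes the \<open>m + n + 2\<close> solutions distinct.\<close>

definition root_assumption :: "mejd \<Rightarrow> real \<Rightarrow> (nat \<Rightarrow> real) \<Rightarrow> (nat \<Rightarrow> real) \<Rightarrow> bool" where
  "root_assumption P a \<beta> \<gamma> \<longleftrightarrow>
     {\<zeta>. \<zeta> \<notin> levy_poles P \<and> levy_exponent P \<zeta> = a} =
        \<beta> ` {1..num_up P + 1} \<union> (\<lambda>j. - \<gamma> j) ` {1..num_down P + 1} \<and>
     0 < \<beta> 1 \<and> (\<forall>i\<in>{1..num_up P}. \<beta> i < eta P i \<and> eta P i < \<beta> (i + 1)) \<and>
     0 < \<gamma> 1 \<and> (\<forall>j\<in>{1..num_down P}. \<gamma> j < theta P j \<and> theta P j < \<gamma> (j + 1))"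

definition sys_dim :: "mejd \<Rightarrow> nat" where
  "sys_dim P = num_up P + num_down P + 2"

definition v_vec :: "mejd \<Rightarrow> real \<Rightarrow> real vec" where
  "v_vec P a = vec_of_list
     ([1, a] @ map (\<lambda>i. 1 / (eta P i - a)) [1..<num_up P + 1]
             @ map (\<lambda>j. 1 / (theta P j + a)) [1..<num_down P + 1])"

text \<open>In the matrices below, \<open>\<beta>, \<gamma>\<close> are the roots at level \<open>\<alpha>\<close> and \<open>\<beta>', \<gamma>'\<close> those at
  level \<open>\<alpha> + \<rho>\<close>.\<close>

definition M_mat :: "mejd \<Rightarrow> (nat \<Rightarrow> real) \<Rightarrow> (nat \<Rightarrow> real) \<Rightarrow> real mat" where
  "M_mat P \<beta> \<gamma>' = mat_of_cols (sys_dim P)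
     (map (\<lambda>i. v_vec P (\<beta> i)) [1..<num_up P + 2] @
      map (\<lambda>j. v_vec P (- \<gamma>' j)) [1..<num_down P + 2])"

definition N_mat :: "mejd \<Rightarrow> (nat \<Rightarrow> real) \<Rightarrow> (nat \<Rightarrow> real) \<Rightarrow> real mat" where
  "N_mat P \<gamma> \<beta>' = mat_of_cols (sys_dim P)
     (map (\<lambda>j. v_vec P (- \<gamma> j)) [1..<num_down P + 2] @
      map (\<lambda>i. v_vec P (\<beta>' i)) [1..<num_up P + 2])"

definition Z_beta :: "mejd \<Rightarrow> real \<Rightarrow> real \<Rightarrow> (nat \<Rightarrow> real) \<Rightarrow> real mat" where
  "Z_beta P h H \<beta>' = mat_diag (sys_dim P)
     (\<lambda>k. (replicate (num_down P + 1) 0 @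
           map (\<lambda>i. exp (\<beta>' i * (h - H))) [1..<num_up P + 2]) ! k)"

definition Z_gamma :: "mejd \<Rightarrow> real \<Rightarrow> real \<Rightarrow> (nat \<Rightarrow> real) \<Rightarrow> real mat" where
  "Z_gamma P h H \<gamma>' = mat_diag (sys_dim P)
     (\<lambda>k. (replicate (num_up P + 1) 0 @
           map (\<lambda>j. exp (\<gamma>' j * (h - H))) [1..<num_down P + 2]) ! k)"

definition B_mat ::
    "mejd \<Rightarrow> real \<Rightarrow> real \<Rightarrow> (nat \<Rightarrow> real) \<Rightarrow> (nat \<Rightarrow> real) \<Rightarrow> (nat \<Rightarrow> real) \<Rightarrow> (nat \<Rightarrow> real) \<Rightarrow> real mat" where
  "B_mat P h H \<beta> \<gamma> \<beta>' \<gamma>' = four_block_mat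
     (M_mat P \<beta> \<gamma>')                    (N_mat P \<gamma> \<beta>' * Z_beta P h H \<beta>')
     (M_mat P \<beta> \<gamma>' * Z_gamma P h H \<gamma>') (N_mat P \<gamma> \<beta>')"

definition V_vec :: "mejd \<Rightarrow> real \<Rightarrow> real \<Rightarrow> real \<Rightarrow> real \<Rightarrow> real \<Rightarrow> real vec" where
  "V_vec P h H g c\<^sub>U c\<^sub>0 =
     (c\<^sub>U - c\<^sub>0) \<cdot>\<^sub>v ((exp (g * h) \<cdot>\<^sub>v v_vec P g) @\<^sub>v (exp (g * H) \<cdot>\<^sub>v v_vec P g))"

definition Q_vec ::
    "mejd \<Rightarrow> (nat \<Rightarrow> real) \<Rightarrow> (nat \<Rightarrow> real) \<Rightarrow> (nat \<Rightarrow> real) \<Rightarrow> (nat \<Rightarrow> real) \<Rightarrow> real vec" where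
  "Q_vec P \<omega>\<^sub>L \<nu>\<^sub>0 \<nu>\<^sub>U \<omega>\<^sub>0 = vec_of_list
     (map \<omega>\<^sub>L [1..<num_up P + 2] @ map \<nu>\<^sub>0 [1..<num_down P + 2] @
      map \<nu>\<^sub>U [1..<num_down P + 2] @ map \<omega>\<^sub>0 [1..<num_up P + 2])"

text \<open>The payoff inside the expectation, as a function of the sample point.\<close>

definition discounted_payoff ::
    "real \<Rightarrow> real \<Rightarrow> real \<Rightarrow> real \<Rightarrow> (real \<Rightarrow> 'a \<Rightarrow> real) \<Rightarrow> real \<Rightarrow> 'a \<Rightarrow> real" where
  "discounted_payoff h H \<rho> g X T \<omega> =
     exp (- \<rho> * (LBINT t:{0..T}. indicator {h<..<H} (X t \<omega>)) + g * X T \<omega>)"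

end

theory Submission
  imports Defs "Jordan_Normal_Form.Determinant"
begin

text \<open>
  Let \<open>U\<close> be the \<open>\<alpha>\<close>-resolvent of \<open>X\<close>, let \<open>D = {h<..<H}\<close>, let \<open>A\<^sub>T\<close> be the time spent in \<open>D\<close>, and let \<open>K\<^sub>x\<close>
  be the discounted occupation measure of \<open>X\<close> started at \<open>x\<close> and weighted by \<open>exp (- \<rho> A\<^sub>T)\<close>.
  The identity \<open>exp (- \<rho> A\<^sub>T) = 1 - \<rho> \<integral>\<^sub>0\<^sup>T 1\<^sub>D (X\<^sub>s) exp (- \<rho> A\<^sub>s) ds\<close> and the independence of
  \<open>X\<^sub>T - X\<^sub>s\<close> from the past up to \<open>s\<close> give \<open>\<integral> (w + \<rho> 1\<^sub>D U w) dK\<^sub>x = U w x\<close>. Hence the left-hand side of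
  the theorem equals \<open>U w x\<close> as soon as \<open>w + \<rho> 1\<^sub>D U w = \<alpha> exp (\<gamma> \<cdot>)\<close>.

  The asserted formula plus \<open>c\<^sub>U exp (\<gamma> x)\<close> is an integrable, piecewise exponential function \<open>f\<close>,
  and the equation to verify is \<open>f = U (- \<rho> 1\<^sub>D (f - c\<^sub>U exp (\<gamma> \<cdot>)))\<close>. Both sides are compared by their
  Fourier transforms, \<open>U\<close> acting as multiplication by \<open>1 / (\<alpha> - G s)\<close>, \<open>s\<close> imaginary. The transform of
  \<open>f\<close> is a combination of terms \<open>1 / (z - s)\<close> over the nodes \<open>z\<close> (roots and \<open>\<gamma>\<close>), and
  \<open>(G z - G s) / (z - s)\<close> is a linear functional of the vector \<open>v z\<close>; therefore \<open>B Q = V\<close> says exactly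
  that \<open>\<alpha> - G s\<close> may be replaced by \<open>\<alpha> - G z\<close>, which is \<open>0\<close> or \<open>- \<rho>\<close> at the roots.

  The same verification with right-hand side \<open>0\<close> shows that \<open>B Q = 0\<close> forces \<open>f = 0\<close> and hence \<open>Q = 0\<close>,
  so that \<open>B\<close> is invertible and a solution \<open>Q\<close> exists.\<close>

section \<open>Measure-theoretic and algebraic preliminaries\<close>

text \<open>The coefficients are verified through the resolvent and not derived from an
  integro-differential equation, so no smoothness of the expectation in \<open>x\<close> has to be
  known beforehand. The motion is weighted up to \<open>s\<close> and free afterwards; in this order
  independence is used at the fixed time \<open>s\<close> only and the killing functional is never
  shifted. The complication is that the index of the next jump is the random number
  \<open>N s + 1\<close>, so the argument is run on each event \<open>N s = k\<close> separately.
  The Fourier comparison yields equality almost everywhere; to have it at every \<open>x\<close>,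
  both sides must be continuous. For the resolvent this holds because a positive volatility, forced
  by the number of roots, removes its atoms. The constants come from the resolvent on exponentials:
  at killing rate \<open>a\<close> the function \<open>\<alpha> exp (\<gamma> x)\<close> is
  multiplied by \<open>1 / (a - G \<gamma>)\<close>, with \<open>a = \<alpha>\<close> outside the
  corridor and \<open>a = \<alpha> + \<rho>\<close> inside, which gives \<open>- c\<^sub>U\<close>
  and \<open>- c\<^sub>0\<close>. Adding \<open>c\<^sub>U exp (\<gamma> x)\<close> cancels the part
  that is not integrable on the line.\<close>

lemma borel_measurable_right_continuous_process:
  fixes Z :: "real \<Rightarrow> 'a \<Rightarrow> real"
  assumes meas: "\<And>r. 0 \<le> r \<Longrightarrow> Z r \<in> borel_measurable G"
    and cont: "\<And>\<omega> r. \<omega> \<in> space G \<Longrightarrow> 0 \<le> r \<Longrightarrow> continuous (at_right r) (\<lambda>r. Z r \<omega>)"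
  shows "(\<lambda>(r, \<omega>). Z (max 0 r) \<omega>) \<in> borel_measurable (borel \<Otimes>\<^sub>M G)"
proof -
  define grid :: "nat \<Rightarrow> real \<Rightarrow> nat" where "grid n r = nat \<lfloor>real (Suc n) * max 0 r\<rfloor>" for n r
  \<comment> \<open>The first point of the grid of mesh \<open>1 / Suc n\<close> strictly to the
    right of \<open>max 0 r\<close>: convergence from the right is what right continuity can use,
    and countably many values make each approximant measurable.\<close>
  define \<tau> where "\<tau> n r = real (Suc (grid n r)) / real (Suc n)" for n r
  have grid_meas: "(\<lambda>p. grid n (fst p)) \<in> measurable (borel \<Otimes>\<^sub>M G) (count_space UNIV)" for n
    unfolding grid_def by measurable
  have step_meas: "(\<lambda>p. Z (\<tau> n (fst p)) (snd p)) \<in> borel_measurable (borel \<Otimes>\<^sub>M G)" for n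
    unfolding \<tau>_def
    by (rule measurable_compose_countable[OF _ grid_meas, where f="\<lambda>i p. Z (real (Suc i) / real (Suc n)) (snd p)"])
       (intro measurable_compose[OF measurable_snd meas], simp)
  have \<tau>_bounds: "max 0 r < \<tau> n r \<and> \<tau> n r \<le> max 0 r + 1 / real (Suc n)" for n r
  proof -
    have g: "real (grid n r) = of_int \<lfloor>real (Suc n) * max 0 r\<rfloor>"
      unfolding grid_def by (simp add: max_def del: of_nat_Suc)
    have "real (Suc n) * max 0 r < real (Suc (grid n r))" "real (grid n r) \<le> real (Suc n) * max 0 r"
      unfolding of_nat_Suc[of "grid n r"] g by linarith+
    then have "max 0 r < \<tau> n r" "real (grid n r) / real (Suc n) \<le> max 0 r"
      unfolding \<tau>_def by (simp_all add: divide_simps mult.commute del: of_nat_Suc)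
    moreover have "\<tau> n r = real (grid n r) / real (Suc n) + 1 / real (Suc n)"
      unfolding \<tau>_def by (simp add: add_divide_distrib)
    ultimately show ?thesis by linarith
  qed
  have \<tau>_lim: "filterlim (\<lambda>n. \<tau> n r) (at_right (max 0 r)) sequentially" for r
  proof -
    have "(\<lambda>n. \<tau> n r) \<longlonglongrightarrow> max 0 r"
    proof (rule tendsto_sandwich[where f="\<lambda>_. max 0 r" and h="\<lambda>n. max 0 r + 1 / real (Suc n)"])
      show "(\<lambda>n. max 0 r + 1 / real (Suc n)) \<longlonglongrightarrow> max 0 r"
        using tendsto_add[OF tendsto_const LIMSEQ_Suc[OF lim_inverse_n'], of "max 0 r"] by simp
      show "\<forall>\<^sub>F n in sequentially. max 0 r \<le> \<tau> n r"
        using \<tau>_bounds[of r] by (intro always_eventually allI) (blast intro: less_imp_le)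
      show "\<forall>\<^sub>F n in sequentially. \<tau> n r \<le> max 0 r + 1 / real (Suc n)"
        using \<tau>_bounds[of r] by (intro always_eventually allI) blast
    qed (rule tendsto_const)
    then show ?thesis
      using \<tau>_bounds[of r] by (intro tendsto_imp_filterlim_at_right always_eventually allI) blast+
  qed
  have "(\<lambda>p :: real \<times> 'a. Z (max 0 (fst p)) (snd p)) \<in> borel_measurable (borel \<Otimes>\<^sub>M G)"
  proof (rule borel_measurable_LIMSEQ_real[OF _ step_meas])
    fix p :: "real \<times> 'a" assume "p \<in> space (borel \<Otimes>\<^sub>M G)"
    then have "snd p \<in> space G" by (auto simp: space_pair_measure)
    then have "((\<lambda>r. Z r (snd p)) \<longlongrightarrow> Z (max 0 (fst p)) (snd p)) (at_right (max 0 (fst p)))"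
      using cont[of "snd p" "max 0 (fst p)"] by (simp add: continuous_within)
    then show "(\<lambda>n. Z (\<tau> n (fst p)) (snd p)) \<longlonglongrightarrow> Z (max 0 (fst p)) (snd p)"
      by (rule filterlim_compose[OF _ \<tau>_lim])
  qed
  then show ?thesis by (simp add: case_prod_beta')
qed

lemma borel_measurable_indefinite_integral:
  fixes f :: "'a \<Rightarrow> real \<Rightarrow> real"
  assumes [measurable]: "(\<lambda>(x, r). f x r) \<in> borel_measurable (M \<Otimes>\<^sub>M borel)" "g \<in> borel_measurable M"
  shows "(\<lambda>x. LBINT r:{0..g x}. f x r) \<in> borel_measurable M"
proof -
  have "(\<lambda>x. \<integral>r. (if 0 \<le> r \<and> r \<le> g x then f x r else 0) \<partial>lborel) \<in> borel_measurable M"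
    by measurable
  then show ?thesis
    unfolding set_lebesgue_integral_def by (rule measurable_cong[THEN iffD1, rotated])
      (auto intro!: Bochner_Integration.integral_cong split: split_indicator)
qed

text \<open>The defect of the identity is \<open>O((t - s)\<^sup>2)\<close> over \<open>[s, t]\<close>, hence constant; this
  replaces the Lebesgue differentiation theorem, the integrand being merely measurable.\<close>

lemma exp_occupation_identity:
  fixes b :: "real \<Rightarrow> real"
  assumes [measurable]: "b \<in> borel_measurable borel" and b: "\<And>t. 0 \<le> b t" "\<And>t. b t \<le> 1"
    and "0 \<le> \<rho>" "0 \<le> T"
  defines "A \<equiv> \<lambda>t. LBINT r:{0..t}. b r"
  shows "exp (- \<rho> * A T) + \<rho> * (LBINT s:{0..T}. b s * exp (- \<rho> * A s)) = 1"
proof -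
  have int_b: "set_integrable lborel S f" if "S \<subseteq> {0..t}" "S \<in> sets borel" "f \<in> borel_measurable borel"
     "\<And>x. x \<in> {0..t} \<Longrightarrow> \<bar>f x\<bar> \<le> 1" for S t and f :: "real \<Rightarrow> real"
  proof -
    have "set_integrable lborel {0..t} f"
      unfolding set_integrable_def
      by (rule Bochner_Integration.integrable_bound[of _ "indicator {0..t} :: real \<Rightarrow> real"])
         (use that in \<open>auto simp: indicator_def emeasure_lborel_Icc_eq intro!: integrable_real_indicator\<close>)
    then show ?thesis by (rule set_integrable_subset) (use that in auto)
  qed
  have split: "(LBINT r:{0..t}. f r) = (LBINT r:{0..s}. f r) + (LBINT r:{s<..t}. f r)"
    if "0 \<le> s" "s \<le> t" "f \<in> borel_measurable borel" "\<And>x. x \<in> {0..t} \<Longrightarrow> \<bar>f x\<bar> \<le> 1" for s t and f :: "real \<Rightarrow> real"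
  proof -
    have "{0..t} = {0..s} \<union> {s<..t}" using that by auto
    then show ?thesis using that by (subst set_integral_Un[symmetric]) (auto intro!: int_b[of _ t])
  qed
  have bnd: "0 \<le> (LBINT r:{s<..t}. f r) \<and> (LBINT r:{s<..t}. f r) \<le> c * (t - s)"
    if "0 \<le> s" "s \<le> t" "f \<in> borel_measurable borel" "\<And>x. x \<in> {s<..t} \<Longrightarrow> 0 \<le> f x \<and> f x \<le> c" "0 \<le> c" for s t c and f :: "real \<Rightarrow> real"
  proof -
    have "integrable lborel (\<lambda>r. indicator {s<..t} r *\<^sub>R c)"
      using that by (intro integrable_scaleR_left integrable_real_indicator) auto
    then have "(LBINT r:{s<..t}. f r) \<le> (LBINT r:{s<..t}. c)"
      unfolding set_lebesgue_integral_def
      by (rule integral_mono') (use that in \<open>auto split: split_indicator\<close>)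
    moreover have "0 \<le> (LBINT r:{s<..t}. f r)"
      unfolding set_lebesgue_integral_def
      by (rule integral_nonneg_AE) (use that in \<open>auto simp: indicator_def\<close>)
    ultimately show ?thesis using that by (simp add: set_integral_const mult.commute)
  qed
  have A_meas[measurable]: "A \<in> borel_measurable borel"
    unfolding A_def by (rule borel_measurable_indefinite_integral) measurable
  have A_nonneg: "0 \<le> A t" for t
    unfolding A_def set_lebesgue_integral_def
    by (rule integral_nonneg_AE) (use b in \<open>auto simp: indicator_def\<close>)
  define I where "I t = (LBINT s:{0..t}. b s * exp (- \<rho> * A s))" for t
  define D where "D t = exp (- \<rho> * A t) + \<rho> * I t" for t
  have integrand: "0 \<le> b s * exp (- \<rho> * A s) \<and> b s * exp (- \<rho> * A s) \<le> 1" for s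
    using b[of s] A_nonneg[of s] \<open>0 \<le> \<rho>\<close> by (auto intro!: mult_le_one)
  have quad: "\<bar>D t - D s\<bar> \<le> 2 * \<rho>\<^sup>2 * (t - s)\<^sup>2" if st: "0 \<le> s" "s \<le> t" for s t
  proof -
    define \<delta> where "\<delta> = (LBINT r:{s<..t}. b r)"
    have A_inc: "A r' = A r + (LBINT u:{r<..r'}. b u)" if "0 \<le> r" "r \<le> r'" for r r'
      unfolding A_def using that b by (intro split) (auto simp: abs_le_iff intro: order_trans[of _ 0])
    have \<delta>: "0 \<le> \<delta> \<and> \<delta> \<le> t - s"
      unfolding \<delta>_def using bnd[of s t b 1] st b by auto
    have I_inc: "I t = I s + (LBINT r:{s<..t}. b r * exp (- \<rho> * A r))"
      unfolding I_def using st integrand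
      by (intro split) (auto simp: abs_le_iff intro: order_trans[of _ 0])
    have int1: "set_integrable lborel {s<..t} b"
      using st b by (intro int_b[of _ t]) (auto simp: abs_le_iff intro: order_trans[of _ 0])
    have int2: "set_integrable lborel {s<..t} (\<lambda>r. b r * exp (- \<rho> * A r))"
      using st integrand by (intro int_b[of _ t]) (auto simp: abs_le_iff intro: order_trans[of _ 0])
    \<comment> \<open>The error made by freezing \<open>exp (- \<rho> * A r)\<close> at its value at
      \<open>s\<close>. With \<open>q\<close> below, the second-order remainder of the exponential,
      the increment of \<open>D\<close> is \<open>exp (- \<rho> * A s) * q - \<rho> * J\<close>, and
      both terms lie between 0 and \<open>\<rho>\<^sup>2 * (t - s)\<^sup>2\<close>.\<close>
    define J where "J = (LBINT r:{s<..t}. b r * (exp (- \<rho> * A s) - exp (- \<rho> * A r)))"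
    have J_eq: "J = exp (- \<rho> * A s) * \<delta> - (LBINT r:{s<..t}. b r * exp (- \<rho> * A r))"
      unfolding J_def \<delta>_def
      using set_integral_diff(2)[OF set_integrable_mult_right[OF int1, of "exp (- \<rho> * A s)"] int2]
      by (simp add: algebra_simps)
    have "0 \<le> J \<and> J \<le> (\<rho> * (t - s)) * (t - s)"
      unfolding J_def
    proof (rule bnd)
      fix r assume r: "r \<in> {s<..t}"
      have "0 \<le> A r - A s \<and> A r - A s \<le> r - s"
        using A_inc[of s r] bnd[of s r b 1] st r b by auto
      then have *: "0 \<le> \<rho> * (A r - A s)" "\<rho> * (A r - A s) \<le> \<rho> * (t - s)"
        using \<open>0 \<le> \<rho>\<close> r by (auto intro!: mult_left_mono)
      have "exp (- \<rho> * A s) - exp (- \<rho> * A r) = exp (- \<rho> * A s) * (1 - exp (- (\<rho> * (A r - A s))))"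
        by (simp add: algebra_simps flip: exp_add)
      moreover have "0 \<le> 1 - exp (- (\<rho> * (A r - A s)))" "1 - exp (- (\<rho> * (A r - A s))) \<le> \<rho> * (t - s)"
        using * exp_ge_add_one_self[of "- (\<rho> * (A r - A s))"] by auto
      moreover have "0 \<le> exp (- \<rho> * A s)" "exp (- \<rho> * A s) \<le> 1"
        using A_nonneg[of s] \<open>0 \<le> \<rho>\<close> by auto
      ultimately have "0 \<le> exp (- \<rho> * A s) - exp (- \<rho> * A r) \<and> exp (- \<rho> * A s) - exp (- \<rho> * A r) \<le> 1 * (\<rho> * (t - s))"
        using mult_mono[of "exp (- \<rho> * A s)" 1 "1 - exp (- (\<rho> * (A r - A s)))" "\<rho> * (t - s)"] by auto
      then show "0 \<le> b r * (exp (- \<rho> * A s) - exp (- \<rho> * A r)) \<and> b r * (exp (- \<rho> * A s) - exp (- \<rho> * A r)) \<le> \<rho> * (t - s)"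
        using b[of r] mult_mono[of "b r" 1 "exp (- \<rho> * A s) - exp (- \<rho> * A r)" "\<rho> * (t - s)"] by auto
    qed (use st \<open>0 \<le> \<rho>\<close> in auto)
    then have J_bnd: "0 \<le> \<rho> * J" "\<rho> * J \<le> \<rho>\<^sup>2 * (t - s)\<^sup>2"
      using \<open>0 \<le> \<rho>\<close> mult_left_mono[of J "\<rho> * (t - s) * (t - s)" \<rho>] by (auto simp: power2_eq_square algebra_simps)
    define q where "q = exp (- (\<rho> * \<delta>)) - 1 + \<rho> * \<delta>"
    have q: "0 \<le> q" "q \<le> (\<rho> * \<delta>)\<^sup>2"
    proof -
      show "0 \<le> q" unfolding q_def using exp_ge_add_one_self[of "- (\<rho> * \<delta>)"] by linarith
      have *: "0 \<le> \<rho> * \<delta>" using \<delta> \<open>0 \<le> \<rho>\<close> by auto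
      \<comment> \<open>Comparison with \<open>1 / (1 + y)\<close> for
        \<open>y = \<rho> * \<delta>\<close> gives the quadratic remainder bound without a Taylor
        expansion.\<close>
      have "exp (- (\<rho> * \<delta>)) \<le> 1 / (1 + \<rho> * \<delta>)"
        using exp_ge_add_one_self[of "\<rho> * \<delta>"] * by (simp add: exp_minus field_simps)
      also have "\<dots> \<le> 1 - \<rho> * \<delta> + (\<rho> * \<delta>)\<^sup>2"
      proof -
        have "1 \<le> (1 - \<rho> * \<delta> + (\<rho> * \<delta>)\<^sup>2) * (1 + \<rho> * \<delta>)"
          using * zero_le_power[OF *, of 3] by (simp add: algebra_simps power2_eq_square power3_eq_cube)
        then show ?thesis using * by (simp add: divide_le_eq)
      qed
      finally show "q \<le> (\<rho> * \<delta>)\<^sup>2" unfolding q_def by linarith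
    qed
    have "(\<rho> * \<delta>)\<^sup>2 \<le> \<rho>\<^sup>2 * (t - s)\<^sup>2"
      using \<delta> by (auto simp: power_mult_distrib intro!: mult_left_mono power_mono)
    then have q': "0 \<le> exp (- \<rho> * A s) * q" "exp (- \<rho> * A s) * q \<le> \<rho>\<^sup>2 * (t - s)\<^sup>2"
      using q A_nonneg[of s] \<open>0 \<le> \<rho>\<close> mult_mono[of "exp (- \<rho> * A s)" 1 q "\<rho>\<^sup>2 * (t - s)\<^sup>2"] by auto
    have "exp (- \<rho> * A t) = exp (- \<rho> * A s) * exp (- (\<rho> * \<delta>))"
      using A_inc[OF st] unfolding \<delta>_def by (simp add: algebra_simps flip: exp_add)
    then have "D t - D s = exp (- \<rho> * A s) * q - \<rho> * J"
      unfolding D_def I_inc J_eq q_def by (simp add: algebra_simps)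
    then show ?thesis using q' J_bnd by linarith
  qed
  have "\<exists>c. \<forall>x\<in>{0..T}. D x = c"
  proof (rule has_field_derivative_zero_constant)
    fix x assume x: "x \<in> {0..T}"
    have "((\<lambda>y. (D y - D x) / (y - x)) \<longlongrightarrow> 0) (at x within {0..T})"
    proof (rule Lim_null_comparison)
      have "norm ((D y - D x) / (y - x)) \<le> 2 * \<rho>\<^sup>2 * \<bar>y - x\<bar>" if "y \<in> {0..T}" "y \<noteq> x" for y
      proof -
        have "\<bar>D y - D x\<bar> \<le> 2 * \<rho>\<^sup>2 * (y - x)\<^sup>2"
          using quad[of x y] quad[of y x] x that by (cases "x \<le> y") (auto simp: abs_minus_commute power2_commute)
        also have "\<dots> = 2 * \<rho>\<^sup>2 * \<bar>y - x\<bar> * \<bar>y - x\<bar>"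
          by (simp add: power2_eq_square)
        finally show ?thesis using that by (simp add: abs_divide divide_le_eq)
      qed
      then show "\<forall>\<^sub>F y in at x within {0..T}. norm ((D y - D x) / (y - x)) \<le> 2 * \<rho>\<^sup>2 * \<bar>y - x\<bar>"
        by (auto simp: eventually_at_filter)
      show "((\<lambda>y. 2 * \<rho>\<^sup>2 * \<bar>y - x\<bar>) \<longlongrightarrow> 0) (at x within {0..T})"
        by (auto intro!: tendsto_eq_intros)
    qed
    then show "(D has_field_derivative 0) (at x within {0..T})"
      by (simp add: has_field_derivative_iff)
  qed (rule convex_real_interval)
  then have "D T = D 0" using \<open>0 \<le> T\<close> by auto
  moreover have "(LBINT r:{0..0::real}. f r) = 0" for f :: "real \<Rightarrow> real"
  proof -
    have *: "indicator {0..0} r *\<^sub>R f r = indicator {0} r *\<^sub>R f 0" for r :: real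
      by (auto split: split_indicator)
    show ?thesis unfolding set_lebesgue_integral_def * by simp
  qed
  ultimately show ?thesis by (simp add: D_def I_def A_def)
qed

section \<open>Exponential integrals, uniqueness of Fourier transforms, exponential sums and
  rational functions\<close>

lemma has_vector_derivative_cexp_scaled:
  fixes z :: complex
  assumes "z \<noteq> 0"
  shows "((\<lambda>x. exp (z * of_real x) / z) has_vector_derivative exp (z * of_real x)) (at x within S)"
  by (rule has_vector_derivative_real_field)
     (use assms in \<open>auto intro!: derivative_eq_intros simp: field_simps\<close>)

lemma tendsto_exp_neg_mult_at_top:
  fixes c :: real
  assumes "c < 0"
  shows "((\<lambda>x. exp (c * x)) \<longlongrightarrow> 0) at_top"
proof -
  have "filterlim (\<lambda>x. c * x) at_bot at_top"
    using assms by (auto intro!: filterlim_tendsto_neg_mult_at_bot filterlim_ident tendsto_const)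
  then show ?thesis by (rule filterlim_compose[OF exp_at_bot])
qed

lemma integrable_cexp_Ioi:
  fixes z :: complex
  assumes "Re z < 0"
  shows "integrable lborel (\<lambda>x. indicator {a<..} x *\<^sub>R exp (z * of_real x))"
proof -
  let ?c = "Re z"
  have "(\<integral>\<^sup>+x. ennreal (exp (?c * x)) * indicator {a ..} x \<partial>lborel) = ennreal (0 - exp (?c * a) / ?c)"
  proof (rule nn_integral_FTC_atLeast)
    show "((\<lambda>x. exp (?c * x) / ?c) \<longlongrightarrow> 0) at_top"
      by (rule tendsto_divide_zero) (rule tendsto_exp_neg_mult_at_top[OF assms])
  qed (use assms in \<open>auto intro!: derivative_eq_intros\<close>)
  then have "(\<integral>\<^sup>+x. ennreal (exp (?c * x)) * indicator {a ..} x \<partial>lborel) < \<infinity>" by simp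
  moreover have "(\<integral>\<^sup>+x. ennreal (norm (indicator {a<..} x *\<^sub>R exp (z * of_real x))) \<partial>lborel) \<le>
      (\<integral>\<^sup>+x. ennreal (exp (?c * x)) * indicator {a ..} x \<partial>lborel)"
    by (intro nn_integral_mono) (auto split: split_indicator simp: norm_exp_eq_Re)
  ultimately show ?thesis
    by (intro integrableI_bounded) (auto simp: le_less_trans)
qed

lemma has_bochner_integral_cexp_Ioi:
  fixes z :: complex
  assumes "Re z < 0"
  shows "has_bochner_integral lborel (\<lambda>x. indicator {a<..} x *\<^sub>R exp (z * of_real x)) (- exp (z * of_real a) / z)"
proof -
  have z: "z \<noteq> 0" using assms by auto
  have "(LBINT x=ereal a..\<infinity>. exp (z * of_real x)) = 0 - exp (z * of_real a) / z"
  proof (rule interval_integral_FTC_integrable)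
    show "set_integrable lborel (einterval (ereal a) \<infinity>) (\<lambda>x. exp (z * complex_of_real x))"
      using integrable_cexp_Ioi[OF assms, of a] by (simp add: set_integrable_def)
    show "(((\<lambda>x. exp (z * complex_of_real x) / z) \<circ> real_of_ereal) \<longlongrightarrow> exp (z * of_real a) / z) (at_right (ereal a))"
      unfolding ereal_tendsto_simps
      by (rule tendsto_within_subset[of _ _ _ UNIV]) (use z in \<open>auto intro!: tendsto_eq_intros\<close>)
    have "((\<lambda>x. exp (z * complex_of_real x)) \<longlongrightarrow> 0) at_top"
      by (intro tendsto_norm_zero_cancel[of "\<lambda>x. exp (z * complex_of_real x)"])
         (simp add: norm_exp_eq_Re tendsto_exp_neg_mult_at_top[OF assms])
    then show "(((\<lambda>x. exp (z * complex_of_real x) / z) \<circ> real_of_ereal) \<longlongrightarrow> 0) (at_left \<infinity>)"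
      unfolding ereal_tendsto_simps by (rule tendsto_divide_zero)
  qed (use has_vector_derivative_cexp_scaled[OF z] in \<open>auto intro!: continuous_intros\<close>)
  then show ?thesis
    using integrable_cexp_Ioi[OF assms, of a]
    by (simp add: interval_integral_to_infinity_eq set_lebesgue_integral_def has_bochner_integral_iff)
qed

lemma has_bochner_integral_cexp_Iio:
  fixes z :: complex
  assumes "0 < Re z"
  shows "has_bochner_integral lborel (\<lambda>x. indicator {..<a} x *\<^sub>R exp (z * of_real x)) (exp (z * of_real a) / z)"
proof -
  have "has_bochner_integral lborel (\<lambda>x. indicator {- a<..} x *\<^sub>R exp (- z * of_real x)) (- exp (- z * of_real (- a)) / - z)"
    by (rule has_bochner_integral_cexp_Ioi) (use assms in simp)
  from lborel_has_bochner_integral_real_affine_iff[where c="-1" and t=0, THEN iffD1, OF _ this]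
  have "has_bochner_integral lborel (\<lambda>x. indicator {- a<..} (- x) *\<^sub>R exp (z * of_real x)) (exp (z * of_real a) / z)"
    by simp
  moreover have "indicator {- a<..} (- x) = (indicator {..<a} x :: real)" for x
    by (auto split: split_indicator)
  ultimately show ?thesis by simp
qed

lemma has_bochner_integral_cexp_Ioo:
  fixes z :: complex
  assumes "z \<noteq> 0" "a < b"
  shows "has_bochner_integral lborel (\<lambda>x. indicator {a<..<b} x *\<^sub>R exp (z * of_real x))
    ((exp (z * of_real b) - exp (z * of_real a)) / z)"
proof -
  have "has_bochner_integral lborel (\<lambda>x. indicator {a..b} x *\<^sub>R exp (z * of_real x))
    (exp (z * of_real b) / z - exp (z * of_real a) / z)"
    using assms
    by (intro has_bochner_integral_FTC_Icc has_vector_derivative_cexp_scaled continuous_intros) auto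
  then show ?thesis
    by (subst has_bochner_integral_discrete_difference[where X="{a, b}" and g="\<lambda>x. indicator {a..b} x *\<^sub>R exp (z * of_real x)"])
       (auto split: split_indicator simp: diff_divide_distrib)
qed

text \<open>Reduction to the uniqueness of characteristic functions: the positive and negative parts
  \<open>p\<close>, \<open>q\<close> of \<open>f - g\<close> have the same transform, hence the same
  mass \<open>c\<close>, and divided by \<open>c\<close> they are probability densities. Frequency 0
  is left out of the hypothesis because the transforms to be compared involve
  \<open>1 / (z - s)\<close> with a node \<open>z\<close> that may be 0; it is recovered by
  dominated convergence along \<open>1 / Suc n\<close>.\<close>

lemma fourier_transform_eq_imp_AE_eq:
  fixes f g :: "real \<Rightarrow> real"
  assumes f: "integrable lborel f" and g: "integrable lborel g"
    and eq: "\<And>\<xi>. \<xi> \<noteq> 0 \<Longrightarrow> (CLBINT x. iexp (\<xi> * x) * f x) = (CLBINT x. iexp (\<xi> * x) * g x)"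
  shows "AE x in lborel. f x = g x"
proof -
  note [measurable] = borel_measurable_integrable[OF f] borel_measurable_integrable[OF g]
  define p where "p x = max (f x - g x) 0" for x
  define q where "q x = max (g x - f x) 0" for x
  have int: "integrable lborel p" "integrable lborel q"
    unfolding p_def q_def using f g by auto
  note [measurable] = borel_measurable_integrable[OF int(1)] borel_measurable_integrable[OF int(2)]
  have intF: "integrable lborel (\<lambda>x. iexp (\<xi> * x) * complex_of_real (h x))" if "integrable lborel h" for h :: "real \<Rightarrow> real" and \<xi>
    by (rule Bochner_Integration.integrable_bound[OF that])
       (use borel_measurable_integrable[OF that] in \<open>auto simp: norm_mult\<close>)
  have nz: "(CLBINT x. iexp (\<xi> * x) * p x) = (CLBINT x. iexp (\<xi> * x) * q x)" if "\<xi> \<noteq> 0" for \<xi>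
  proof -
    have "(CLBINT x. iexp (\<xi> * x) * p x) - (CLBINT x. iexp (\<xi> * x) * q x)
        = (CLBINT x. iexp (\<xi> * x) * p x - iexp (\<xi> * x) * q x)"
      by (rule Bochner_Integration.integral_diff[symmetric]) (intro intF int)+
    also have "\<dots> = (CLBINT x. iexp (\<xi> * x) * f x - iexp (\<xi> * x) * g x)"
      by (rule Bochner_Integration.integral_cong)
         (auto simp: p_def q_def max_def algebra_simps)
    also have "\<dots> = 0"
      using eq[OF that] intF[OF f] intF[OF g] by simp
    finally show ?thesis by simp
  qed
  have lim: "(\<lambda>n. CLBINT x. iexp (1 / real (Suc n) * x) * h x) \<longlonglongrightarrow> (CLBINT x. iexp (0 * x) * h x)"
    if h: "integrable lborel h" for h :: "real \<Rightarrow> real"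
  proof (rule integral_dominated_convergence[where w="\<lambda>x. \<bar>h x\<bar>"])
    note [measurable] = borel_measurable_integrable[OF h]
    show "AE x in lborel. (\<lambda>n. iexp (1 / real (Suc n) * x) * h x) \<longlonglongrightarrow> iexp (0 * x) * h x"
    proof (intro AE_I2)
      fix x
      have "(\<lambda>n. 1 / real (Suc n)) \<longlonglongrightarrow> 0" using LIMSEQ_Suc[OF lim_1_over_n] by simp
      then have "(\<lambda>n. 1 / real (Suc n) * x) \<longlonglongrightarrow> 0 * x" by (rule tendsto_mult_right)
      then have "(\<lambda>n. complex_of_real (1 / real (Suc n) * x)) \<longlonglongrightarrow> complex_of_real (0 * x)"
        by (rule tendsto_of_real)
      then show "(\<lambda>n. iexp (1 / real (Suc n) * x) * h x) \<longlonglongrightarrow> iexp (0 * x) * h x"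
        by (intro tendsto_mult tendsto_exp tendsto_const)
    qed
  qed (use h in \<open>auto simp: norm_mult borel_measurable_integrable\<close>)
  have FT: "(CLBINT x. iexp (\<xi> * x) * p x) = (CLBINT x. iexp (\<xi> * x) * q x)" for \<xi>
  proof (cases "\<xi> = 0")
    case True
    then show ?thesis
      using LIMSEQ_unique[OF lim[OF int(1)]] lim[OF int(2)] by (subst (asm) nz) auto
  qed (rule nz)
  define c where "c = integral\<^sup>L lborel p"
  have c: "integral\<^sup>L lborel p = c" "integral\<^sup>L lborel q = c"
  proof -
    have "complex_of_real (integral\<^sup>L lborel p) = complex_of_real (integral\<^sup>L lborel q)"
      using FT[of 0] by simp
    then show "integral\<^sup>L lborel q = c" by (simp add: c_def)
  qed (simp add: c_def)
  have nonneg: "0 \<le> p x" "0 \<le> q x" for x by (auto simp: p_def q_def)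
  have "AE x in lborel. p x = q x"
  proof (cases "c = 0")
    case True
    then have "AE x in lborel. p x = 0" "AE x in lborel. q x = 0"
      using c integral_nonneg_eq_0_iff_AE[OF int(1)] integral_nonneg_eq_0_iff_AE[OF int(2)] nonneg by auto
    then show ?thesis by eventually_elim simp
  next
    case False
    then have "0 < c" using c(1) integral_nonneg_AE[of p lborel] nonneg by auto
    have dist: "real_distribution (density lborel (\<lambda>x. ennreal (h x / c)))"
      and char: "char (density lborel (\<lambda>x. ennreal (h x / c))) \<xi> = (CLBINT x. iexp (\<xi> * x) * h x) / c"
      if h: "integrable lborel h" "\<And>x. 0 \<le> h x" "integral\<^sup>L lborel h = c" for h \<xi>
    proof -
      note [measurable] = borel_measurable_integrable[OF h(1)]
      have "emeasure (density lborel (\<lambda>x. ennreal (h x / c))) UNIV = (\<integral>\<^sup>+x. ennreal (h x / c) \<partial>lborel)"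
        by (simp add: emeasure_density)
      also have "\<dots> = ennreal (\<integral>x. h x / c \<partial>lborel)"
        using h \<open>0 < c\<close> by (intro nn_integral_eq_integral) auto
      also have "\<dots> = 1" using h False by simp
      finally show "real_distribution (density lborel (\<lambda>x. ennreal (h x / c)))"
        by (intro real_distribution.intro prob_spaceI real_distribution_axioms.intro) auto
      have "char (density lborel (\<lambda>x. ennreal (h x / c))) \<xi> = (CLBINT x. (h x / c) *\<^sub>R iexp (\<xi> * x))"
        unfolding char_def using h \<open>0 < c\<close> by (intro integral_density) auto
      also have "\<dots> = (CLBINT x. iexp (\<xi> * x) * h x / c)"
        by (intro Bochner_Integration.integral_cong) (auto simp: scaleR_conv_of_real)
      finally show "char (density lborel (\<lambda>x. ennreal (h x / c))) \<xi> = (CLBINT x. iexp (\<xi> * x) * h x) / c"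
        by simp
    qed
    have "density lborel (\<lambda>x. ennreal (p x / c)) = density lborel (\<lambda>x. ennreal (q x / c))"
      using FT by (intro Levy_uniqueness dist ext int nonneg c) (simp add: char int nonneg c)
    then have "AE x in lborel. ennreal (p x / c) = ennreal (q x / c)"
      by (subst (asm) sigma_finite_measure.density_unique_iff[OF sigma_finite_lborel]) auto
    then show ?thesis
      by eventually_elim (use nonneg \<open>0 < c\<close> in \<open>simp add: ennreal_inj\<close>)
  qed
  then show ?thesis by eventually_elim (auto simp: p_def q_def max_def split: if_splits)
qed

text \<open>Multiplying by \<open>exp (- z k * x)\<close> makes the term \<open>k\<close> constant
  and differentiating removes it. What remains is a vanishing combination of fewer exponentials with
  the distinct exponents \<open>z i - z k\<close>, whose coefficients
  \<open>c i * (z i - z k)\<close> vanish only if \<open>c i\<close> does.\<close>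

lemma exponentials_linearly_independent:
  fixes z c :: "'i \<Rightarrow> real"
  assumes "finite I" "inj_on z I" "a < b"
    and "\<And>x. a < x \<Longrightarrow> x < b \<Longrightarrow> (\<Sum>i\<in>I. c i * exp (z i * x)) = 0"
  shows "\<forall>i\<in>I. c i = 0"
  using assms
proof (induction I arbitrary: c z rule: finite_induct)
  case (insert k I)
  have sum_eq: "c k + (\<Sum>i\<in>I. c i * exp ((z i - z k) * x)) = 0" if "a < x" "x < b" for x
  proof -
    have "(\<Sum>i\<in>insert k I. c i * exp (z i * x)) * exp (- z k * x) = 0"
      using insert.prems that by simp
    then show ?thesis
      using insert.hyps by (simp add: algebra_simps sum_distrib_left sum_distrib_right flip: exp_add)
  qed
  have "(\<Sum>i\<in>I. (c i * (z i - z k)) * exp ((z i - z k) * x)) = 0" if x: "a < x" "x < b" for x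
  proof (rule DERIV_unique)
    show "((\<lambda>x. c k + (\<Sum>i\<in>I. c i * exp ((z i - z k) * x))) has_real_derivative
        (\<Sum>i\<in>I. (c i * (z i - z k)) * exp ((z i - z k) * x))) (at x)"
      by (auto intro!: derivative_eq_intros sum.cong)
    show "((\<lambda>x. c k + (\<Sum>i\<in>I. c i * exp ((z i - z k) * x))) has_real_derivative 0) (at x)"
      by (rule has_field_derivative_transform_within_open[of "\<lambda>_. 0" _ _ "{a<..<b}"])
         (use x sum_eq in \<open>auto simp: sum_eq\<close>)
  qed
  then have "\<forall>i\<in>I. c i * (z i - z k) = 0"
    using insert.prems by (intro insert.IH[of "\<lambda>i. z i - z k"]) (auto simp: inj_on_def)
  then have "\<forall>i\<in>I. c i = 0"
    using insert.prems insert.hyps by (auto simp: inj_on_def)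
  moreover have "c k = 0"
    using sum_eq[of "(a + b) / 2"] calculation \<open>a < b\<close> by (simp add: field_simps)
  ultimately show ?case by auto
qed simp

text \<open>Clearing denominators turns the zeros into roots of the polynomial \<open>q\<close> of
  degree at most \<open>card I + 1\<close>. Finiteness of the zero set is assumed in order to
  exclude \<open>q = 0\<close>, in which case every point off the poles would be a zero.\<close>

lemma card_zeros_partial_fractions_le:
  fixes e c :: "'i \<Rightarrow> real"
  assumes "finite I" and fin: "finite {x. x \<notin> e ` I \<and> a * x + b + (\<Sum>i\<in>I. c i / (e i - x)) = 0}"
  shows "card {x. x \<notin> e ` I \<and> a * x + b + (\<Sum>i\<in>I. c i / (e i - x)) = 0} \<le> card I + 1"
    (is "card ?Z \<le> _")
proof -
  define q where "q = [:b, a:] * (\<Prod>i\<in>I. [:e i, -1:]) + (\<Sum>i\<in>I. [:c i:] * (\<Prod>j\<in>I - {i}. [:e j, -1:]))"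
  have poly_q: "poly q x = (a * x + b + (\<Sum>i\<in>I. c i / (e i - x))) * (\<Prod>i\<in>I. e i - x)" if "x \<notin> e ` I" for x
  proof -
    have "(\<Prod>j\<in>I - {i}. e j - x) = (\<Prod>j\<in>I. e j - x) / (e i - x)" if "i \<in> I" for i
      using that \<open>x \<notin> e ` I\<close> \<open>finite I\<close> by (subst prod.remove[of I i]) auto
    then have "(\<Sum>i\<in>I. c i * (\<Prod>j\<in>I - {i}. e j - x)) = (\<Sum>i\<in>I. c i / (e i - x) * (\<Prod>j\<in>I. e j - x))"
      by (intro sum.cong) auto
    then show ?thesis
      by (simp add: q_def poly_sum poly_prod algebra_simps sum_distrib_left sum_distrib_right)
  qed
  have deg_prod: "degree (\<Prod>j\<in>J. [:e j, -1:]) \<le> card J" for J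
  proof (cases "finite J")
    case True
    then show ?thesis
      using degree_prod_sum_le[of J "\<lambda>j. [:e j, -1:]"] by simp
  qed simp
  have "degree q \<le> card I + 1"
    unfolding q_def
  proof (intro degree_add_le degree_sum_le)
    show "degree ([:b, a:] * (\<Prod>i\<in>I. [:e i, - 1:])) \<le> card I + 1"
      using degree_mult_le[of "[:b, a:]" "\<Prod>i\<in>I. [:e i, - 1:]"] deg_prod[of I] by (simp split: if_splits)
    show "degree ([:c i:] * (\<Prod>j\<in>I - {i}. [:e j, - 1:])) \<le> card I + 1" if "i \<in> I" for i
    proof -
      have "degree ([:c i:] * (\<Prod>j\<in>I - {i}. [:e j, - 1:])) \<le> card (I - {i})"
        using degree_mult_le[of "[:c i:]" "\<Prod>j\<in>I - {i}. [:e j, - 1:]"] deg_prod[of "I - {i}"] by simp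
      also have "\<dots> \<le> card I" by (rule card_mono) (use \<open>finite I\<close> in auto)
      finally show ?thesis by simp
    qed
  qed (rule \<open>finite I\<close>)
  moreover have "q \<noteq> 0"
  proof
    assume "q = 0"
    then have "- (e ` I) \<subseteq> ?Z"
      using poly_q \<open>finite I\<close> by (auto simp: prod_zero_iff)
    then have "finite (- (e ` I))" using fin finite_subset by blast
    then show False using \<open>finite I\<close> infinite_UNIV_char_0[where 'a=real] by (metis finite_compl finite_imageI)
  qed
  moreover have "?Z \<subseteq> {x. poly q x = 0}" using poly_q by auto
  then have "card ?Z \<le> card {x. poly q x = 0}"
    using \<open>q \<noteq> 0\<close> by (intro card_mono poly_roots_finite)
  ultimately show ?thesis using card_poly_roots_bound[of q] by linarith
qed

lemma mat_solve_of_trivial_kernel: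
  fixes A :: "'a :: field mat"
  assumes A: "A \<in> carrier_mat n n" and b: "b \<in> carrier_vec n"
    and ker: "\<And>v. v \<in> carrier_vec n \<Longrightarrow> A *\<^sub>v v = 0\<^sub>v n \<Longrightarrow> v = 0\<^sub>v n"
  shows "\<exists>v. v \<in> carrier_vec n \<and> A *\<^sub>v v = b"
proof -
  have "det A \<noteq> 0" using det_0_iff_vec_prod_zero_field[OF A] ker by auto
  then obtain C where C: "C \<in> carrier_mat n n" "A * C = 1\<^sub>m n"
    using det_non_zero_imp_unit[OF A] by (auto simp: Units_def ring_mat_def)
  then have "A *\<^sub>v (C *\<^sub>v b) = b"
    using A b by (simp flip: assoc_mult_mat_vec)
  then show ?thesis using C b by (intro exI[of _ "C *\<^sub>v b"]) auto
qed

section \<open>Independence of past and future\<close>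

lemma sigma_algebra_generated_events: "sigma_algebra (space M) (generated_events M I S Z)"
  unfolding generated_events_def by (rule sigma_algebra_sigma_sets) auto

lemma generated_events_Int:
  "a \<in> generated_events M I S Z \<Longrightarrow> b \<in> generated_events M I S Z \<Longrightarrow> a \<inter> b \<in> generated_events M I S Z"
proof -
  interpret sigma_algebra "space M" "generated_events M I S Z" by (rule sigma_algebra_generated_events)
  show "a \<in> generated_events M I S Z \<Longrightarrow> b \<in> generated_events M I S Z \<Longrightarrow> a \<inter> b \<in> generated_events M I S Z"
    by (rule Int)
qed

lemma space_in_generated_events: "space M \<in> generated_events M I S Z"
  unfolding generated_events_def by (rule sigma_sets_top)

lemma generated_events_mono: "I \<subseteq> J \<Longrightarrow> generated_events M I S Z \<subseteq> generated_events M J S Z"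
  unfolding generated_events_def by (intro sigma_sets_mono') auto

lemma vimage_in_generated_events:
  "i \<in> I \<Longrightarrow> A \<in> sets S \<Longrightarrow> Z i -` A \<inter> space M \<in> generated_events M I S Z"
  unfolding generated_events_def by (rule sigma_sets.Basic) auto

lemma generated_events_subset_events:
  assumes "\<And>i. i \<in> I \<Longrightarrow> Z i \<in> measurable M S"
  shows "generated_events M I S Z \<subseteq> sets M"
  unfolding generated_events_def using assms by (intro sets.sigma_sets_subset) (auto intro: measurable_sets)

lemma sets_sigma_generated_events: "sets (sigma (space M) (generated_events M I S Z)) = generated_events M I S Z"
  using sigma_algebra.sets_measure_of_eq[OF sigma_algebra_generated_events] by blast

lemma Int_stable_vimage: "Int_stable {f -` A \<inter> \<Omega> |A. A \<in> sets S}"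
proof (rule Int_stableI, safe)
  fix A B assume "A \<in> sets S" "B \<in> sets S"
  then show "\<exists>C. f -` A \<inter> \<Omega> \<inter> (f -` B \<inter> \<Omega>) = f -` C \<inter> \<Omega> \<and> C \<in> sets S"
    by (intro exI[of _ "A \<inter> B"]) auto
qed

lemma measurable_generated_events:
  assumes "i \<in> I" "Z i \<in> measurable M S"
  shows "Z i \<in> measurable (sigma (space M) (generated_events M I S Z)) S"
proof (rule measurableI)
  fix A assume "A \<in> sets S"
  then show "Z i -` A \<inter> space (sigma (space M) (generated_events M I S Z)) \<in> sets (sigma (space M) (generated_events M I S Z))"
    using vimage_in_generated_events[OF assms(1)] by (simp add: sets_sigma_generated_events space_measure_of_conv)
qed (use measurable_space[OF assms(2)] in \<open>simp add: space_measure_of_conv\<close>)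

context prob_space
begin

lemma indep_set_mono:
  "indep_set A B \<Longrightarrow> A' \<subseteq> A \<Longrightarrow> B' \<subseteq> B \<Longrightarrow> indep_set A' B'"
  unfolding indep_set_def by (erule indep_sets_mono_sets) (auto split: bool.split)

text \<open>Independent increments speak of finitely many times. For a finite \<open>J\<close>
  inside \<open>{0..s}\<close> the values of \<open>Z\<close> on \<open>J\<close> are sums of
  increments over a grid ending at \<open>s\<close>, hence independent of the increment up to
  \<open>T\<close>. The events determined by finitely many times are stable under intersection,
  since \<open>J\<close> and \<open>K\<close> both lie in \<open>J \<union> K\<close>, and generate
  the past, so independence extends to it.\<close>

lemma indep_set_past_increment:
  fixes Z :: "real \<Rightarrow> 'a \<Rightarrow> real"
  assumes Z: "\<And>t. 0 \<le> t \<Longrightarrow> Z t \<in> borel_measurable M" and Z0: "\<And>\<omega>. \<omega> \<in> space M \<Longrightarrow> Z 0 \<omega> = 0"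
    and incr: "independent_increments M Z" and st: "0 \<le> s" "s \<le> T"
  shows "indep_set (generated_events M {0..s} borel Z) {(\<lambda>\<omega>. Z T \<omega> - Z s \<omega>) -` A \<inter> space M |A. A \<in> sets borel}"
    (is "indep_set _ ?F")
proof -
  have finite_past: "indep_set (generated_events M J borel Z) ?F" if J: "finite J" "J \<subseteq> {0..s}" for J
  proof -
    \<comment> \<open>Time 0 is added because \<open>Z 0 = 0\<close> makes every value a sum of
      increments, time \<open>s\<close> because the last increment has to start there.\<close>
    define l where "l = sorted_list_of_set (insert 0 (insert s J))"
    have l: "sorted l" "set l = insert 0 (insert s J)" "l \<noteq> []"
    proof -
      have "finite (insert 0 (insert s J))" using J by simp
      then show "set l = insert 0 (insert s J)" unfolding l_def by (rule set_sorted_list_of_set)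
      show "sorted l" unfolding l_def by (rule sorted_sorted_list_of_set)
      from \<open>set l = _\<close> show "l \<noteq> []" by auto
    qed
    define n where "n = length l - 1"
    \<comment> \<open>\<open>independent_increments\<close> asks for a monotone sequence indexed by
      all naturals. The constant continuation by \<open>T\<close> makes the increment with index
      \<open>n\<close> equal to \<open>Z T - Z s\<close>.\<close>
    define t where "t i = (if i \<le> n then l ! i else T)" for i
    have len: "length l = Suc n" using l(3) by (cases l) (auto simp: n_def)
    have l_range: "l ! i \<in> {0..s}" if "i \<le> n" for i
      using nth_mem[of i l] that l(2) J st by (auto simp: len)
    have l0: "l ! 0 = 0"
    proof -
      obtain i where "i < length l" "l ! i = 0" using l(2) by (metis in_set_conv_nth insertI1)
      then have "l ! 0 \<le> 0" using sorted_nth_mono[OF l(1), of 0 i] by auto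
      then show ?thesis using l_range[of 0] by auto
    qed
    have ln: "l ! n = s"
    proof -
      obtain i where i: "i < length l" "l ! i = s" using l(2) by (metis in_set_conv_nth insertI1 insertI2)
      then have "s \<le> l ! n" using sorted_nth_mono[OF l(1), of i n] by (auto simp: len)
      then show ?thesis using l_range[of n] by auto
    qed
    have "mono t"
    proof (rule monoI)
      fix i j :: nat assume "i \<le> j"
      then show "t i \<le> t j"
        using sorted_nth_mono[OF l(1), of i j] l_range[of i] st by (auto simp: t_def len)
    qed
    moreover have t0: "t 0 = 0" by (simp add: t_def l0)
    moreover define D where "D i \<omega> = Z (t (Suc i)) \<omega> - Z (t i) \<omega>" for i \<omega>
    ultimately have indep: "indep_vars (\<lambda>_. borel) D {..<Suc n}"
      using incr unfolding independent_increments_def D_def[abs_def] by simp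
    define E where "E i = {D i -` A \<inter> space M |A. A \<in> sets borel}" for i
    have "indep_sets (\<lambda>j. sigma_sets (space M) (\<Union>i\<in>(case j of True \<Rightarrow> {..<n} | False \<Rightarrow> {n}). E i)) UNIV"
    proof (rule indep_sets_collect_sigma)
      show "indep_sets E (\<Union>j\<in>UNIV. case j of True \<Rightarrow> {..<n} | False \<Rightarrow> {n})"
        using indep unfolding indep_vars_def2 E_def by (auto simp: UNIV_bool lessThan_Suc)
      show "Int_stable (E i)" for i
        unfolding E_def by (rule Int_stable_vimage)
    qed (auto simp: disjoint_family_on_def split: bool.split)
    then have "indep_set (sigma_sets (space M) (\<Union>i<n. E i)) (sigma_sets (space M) (E n))"
      unfolding indep_set_def by (rule indep_sets_mono_sets) (auto split: bool.split)
    moreover have "?F \<subseteq> sigma_sets (space M) (E n)"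
    proof -
      have "D n = (\<lambda>\<omega>. Z T \<omega> - Z s \<omega>)" by (auto simp: D_def t_def ln)
      then show ?thesis by (auto simp: E_def intro!: sigma_sets.Basic)
    qed
    moreover have "generated_events M J borel Z \<subseteq> sigma_sets (space M) (\<Union>i<n. E i)"
    proof -
      define G where "G = sigma (space M) (\<Union>i<n. E i)"
      have sub: "(\<Union>i<n. E i) \<subseteq> Pow (space M)" by (auto simp: E_def)
      then have G: "sets G = sigma_sets (space M) (\<Union>i<n. E i)" "space G = space M"
        unfolding G_def by (simp_all add: sets_measure_of space_measure_of_conv)
      have D: "D i \<in> borel_measurable G" if "i < n" for i
        by (rule measurableI) (use that in \<open>auto simp: G E_def intro!: sigma_sets.Basic\<close>)
      have Zt: "Z (t i) \<in> borel_measurable G" if "i \<le> n" for i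
        using that
      proof (induction i)
        case 0
        have "(\<lambda>_. 0) \<in> borel_measurable G" by simp
        then show ?case by (rule measurable_cong[THEN iffD1, rotated]) (simp add: t0 Z0 G)
      next
        case (Suc i)
        then have "(\<lambda>\<omega>. Z (t i) \<omega> + D i \<omega>) \<in> borel_measurable G"
          by (intro borel_measurable_add D) auto
        then show ?case by (simp add: D_def)
      qed
      have "Z r -` A \<inter> space M \<in> sets G" if "r \<in> J" "A \<in> sets borel" for r A
      proof -
        obtain i where "i \<le> n" "t i = r"
          using \<open>r \<in> J\<close> l(2) len unfolding t_def by (metis in_set_conv_nth insertI2 less_Suc_eq_le)
        then show ?thesis using measurable_sets[OF Zt \<open>A \<in> sets borel\<close>] G(2) by auto
      qed
      then show ?thesis
        using sets.sigma_sets_subset[of "\<Union>i\<in>J. {Z i -` A \<inter> space M |A. A \<in> sets borel}" G]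
        unfolding generated_events_def G by auto
    qed
    ultimately show ?thesis using indep_set_mono by blast
  qed
  define C where "C = (\<Union>J\<in>{J. finite J \<and> J \<subseteq> {0..s}}. generated_events M J borel Z)"
  have "indep_set C ?F"
  proof (rule indep_setI)
    show "C \<subseteq> events"
      unfolding C_def using Z by (intro UN_least generated_events_subset_events) auto
    have "(\<lambda>\<omega>. Z T \<omega> - Z s \<omega>) \<in> borel_measurable M"
      using Z st by (intro borel_measurable_diff) auto
    then show "?F \<subseteq> events" by (auto intro: measurable_sets)
    show "prob (a \<inter> b) = prob a * prob b" if "a \<in> C" "b \<in> ?F" for a b
      using that finite_past unfolding C_def by (auto intro: indep_setD)
  qed
  then have "indep_set (sigma_sets (space M) C) (sigma_sets (space M) ?F)"
  proof (rule indep_set_sigma_sets)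
    show "Int_stable C"
    proof (rule Int_stableI)
      fix a b assume "a \<in> C" "b \<in> C"
      then obtain J K where JK: "finite J" "J \<subseteq> {0..s}" "finite K" "K \<subseteq> {0..s}"
        "a \<in> generated_events M J borel Z" "b \<in> generated_events M K borel Z" by (auto simp: C_def)
      then have "a \<inter> b \<in> generated_events M (J \<union> K) borel Z"
        using generated_events_mono[of J "J \<union> K" M borel Z] generated_events_mono[of K "J \<union> K" M borel Z]
        by (intro generated_events_Int) auto
      then show "a \<inter> b \<in> C" using JK unfolding C_def by blast
    qed
    show "Int_stable ?F"
      by (rule Int_stable_vimage)
  qed
  moreover have "generated_events M {0..s} borel Z \<subseteq> sigma_sets (space M) C"
    unfolding generated_events_def[of M "{0..s}"]
  proof (rule sigma_sets_mono, safe)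
    fix r A assume "r \<in> {0..s}" "A \<in> sets (borel :: real measure)"
    then show "Z r -` A \<inter> space M \<in> sigma_sets (space M) C"
      unfolding C_def by (intro sigma_sets.Basic UN_I[of "{r}"] vimage_in_generated_events) auto
  qed
  ultimately show ?thesis
    by (rule indep_set_mono) (auto intro: sigma_sets.Basic)
qed

text \<open>Transfer from the real-valued process. Subtraction of naturals is truncated, so monotone
  paths are what identifies \<open>N T - N s\<close> with the real difference.\<close>

lemma indep_set_past_increment_nat:
  fixes N :: "real \<Rightarrow> 'a \<Rightarrow> nat"
  assumes N: "\<And>t. 0 \<le> t \<Longrightarrow> N t \<in> measurable M (count_space UNIV)"
    and N0: "\<And>\<omega>. \<omega> \<in> space M \<Longrightarrow> N 0 \<omega> = 0" and mono: "\<And>\<omega>. \<omega> \<in> space M \<Longrightarrow> mono_on {0..} (\<lambda>t. N t \<omega>)"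
    and incr: "independent_increments M (\<lambda>t \<omega>. real (N t \<omega>))" and st: "0 \<le> s" "s \<le> T"
  shows "indep_set (generated_events M {0..s} (count_space UNIV) N)
    {(\<lambda>\<omega>. N T \<omega> - N s \<omega>) -` A \<inter> space M |A. A \<in> sets (count_space UNIV)}"
proof (rule indep_set_mono[OF indep_set_past_increment[OF _ _ incr st]])
  have real_vimage: "real ` A \<in> sets borel" for A
    by (rule sets.countable) auto
  have eq: "N r -` A \<inter> space M = (\<lambda>\<omega>. real (N r \<omega>)) -` (real ` A) \<inter> space M" for r A
    by auto
  show "generated_events M {0..s} (count_space UNIV) N \<subseteq> generated_events M {0..s} borel (\<lambda>t \<omega>. real (N t \<omega>))"
    unfolding generated_events_def
  proof (rule sigma_sets_mono', safe)
    fix r and A :: "nat set" assume "r \<in> {0..s}"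
    then show "N r -` A \<inter> space M \<in> (\<Union>i\<in>{0..s}. {(\<lambda>\<omega>. real (N i \<omega>)) -` A \<inter> space M |A. A \<in> sets borel})"
      using real_vimage[of A] eq[of r A] by (intro UN_I[of r] CollectI exI[of _ "real ` A"]) auto
  qed
  have "(\<lambda>\<omega>. N T \<omega> - N s \<omega>) -` A \<inter> space M = (\<lambda>\<omega>. real (N T \<omega>) - real (N s \<omega>)) -` (real ` A) \<inter> space M" for A
  proof -
    have "N T \<omega> - N s \<omega> \<in> A \<longleftrightarrow> real (N T \<omega>) - real (N s \<omega>) \<in> real ` A" if "\<omega> \<in> space M" for \<omega>
    proof -
      have "real (N T \<omega>) - real (N s \<omega>) = real (N T \<omega> - N s \<omega>)"
        using mono_onD[OF mono[OF that], of s T] st by (simp add: of_nat_diff)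
      then show ?thesis by (metis image_iff of_nat_eq_iff)
    qed
    then show ?thesis by blast
  qed
  then show "{(\<lambda>\<omega>. N T \<omega> - N s \<omega>) -` A \<inter> space M |A. A \<in> sets (count_space UNIV)}
      \<subseteq> {(\<lambda>\<omega>. real (N T \<omega>) - real (N s \<omega>)) -` A \<inter> space M |A. A \<in> sets borel}"
    using real_vimage by (intro subsetI) (elim CollectE exE conjE, metis (mono_tags, lifting) mem_Collect_eq)
qed (use N N0 in auto)

lemma indep_set_generated_events_disjoint:
  assumes "indep_vars (\<lambda>_. S) Y (I \<union> J)" "I \<inter> J = {}"
  shows "indep_set (generated_events M I S Y) (generated_events M J S Y)"
proof -
  have "indep_sets (\<lambda>b. sigma_sets (space M) (\<Union>i\<in>(case b of True \<Rightarrow> I | False \<Rightarrow> J). {Y i -` A \<inter> space M |A. A \<in> sets S})) UNIV"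
  proof (rule indep_sets_collect_sigma)
    show "indep_sets (\<lambda>i. {Y i -` A \<inter> space M |A. A \<in> sets S}) (\<Union>b\<in>UNIV. case b of True \<Rightarrow> I | False \<Rightarrow> J)"
      using assms(1) unfolding indep_vars_def2 by (auto simp: UNIV_bool Un_commute)
    show "Int_stable {Y i -` A \<inter> space M |A. A \<in> sets S}" for i
      by (rule Int_stable_vimage)
  qed (use assms(2) in \<open>auto simp: disjoint_family_on_def split: bool.split\<close>)
  then show ?thesis
    unfolding indep_set_def generated_events_def by (rule indep_sets_mono_sets) (auto split: bool.split)
qed

text \<open>A factorisation into six: independence of the three sources separates
  \<open>a \<inter> a'\<close>, \<open>b \<inter> b'\<close> and \<open>c \<inter> c'\<close>, and
  within each source independence of past and future separates the two events. Closure under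
  intersection keeps \<open>a \<inter> a'\<close> inside \<open>A\<close>, where the first
  factorisation applies.\<close>

lemma indep_set_Int3:
  assumes indep: "indep_sets (\<lambda>k. [A, B, C] ! k) {..<3}"
    and Int_closed: "\<And>a a'. a \<in> A \<Longrightarrow> a' \<in> A \<Longrightarrow> a \<inter> a' \<in> A" "\<And>b b'. b \<in> B \<Longrightarrow> b' \<in> B \<Longrightarrow> b \<inter> b' \<in> B"
      "\<And>c c'. c \<in> C \<Longrightarrow> c' \<in> C \<Longrightarrow> c \<inter> c' \<in> C"
    and sub: "A1 \<subseteq> A" "A2 \<subseteq> A" "B1 \<subseteq> B" "B2 \<subseteq> B" "C1 \<subseteq> C" "C2 \<subseteq> C"
    and indep2: "indep_set A1 A2" "indep_set B1 B2" "indep_set C1 C2"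
  shows "indep_set {a \<inter> b \<inter> c |a b c. a \<in> A1 \<and> b \<in> B1 \<and> c \<in> C1} {a \<inter> b \<inter> c |a b c. a \<in> A2 \<and> b \<in> B2 \<and> c \<in> C2}"
proof -
  have ev: "A \<subseteq> events" "B \<subseteq> events" "C \<subseteq> events"
  proof -
    have "\<forall>k<3. [A, B, C] ! k \<subseteq> events"
      using indep unfolding indep_sets_def by simp
    from this[rule_format, of 0] this[rule_format, of 1] this[rule_format, of 2]
    show "A \<subseteq> events" "B \<subseteq> events" "C \<subseteq> events" by (auto simp: numeral_2_eq_2)
  qed
  have prod3: "prob (a \<inter> b \<inter> c) = prob a * prob b * prob c" if "a \<in> A" "b \<in> B" "c \<in> C" for a b c
  proof -
    have "prob (\<Inter>j\<in>{..<3::nat}. [a, b, c] ! j) = (\<Prod>j\<in>{..<3}. prob ([a, b, c] ! j))"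
      by (rule indep_setsD[OF indep]) (use that in \<open>auto simp: numeral_3_eq_3 less_Suc_eq\<close>)
    moreover have "{..<3::nat} = {0, 1, 2}" by auto
    ultimately show ?thesis by (simp add: Int_ac mult_ac)
  qed
  show ?thesis
  proof (rule indep_setI, goal_cases)
    case (3 x y)
    then obtain a b c a' b' c' where abc: "a \<in> A1" "b \<in> B1" "c \<in> C1" "a' \<in> A2" "b' \<in> B2" "c' \<in> C2"
      and xy: "x = a \<inter> b \<inter> c" "y = a' \<inter> b' \<inter> c'" by auto
    have "prob (x \<inter> y) = prob ((a \<inter> a') \<inter> (b \<inter> b') \<inter> (c \<inter> c'))"
      unfolding xy by (rule arg_cong[where f=prob]) auto
    also have "\<dots> = prob (a \<inter> a') * prob (b \<inter> b') * prob (c \<inter> c')"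
      using abc sub by (intro prod3 Int_closed) auto
    also have "\<dots> = (prob a * prob a') * (prob b * prob b') * (prob c * prob c')"
      using abc indep_setD[OF indep2(1)] indep_setD[OF indep2(2)] indep_setD[OF indep2(3)] by simp
    also have "\<dots> = prob x * prob y"
      using abc sub unfolding xy by (subst (1 2) prod3) (auto simp: mult_ac)
    finally show ?case .
  qed (use sub ev in blast)+
qed

lemma indep_var_of_indep_set:
  assumes indep: "indep_set (sets F) (sets G)" and "space F = space M" "space G = space M"
    and X: "X \<in> measurable F S" and Y: "Y \<in> measurable G T"
  shows "indep_var S X T Y"
proof -
  have sub: "sets F \<subseteq> events" "sets G \<subseteq> events"
    using indep unfolding indep_set_def indep_sets_def by (auto simp: UNIV_bool)
  have "sigma_sets (space M) {X -` A \<inter> space M |A. A \<in> sets S} \<subseteq> sets F"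
    using measurable_sets[OF X] assms(2) sets.sigma_sets_subset[of "{X -` A \<inter> space M |A. A \<in> sets S}" F] by auto
  moreover have "sigma_sets (space M) {Y -` A \<inter> space M |A. A \<in> sets T} \<subseteq> sets G"
    using measurable_sets[OF Y] assms(3) sets.sigma_sets_subset[of "{Y -` A \<inter> space M |A. A \<in> sets T}" G] by auto
  moreover have "X \<in> measurable M S" "Y \<in> measurable M T"
    using X Y sub assms(2,3) by (auto simp: measurable_def)
  ultimately show ?thesis
    unfolding indep_var_eq using indep_set_mono[OF indep] by blast
qed

end

section \<open>Laplace transforms of the increments\<close>

lemma has_bochner_integral_distributed:
  fixes g :: "'b \<Rightarrow> 'c :: {banach, second_countable_topology}"
  assumes D: "distributed M L X (\<lambda>x. ennreal (f x))" and f: "f \<in> borel_measurable L" "\<And>x. 0 \<le> f x"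
    and g: "g \<in> borel_measurable L" and int: "has_bochner_integral L (\<lambda>x. f x *\<^sub>R g x) c"
  shows "has_bochner_integral M (\<lambda>\<omega>. g (X \<omega>)) c"
proof -
  have "has_bochner_integral (distr M L X) g c"
    unfolding distributed_distr_eq_density[OF D]
    using f g int by (intro has_bochner_integral_density) auto
  then show ?thesis
    using g distributed_measurable[OF D] by (simp add: has_bochner_integral_iff integrable_distr_eq integral_distr)
qed

text \<open>Only the imaginary direction is given by the characteristic function of the normal law.
  The substitution \<open>x = a * s\<^sup>2 + s * y\<close> completes the square and absorbs the
  real part \<open>a\<close> of \<open>w\<close>: the integrand becomes the constant
  \<open>C\<close> times the standard normal density times \<open>iexp (b * s * y)\<close>.\<close>

lemma has_bochner_integral_cexp_normal:
  fixes w :: complex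
  assumes D: "distributed M lborel X (normal_density 0 s)" and "0 < s"
  shows "has_bochner_integral M (\<lambda>\<omega>. exp (w * of_real (X \<omega>))) (exp (of_real (s\<^sup>2) * w\<^sup>2 / 2))"
proof (rule has_bochner_integral_distributed[OF D])
  define a b where "a = Re w" and "b = Im w"
  have w: "w = Complex a b" by (simp add: a_def b_def)
  have "integrable std_normal_distribution (\<lambda>y. iexp (b * s * y))"
    by (intro finite_measure.integrable_const_bound[of _ _ 1] prob_space.finite_measure prob_space_normal_density) auto
  then have "integrable lborel (\<lambda>y. std_normal_density y *\<^sub>R iexp (b * s * y))"
    by (subst (asm) integrable_density) auto
  moreover have "(CLBINT y. std_normal_density y *\<^sub>R iexp (b * s * y)) = exp (- ((b * s)\<^sup>2) / 2)"
    using fun_cong[OF char_std_normal_distribution, of "b * s"]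
    by (subst (asm) char_def, subst (asm) integral_density) auto
  ultimately have std: "has_bochner_integral lborel (\<lambda>y. std_normal_density y *\<^sub>R iexp (b * s * y)) (of_real (exp (- ((b * s)\<^sup>2) / 2)))"
    by (simp add: has_bochner_integral_iff)
  define C where "C = exp (complex_of_real (a\<^sup>2 * s\<^sup>2 / 2) + \<i> * of_real (a * b * s\<^sup>2))"
  have "has_bochner_integral lborel (\<lambda>y. (1 / s) *\<^sub>R (C * (std_normal_density y *\<^sub>R iexp (b * s * y))))
      ((1 / s) *\<^sub>R (C * of_real (exp (- ((b * s)\<^sup>2) / 2))))"
    by (intro has_bochner_integral_scaleR_right has_bochner_integral_mult_right std)
  moreover have "(1 / s) *\<^sub>R (C * (std_normal_density y *\<^sub>R iexp (b * s * y))) =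
      normal_density 0 s (a * s\<^sup>2 + s * y) *\<^sub>R exp (w * of_real (a * s\<^sup>2 + s * y))" for y
  proof -
    have e: "- (a * s\<^sup>2 + s * y)\<^sup>2 / (2 * s\<^sup>2) = - y\<^sup>2 / 2 - a * s * y - a\<^sup>2 * s\<^sup>2 / 2"
      using \<open>0 < s\<close> by (simp add: field_simps power2_eq_square)
    have n: "normal_density 0 s (a * s\<^sup>2 + s * y) = 1 / s * (1 / sqrt (2 * pi)) * exp (- y\<^sup>2 / 2 - a * s * y - a\<^sup>2 * s\<^sup>2 / 2)"
      unfolding normal_density_def diff_0_right e using \<open>0 < s\<close> by (simp add: real_sqrt_mult)
    have "complex_of_real (exp (- y\<^sup>2 / 2 - a * s * y - a\<^sup>2 * s\<^sup>2 / 2)) * exp (w * of_real (a * s\<^sup>2 + s * y))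
        = C * (of_real (exp (- y\<^sup>2 / 2)) * iexp (b * s * y))"
    proof -
      have "complex_of_real (- y\<^sup>2 / 2 - a * s * y - a\<^sup>2 * s\<^sup>2 / 2) + w * of_real (a * s\<^sup>2 + s * y) =
          (complex_of_real (a\<^sup>2 * s\<^sup>2 / 2) + \<i> * of_real (a * b * s\<^sup>2)) + (of_real (- y\<^sup>2 / 2) + \<i> * of_real (b * s * y))"
        unfolding w by (simp add: complex_eq_iff algebra_simps power2_eq_square)
      then show ?thesis unfolding C_def exp_of_real[symmetric] by (simp only: flip: exp_add)
    qed
    then show ?thesis
      unfolding n std_normal_density_def scaleR_conv_of_real of_real_mult by (simp add: mult_ac)
  qed
  moreover have "(1 / s) *\<^sub>R (C * of_real (exp (- ((b * s)\<^sup>2) / 2))) = exp (of_real (s\<^sup>2) * w\<^sup>2 / 2) /\<^sub>R \<bar>s\<bar>"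
  proof -
    have "(complex_of_real (a\<^sup>2 * s\<^sup>2 / 2) + \<i> * of_real (a * b * s\<^sup>2)) + of_real (- ((b * s)\<^sup>2) / 2) = of_real (s\<^sup>2) * w\<^sup>2 / 2"
      unfolding w by (simp add: complex_eq_iff power2_eq_square algebra_simps)
    then have "C * of_real (exp (- ((b * s)\<^sup>2) / 2)) = exp (of_real (s\<^sup>2) * w\<^sup>2 / 2)"
      unfolding C_def exp_of_real[symmetric] by (simp only: flip: exp_add)
    then show ?thesis using \<open>0 < s\<close> by (simp only: abs_of_pos inverse_eq_divide)
  qed
  ultimately show "has_bochner_integral lborel (\<lambda>x. normal_density 0 s x *\<^sub>R exp (w * of_real x)) (exp (of_real (s\<^sup>2) * w\<^sup>2 / 2))"
    using \<open>0 < s\<close> by (subst lborel_has_bochner_integral_real_affine_iff[where c=s and t="a * s\<^sup>2"]) auto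
qed auto

text \<open>The moment generating function of one jump on \<open>strip P\<close>; elsewhere this is
  its rational continuation, which is what the roots beyond the first poles are plugged
  into.\<close>

definition jump_mgf :: "mejd \<Rightarrow> complex \<Rightarrow> complex" where
  "jump_mgf P z = of_real (prob_up P) * (\<Sum>i=1..num_up P. of_real (weight_up P i * eta P i) / (of_real (eta P i) - z))
     + of_real (prob_down P) * (\<Sum>j=1..num_down P. of_real (weight_down P j * theta P j) / (of_real (theta P j) + z))"

definition complex_exponent :: "mejd \<Rightarrow> complex \<Rightarrow> complex" where
  "complex_exponent P z = of_real (drift P) * z + of_real ((volatility P)\<^sup>2) / 2 * z\<^sup>2 + of_real (rate P) * (jump_mgf P z - 1)"

lemma complex_exponent_of_real: "complex_exponent P (of_real \<zeta>) = of_real (levy_exponent P \<zeta>)"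
  by (simp add: complex_exponent_def jump_mgf_def levy_exponent_def)

text \<open>The two smallest rates bound the domain on which every term of the jump density,
  whatever the sign of its weight, has finite exponential moments.\<close>

definition strip :: "mejd \<Rightarrow> complex set" where
  "strip P = {z. - theta P 1 < Re z \<and> Re z < eta P 1}"

lemma eta_ge:
  assumes "mejd_parameters P" "i \<in> {1..num_up P}" shows "eta P 1 \<le> eta P i" "0 < eta P i"
proof -
  show "eta P 1 \<le> eta P i"
    using assms strict_mono_on_leD[of "{1..num_up P}" "eta P" 1 i] by (auto simp: mejd_parameters_def)
  then show "0 < eta P i" using assms by (auto simp: mejd_parameters_def)
qed

lemma theta_ge:
  assumes "mejd_parameters P" "j \<in> {1..num_down P}" shows "theta P 1 \<le> theta P j" "0 < theta P j"
proof -
  show "theta P 1 \<le> theta P j"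
    using assms strict_mono_on_leD[of "{1..num_down P}" "theta P" 1 j] by (auto simp: mejd_parameters_def)
  then show "0 < theta P j" using assms by (auto simp: mejd_parameters_def)
qed

lemma has_bochner_integral_jump_mgf:
  assumes P: "mejd_parameters P" and z: "z \<in> strip P"
  shows "has_bochner_integral lborel (\<lambda>y. jump_density P y *\<^sub>R exp (z * of_real y)) (jump_mgf P z)"
proof -
  have up: "has_bochner_integral lborel (\<lambda>y. indicator {0..} y *\<^sub>R exp ((z - of_real (eta P i)) * of_real y)) (1 / (of_real (eta P i) - z))"
    if "i \<in> {1..num_up P}" for i
  proof -
    have "Re (z - of_real (eta P i)) < 0" using eta_ge[OF P that] z by (auto simp: strip_def)
    from has_bochner_integral_cexp_Ioi[OF this, of 0]
    have "has_bochner_integral lborel (\<lambda>y. indicator {0<..} y *\<^sub>R exp ((z - of_real (eta P i)) * of_real y)) (1 / (of_real (eta P i) - z))"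
      using minus_divide_right[of 1 "z - of_real (eta P i)"] by simp
    then show ?thesis
      by (subst has_bochner_integral_discrete_difference[where X="{0}"
            and g="\<lambda>y. indicator {0<..} y *\<^sub>R exp ((z - of_real (eta P i)) * of_real y)"])
         (auto split: split_indicator)
  qed
  have down: "has_bochner_integral lborel (\<lambda>y. indicator {..<0} y *\<^sub>R exp ((of_real (theta P j) + z) * of_real y)) (1 / (of_real (theta P j) + z))"
    if "j \<in> {1..num_down P}" for j
  proof -
    have "0 < Re (of_real (theta P j) + z)" using theta_ge[OF P that] z by (auto simp: strip_def)
    from has_bochner_integral_cexp_Iio[OF this, of 0] show ?thesis by simp
  qed
  have "has_bochner_integral lborel
      (\<lambda>y. of_real (prob_up P) * (\<Sum>i=1..num_up P. of_real (weight_up P i * eta P i) * (indicator {0..} y *\<^sub>R exp ((z - of_real (eta P i)) * of_real y)))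
         + of_real (prob_down P) * (\<Sum>j=1..num_down P. of_real (weight_down P j * theta P j) * (indicator {..<0} y *\<^sub>R exp ((of_real (theta P j) + z) * of_real y))))
      (of_real (prob_up P) * (\<Sum>i=1..num_up P. of_real (weight_up P i * eta P i) * (1 / (of_real (eta P i) - z)))
         + of_real (prob_down P) * (\<Sum>j=1..num_down P. of_real (weight_down P j * theta P j) * (1 / (of_real (theta P j) + z))))"
    by (intro has_bochner_integral_add has_bochner_integral_mult_right has_bochner_integral_sum up down)
  moreover have "of_real (prob_up P) * (\<Sum>i=1..num_up P. of_real (weight_up P i * eta P i) * (indicator {0..} y *\<^sub>R exp ((z - of_real (eta P i)) * of_real y)))
         + of_real (prob_down P) * (\<Sum>j=1..num_down P. of_real (weight_down P j * theta P j) * (indicator {..<0} y *\<^sub>R exp ((of_real (theta P j) + z) * of_real y)))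
      = jump_density P y *\<^sub>R exp (z * of_real y)" for y
  proof -
    have "exp ((z - of_real e) * of_real y) = of_real (exp (- e * y)) * exp (z * of_real y)"
      and "exp ((of_real e + z) * of_real y) = of_real (exp (e * y)) * exp (z * of_real y)" for e
      by (simp_all add: algebra_simps exp_of_real[symmetric] flip: exp_add)
    then show ?thesis
      by (cases "0 \<le> y") (simp_all add: jump_density_def scaleR_conv_of_real sum_distrib_right mult.assoc)
  qed
  ultimately show ?thesis by (simp add: jump_mgf_def)
qed

section \<open>The driving processes and the sigma-algebras of past and future\<close>

locale mejd_model =
  fixes P :: mejd and \<Omega> :: "'a measure"
    and W :: "real \<Rightarrow> 'a \<Rightarrow> real" and N :: "real \<Rightarrow> 'a \<Rightarrow> nat" and Y :: "nat \<Rightarrow> 'a \<Rightarrow> real"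
  assumes params: "mejd_parameters P" and drivers: "mejd_drivers P \<Omega> W N Y"
begin

sublocale prob_space \<Omega>
  using drivers by (simp add: mejd_drivers_def)

abbreviation "gen_W \<equiv> generated_events \<Omega> {0..} borel W"
abbreviation "gen_N \<equiv> generated_events \<Omega> {0..} (count_space UNIV) N"
abbreviation "gen_Y \<equiv> generated_events \<Omega> {1..} borel Y"

lemma W_measurable: "0 \<le> t \<Longrightarrow> W t \<in> borel_measurable \<Omega>"
  and W_0: "\<omega> \<in> space \<Omega> \<Longrightarrow> W 0 \<omega> = 0"
  and W_continuous: "\<omega> \<in> space \<Omega> \<Longrightarrow> continuous_on {0..} (\<lambda>t. W t \<omega>)"
  and W_increments: "independent_increments \<Omega> W"
  and W_distributed: "0 \<le> s \<Longrightarrow> s < t \<Longrightarrow> distributed \<Omega> lborel (\<lambda>\<omega>. W t \<omega> - W s \<omega>) (normal_density 0 (sqrt (t - s)))"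
  using drivers by (auto simp: mejd_drivers_def standard_brownian_motion_def)

lemma N_measurable: "0 \<le> t \<Longrightarrow> N t \<in> measurable \<Omega> (count_space UNIV)"
  and N_0: "\<omega> \<in> space \<Omega> \<Longrightarrow> N 0 \<omega> = 0"
  and N_mono: "\<omega> \<in> space \<Omega> \<Longrightarrow> mono_on {0..} (\<lambda>t. N t \<omega>)"
  and N_right_continuous: "\<omega> \<in> space \<Omega> \<Longrightarrow> 0 \<le> t \<Longrightarrow> continuous (at_right t) (\<lambda>s. N s \<omega>)"
  and N_increments: "independent_increments \<Omega> (\<lambda>t \<omega>. real (N t \<omega>))"
  and N_distr: "0 \<le> s \<Longrightarrow> s < t \<Longrightarrow>
     distr \<Omega> (count_space UNIV) (\<lambda>\<omega>. N t \<omega> - N s \<omega>) = measure_pmf (poisson_pmf (rate P * (t - s)))"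
  using drivers by (auto simp: mejd_drivers_def homogeneous_poisson_process_def)

lemma Y_distributed: "1 \<le> i \<Longrightarrow> distributed \<Omega> lborel (Y i) (jump_density P)"
  and Y_indep: "indep_vars (\<lambda>_. borel) Y {1..}"
  and generators_indep: "indep_sets (\<lambda>k. [gen_W, gen_N, gen_Y] ! k) {..<3}"
  using drivers by (auto simp: mejd_drivers_def)

lemma Y_measurable: "1 \<le> i \<Longrightarrow> Y i \<in> borel_measurable \<Omega>"
  using distributed_measurable[OF Y_distributed] by simp

lemma rate_pos: "0 < rate P" and jump_density_nonneg: "0 \<le> jump_density P y"
  using params by (auto simp: mejd_parameters_def)

lemma strip_real: "z \<in> strip P \<Longrightarrow> complex_of_real (Re z) \<in> strip P"
  by (simp add: strip_def)

lemma imaginary_in_strip: "Re z = 0 \<Longrightarrow> z \<in> strip P"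
  using params by (auto simp: strip_def mejd_parameters_def)

lemma measurable_sigma_gen_W: "0 \<le> t \<Longrightarrow> W t \<in> borel_measurable (sigma (space \<Omega>) gen_W)"
  by (rule measurable_generated_events) (auto intro: W_measurable)

lemma measurable_sigma_gen_N: "0 \<le> t \<Longrightarrow> N t \<in> measurable (sigma (space \<Omega>) gen_N) (count_space UNIV)"
  by (rule measurable_generated_events) (auto intro: N_measurable)

lemma measurable_sigma_gen_Y: "1 \<le> i \<Longrightarrow> Y i \<in> borel_measurable (sigma (space \<Omega>) gen_Y)"
  by (rule measurable_generated_events) (auto intro: Y_measurable)

text \<open>The driver increments on \<open>[s, T]\<close> are used together with the jump sizes following the
  first \<open>k\<close>, so that on \<open>{N s = k}\<close> these generate the increments of the process itself.\<close>

abbreviation past_sets :: "real \<Rightarrow> nat \<Rightarrow> 'a set set" where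
  "past_sets s k \<equiv> {a \<inter> b \<inter> c |a b c. a \<in> generated_events \<Omega> {0..s} borel W \<and>
     b \<in> generated_events \<Omega> {0..s} (count_space UNIV) N \<and> c \<in> generated_events \<Omega> {1..k} borel Y}"

abbreviation future_sets :: "real \<Rightarrow> real \<Rightarrow> nat \<Rightarrow> 'a set set" where
  "future_sets s T k \<equiv> {a \<inter> b \<inter> c |a b c. a \<in> {(\<lambda>\<omega>. W T \<omega> - W s \<omega>) -` A \<inter> space \<Omega> |A. A \<in> sets borel} \<and>
     b \<in> {(\<lambda>\<omega>. N T \<omega> - N s \<omega>) -` A \<inter> space \<Omega> |A. A \<in> sets (count_space UNIV)} \<and> c \<in> generated_events \<Omega> {k<..} borel Y}"

definition past :: "real \<Rightarrow> nat \<Rightarrow> 'a measure" where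
  "past s k = sigma (space \<Omega>) (past_sets s k)"

definition future :: "real \<Rightarrow> real \<Rightarrow> nat \<Rightarrow> 'a measure" where
  "future s T k = sigma (space \<Omega>) (future_sets s T k)"

lemma space_past [simp]: "space (past s k) = space \<Omega>"
  and space_future [simp]: "space (future s T k) = space \<Omega>"
  by (simp_all add: past_def future_def space_measure_of_conv)

lemma gen_subset_Pow: "a \<in> generated_events \<Omega> I S Z \<Longrightarrow> a \<subseteq> space \<Omega>"
  unfolding generated_events_def by (rule sigma_sets_into_sp) auto

lemma sets_past: "sets (past s k) = sigma_sets (space \<Omega>) (past_sets s k)"
  unfolding past_def by (rule sets_measure_of) (auto dest: gen_subset_Pow)

lemma sets_future: "sets (future s T k) = sigma_sets (space \<Omega>) (future_sets s T k)"
  unfolding future_def by (rule sets_measure_of) (auto dest: gen_subset_Pow)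

lemma Int_stable_Int3:
  assumes "Int_stable A" "Int_stable B" "Int_stable C"
  shows "Int_stable {a \<inter> b \<inter> c |a b c. a \<in> A \<and> b \<in> B \<and> c \<in> C}"
proof (rule Int_stableI)
  fix x y assume "x \<in> {a \<inter> b \<inter> c |a b c. a \<in> A \<and> b \<in> B \<and> c \<in> C}" "y \<in> {a \<inter> b \<inter> c |a b c. a \<in> A \<and> b \<in> B \<and> c \<in> C}"
  then obtain a b c a' b' c' where "x = a \<inter> b \<inter> c" "y = a' \<inter> b' \<inter> c'" and *: "a \<in> A" "b \<in> B" "c \<in> C" "a' \<in> A" "b' \<in> B" "c' \<in> C"
    by auto
  then have "x \<inter> y = (a \<inter> a') \<inter> (b \<inter> b') \<inter> (c \<inter> c')" by auto
  moreover have "a \<inter> a' \<in> A" "b \<inter> b' \<in> B" "c \<inter> c' \<in> C" using * assms by (auto dest: Int_stableD)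
  ultimately show "x \<inter> y \<in> {a \<inter> b \<inter> c |a b c. a \<in> A \<and> b \<in> B \<and> c \<in> C}" by blast
qed

lemma Int_stable_generated_events: "Int_stable (generated_events \<Omega> I S Z)"
  by (rule Int_stableI) (rule generated_events_Int)

text \<open>The six-fold factorisation holds for intersections of one event per driver; these
  generators are stable under intersection, so independence passes to the sigma-algebras they
  generate.\<close>

lemma past_future_indep:
  assumes "0 \<le> s" "s \<le> T"
  shows "indep_set (sets (past s k)) (sets (future s T k))"
  unfolding sets_past sets_future
proof (rule indep_set_sigma_sets)
  show "indep_set (past_sets s k)
    (future_sets s T k)"
  proof (rule indep_set_Int3[OF generators_indep])
    show "indep_set (generated_events \<Omega> {0..s} borel W) {(\<lambda>\<omega>. W T \<omega> - W s \<omega>) -` A \<inter> space \<Omega> |A. A \<in> sets borel}"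
      by (rule indep_set_past_increment) (use W_measurable W_0 W_increments assms in auto)
    show "indep_set (generated_events \<Omega> {0..s} (count_space UNIV) N) {(\<lambda>\<omega>. N T \<omega> - N s \<omega>) -` A \<inter> space \<Omega> |A. A \<in> sets (count_space UNIV)}"
      by (rule indep_set_past_increment_nat) (use N_measurable N_0 N_mono N_increments assms in auto)
    show "indep_set (generated_events \<Omega> {1..k} borel Y) (generated_events \<Omega> {k<..} borel Y)"
      by (rule indep_set_generated_events_disjoint, rule indep_vars_subset[OF Y_indep]) auto
    have "(\<lambda>\<omega>. W T \<omega> - W s \<omega>) \<in> borel_measurable (sigma (space \<Omega>) gen_W)"
      using assms by (intro borel_measurable_diff measurable_sigma_gen_W) auto
    then show "{(\<lambda>\<omega>. W T \<omega> - W s \<omega>) -` A \<inter> space \<Omega> |A. A \<in> sets borel} \<subseteq> gen_W"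
      by (auto dest!: measurable_sets simp: sets_sigma_generated_events space_measure_of_conv)
    have "(\<lambda>\<omega>. N T \<omega> - N s \<omega>) \<in> measurable (sigma (space \<Omega>) gen_N) (count_space UNIV)"
      using measurable_sigma_gen_N[of T] measurable_sigma_gen_N[of s] assms by simp
    from measurable_sets[OF this]
    show "{(\<lambda>\<omega>. N T \<omega> - N s \<omega>) -` A \<inter> space \<Omega> |A. A \<in> sets (count_space UNIV)} \<subseteq> gen_N"
      by (auto simp: sets_sigma_generated_events space_measure_of_conv)
  qed (auto intro: generated_events_Int intro!: generated_events_mono)
qed (intro Int_stable_Int3 Int_stable_generated_events Int_stable_vimage)+

lemma past_memI:
  shows "a \<in> generated_events \<Omega> {0..s} borel W \<Longrightarrow> a \<in> sets (past s k)"
    and "b \<in> generated_events \<Omega> {0..s} (count_space UNIV) N \<Longrightarrow> b \<in> sets (past s k)"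
    and "c \<in> generated_events \<Omega> {1..k} borel Y \<Longrightarrow> c \<in> sets (past s k)"
proof -
  have basic: "a \<inter> b \<inter> c \<in> sets (past s k)" if "a \<in> generated_events \<Omega> {0..s} borel W"
    "b \<in> generated_events \<Omega> {0..s} (count_space UNIV) N" "c \<in> generated_events \<Omega> {1..k} borel Y" for a b c
    unfolding sets_past by (rule sigma_sets.Basic) (use that in blast)
  show "a \<in> generated_events \<Omega> {0..s} borel W \<Longrightarrow> a \<in> sets (past s k)"
    using basic[of a "space \<Omega>" "space \<Omega>"] space_in_generated_events by (metis gen_subset_Pow Int_absorb2)
  show "b \<in> generated_events \<Omega> {0..s} (count_space UNIV) N \<Longrightarrow> b \<in> sets (past s k)"
    using basic[of "space \<Omega>" b "space \<Omega>"] space_in_generated_events by (metis gen_subset_Pow Int_absorb1 Int_absorb2)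
  show "c \<in> generated_events \<Omega> {1..k} borel Y \<Longrightarrow> c \<in> sets (past s k)"
    using basic[of "space \<Omega>" "space \<Omega>" c] space_in_generated_events by (metis gen_subset_Pow Int_absorb1 Int_absorb2 order_refl)
qed

lemma measurable_past:
  shows "0 \<le> r \<Longrightarrow> r \<le> s \<Longrightarrow> W r \<in> borel_measurable (past s k)"
    and "0 \<le> r \<Longrightarrow> r \<le> s \<Longrightarrow> N r \<in> measurable (past s k) (count_space UNIV)"
    and "1 \<le> i \<Longrightarrow> i \<le> k \<Longrightarrow> Y i \<in> borel_measurable (past s k)"
  subgoal by (auto intro!: measurableI past_memI(1) vimage_in_generated_events)
  subgoal by (auto intro!: measurableI past_memI(2) vimage_in_generated_events)
  subgoal by (auto intro!: measurableI past_memI(3) vimage_in_generated_events)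
  done

lemma future_memI:
  shows "A \<in> sets borel \<Longrightarrow> (\<lambda>\<omega>. W T \<omega> - W s \<omega>) -` A \<inter> space \<Omega> \<in> sets (future s T k)"
    and "(\<lambda>\<omega>. N T \<omega> - N s \<omega>) -` B \<inter> space \<Omega> \<in> sets (future s T k)"
    and "c \<in> generated_events \<Omega> {k<..} borel Y \<Longrightarrow> c \<in> sets (future s T k)"
proof -
  have basic: "((\<lambda>\<omega>. W T \<omega> - W s \<omega>) -` A \<inter> space \<Omega>) \<inter> ((\<lambda>\<omega>. N T \<omega> - N s \<omega>) -` B \<inter> space \<Omega>) \<inter> c \<in> sets (future s T k)"
    if "A \<in> sets borel" "c \<in> generated_events \<Omega> {k<..} borel Y" for A B c
    unfolding sets_future 
    by (rule sigma_sets.Basic, rule CollectI, rule exI, rule exI, rule exI, rule conjI[OF refl]) (use that in auto)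
  show "A \<in> sets borel \<Longrightarrow> (\<lambda>\<omega>. W T \<omega> - W s \<omega>) -` A \<inter> space \<Omega> \<in> sets (future s T k)"
    using basic[of A "space \<Omega>" UNIV] by (simp add: space_in_generated_events Int_assoc)
  show "(\<lambda>\<omega>. N T \<omega> - N s \<omega>) -` B \<inter> space \<Omega> \<in> sets (future s T k)"
    using basic[of UNIV "space \<Omega>" B] by (simp add: space_in_generated_events Int_ac)
  show "c \<in> generated_events \<Omega> {k<..} borel Y \<Longrightarrow> c \<in> sets (future s T k)"
    using basic[of UNIV c UNIV] gen_subset_Pow[of c "{k<..}" borel Y] by (simp add: Int_absorb1)
qed

lemma measurable_future:
  shows "(\<lambda>\<omega>. W T \<omega> - W s \<omega>) \<in> borel_measurable (future s T k)"
    and "(\<lambda>\<omega>. N T \<omega> - N s \<omega>) \<in> measurable (future s T k) (count_space UNIV)"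
    and "k < i \<Longrightarrow> Y i \<in> borel_measurable (future s T k)"
  subgoal by (auto intro!: measurableI future_memI(1))
  subgoal by (auto intro!: measurableI future_memI(2))
  subgoal by (auto intro!: measurableI future_memI(3) vimage_in_generated_events)
  done

text \<open>On \<open>N s = k\<close> this is the increment of the process over
  \<open>[s, T]\<close>. The jumps are counted from the deterministic index \<open>Suc k\<close> and
  not from \<open>N s + 1\<close>, which makes the variable measurable for
  \<open>future s T k\<close> on the whole space.\<close>

definition increment :: "nat \<Rightarrow> real \<Rightarrow> real \<Rightarrow> 'a \<Rightarrow> real" where
  "increment k s T \<omega> = drift P * (T - s) + volatility P * (W T \<omega> - W s \<omega>) + (\<Sum>i=Suc k..k + (N T \<omega> - N s \<omega>). Y i \<omega>)"

lemma increment_measurable_future: "increment k s T \<in> borel_measurable (future s T k)"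
proof -
  have "(\<lambda>\<omega>. \<Sum>i=Suc k..k + (N T \<omega> - N s \<omega>). Y i \<omega>) \<in> borel_measurable (future s T k)"
    by (rule measurable_compose_countable[OF _ measurable_future(2), of "\<lambda>n \<omega>. \<Sum>i=Suc k..k + n. Y i \<omega>"])
       (auto intro!: borel_measurable_sum measurable_future(3))
  then show ?thesis
    unfolding increment_def[abs_def] using measurable_future(1) by (intro borel_measurable_add borel_measurable_times) auto
qed

lemma indep_var_past_future:
  assumes "0 \<le> s" "s \<le> T" "A \<in> measurable (past s k) S" "B \<in> measurable (future s T k) S'"
  shows "indep_var S A S' B"
  by (rule indep_var_of_indep_set[OF past_future_indep[OF assms(1,2)]]) (use assms in auto)

end

section \<open>Transforms of jump sums and stationarity of the increments\<close>

context mejd_model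
begin

lemma jump_transform:
  assumes "1 \<le> i" "z \<in> strip P"
  shows "has_bochner_integral \<Omega> (\<lambda>\<omega>. exp (z * of_real (Y i \<omega>))) (jump_mgf P z)"
proof (rule has_bochner_integral_distributed[OF Y_distributed[OF assms(1)]])
  show "jump_density P \<in> borel_measurable lborel"
    unfolding jump_density_def[abs_def] by measurable
qed (use jump_density_nonneg has_bochner_integral_jump_mgf[OF params assms(2)] in auto)

lemma jump_sum_transform:
  assumes "z \<in> strip P"
  shows "has_bochner_integral \<Omega> (\<lambda>\<omega>. exp (z * of_real (\<Sum>i=Suc k..k + n. Y i \<omega>))) (jump_mgf P z ^ n)"
proof -
  have indep: "indep_vars (\<lambda>_. borel) (\<lambda>i \<omega>. exp (z * of_real (Y i \<omega>))) {Suc k..k + n}"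
    by (rule indep_vars_compose2[where X=Y and M'="\<lambda>_. borel" and Y="\<lambda>_ y. exp (z * of_real y)"])
       (auto intro: indep_vars_subset[OF Y_indep])
  have "has_bochner_integral \<Omega> (\<lambda>\<omega>. \<Prod>i\<in>{Suc k..k + n}. exp (z * of_real (Y i \<omega>))) (jump_mgf P z ^ n)"
    using indep_vars_lebesgue_integral[OF _ indep] indep_vars_integrable[OF _ indep] jump_transform[OF _ assms]
    by (simp add: has_bochner_integral_iff)
  then show ?thesis by (simp add: exp_sum sum_distrib_left)
qed

lemma indep_W_NY: "indep_set gen_W (sigma_sets (space \<Omega>) (gen_N \<union> gen_Y))"
proof -
  have "indep_sets (\<lambda>b. sigma_sets (space \<Omega>) (\<Union>k\<in>(case b of True \<Rightarrow> {0} | False \<Rightarrow> {1, 2}). [gen_W, gen_N, gen_Y] ! k)) UNIV"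
  proof (rule indep_sets_collect_sigma)
    have "(\<Union>b\<in>UNIV. case b of True \<Rightarrow> {0} | False \<Rightarrow> {1, 2}) = {..<3::nat}" by (auto simp: UNIV_bool)
    then show "indep_sets (\<lambda>k. [gen_W, gen_N, gen_Y] ! k) (\<Union>b\<in>UNIV. case b of True \<Rightarrow> {0} | False \<Rightarrow> {1, 2})"
      using generators_indep by simp
  qed (auto simp: disjoint_family_on_def Int_stable_generated_events split: bool.splits)
  then show ?thesis
    unfolding indep_set_def by (rule indep_sets_mono_sets) (auto split: bool.split intro: sigma_sets.Basic)
qed

lemma indep_N_Y: "indep_set gen_N gen_Y"
proof -
  have "indep_sets (\<lambda>b. sigma_sets (space \<Omega>) (\<Union>k\<in>(case b of True \<Rightarrow> {1} | False \<Rightarrow> {2}). [gen_W, gen_N, gen_Y] ! k)) UNIV"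
  proof (rule indep_sets_collect_sigma)
    show "indep_sets (\<lambda>k. [gen_W, gen_N, gen_Y] ! k) (\<Union>b\<in>UNIV. case b of True \<Rightarrow> {1} | False \<Rightarrow> {2})"
      by (rule indep_sets_mono_index[OF _ generators_indep]) (auto split: bool.splits)
  qed (auto simp: disjoint_family_on_def Int_stable_generated_events split: bool.splits)
  then show ?thesis
    unfolding indep_set_def by (rule indep_sets_mono_sets) (auto split: bool.split intro: sigma_sets.Basic)
qed

lemma measurable_sigma_gen_NY:
  "0 \<le> t \<Longrightarrow> N t \<in> measurable (sigma (space \<Omega>) (gen_N \<union> gen_Y)) (count_space UNIV)"
  "1 \<le> i \<Longrightarrow> Y i \<in> borel_measurable (sigma (space \<Omega>) (gen_N \<union> gen_Y))"
proof -
  have sub: "gen_N \<union> gen_Y \<subseteq> Pow (space \<Omega>)" by (auto dest: gen_subset_Pow)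
  show "0 \<le> t \<Longrightarrow> N t \<in> measurable (sigma (space \<Omega>) (gen_N \<union> gen_Y)) (count_space UNIV)"
    using sub by (auto intro!: measurableI sigma_sets.Basic vimage_in_generated_events simp: space_measure_of_conv)
  show "1 \<le> i \<Longrightarrow> Y i \<in> borel_measurable (sigma (space \<Omega>) (gen_N \<union> gen_Y))"
    using sub by (auto intro!: measurableI sigma_sets.Basic disjI2 vimage_in_generated_events simp: space_measure_of_conv)
qed

text \<open>Decomposition according to the number \<open>D\<close> of jumps: on \<open>D = n\<close>
  the sum has \<open>n\<close> independent jumps and is independent of \<open>D\<close>, so the term
  contributes \<open>p n * jump_mgf P z ^ n\<close>, and these add up to an exponential series.
  Summation and expectation are interchanged by absolute convergence.\<close>

lemma compound_poisson_transform:
  assumes "0 \<le> s" "s < T" and z: "z \<in> strip P"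
  shows "has_bochner_integral \<Omega> (\<lambda>\<omega>. exp (z * of_real (\<Sum>i=Suc k..k + (N T \<omega> - N s \<omega>). Y i \<omega>)))
    (exp (of_real (rate P * (T - s)) * (jump_mgf P z - 1)))"
proof -
  define D where "D \<omega> = N T \<omega> - N s \<omega>" for \<omega>
  define p where "p n = pmf (poisson_pmf (rate P * (T - s))) n" for n
  have c_pos: "0 < rate P * (T - s)" using rate_pos assms by simp
  have p: "p n = (rate P * (T - s)) ^ n / fact n * exp (- (rate P * (T - s)))" for n
    unfolding p_def by (rule pmf_poisson[OF c_pos])
  have p_nonneg: "0 \<le> p n" for n by (simp add: p_def)
  have D_gen: "D \<in> measurable (sigma (space \<Omega>) gen_N) (count_space UNIV)"
    unfolding D_def[abs_def] using measurable_sigma_gen_N[of T] measurable_sigma_gen_N[of s] assms by simp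
  have D_meas[measurable]: "D \<in> measurable \<Omega> (count_space UNIV)"
    unfolding D_def[abs_def] using N_measurable[of T] N_measurable[of s] assms by simp
  have D_int: "has_bochner_integral \<Omega> (\<lambda>\<omega>. complex_of_real (indicator {n} (D \<omega>))) (of_real (p n))" for n
  proof -
    have "p n = measure (distr \<Omega> (count_space UNIV) D) {n}"
      using N_distr[of s T] assms by (simp add: p_def D_def[abs_def] measure_pmf_single)
    also have "\<dots> = measure \<Omega> (D -` {n} \<inter> space \<Omega>)"
      by (rule measure_distr) auto
    finally have "p n = measure \<Omega> (D -` {n} \<inter> space \<Omega>)" .
    moreover have "has_bochner_integral \<Omega> (\<lambda>\<omega>. indicator (D -` {n} \<inter> space \<Omega>) \<omega>) (measure \<Omega> (D -` {n} \<inter> space \<Omega>))"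
      by (intro has_bochner_integral_real_indicator) (auto simp: emeasure_eq_measure)
    ultimately have "has_bochner_integral \<Omega> (\<lambda>\<omega>. indicator {n} (D \<omega>)) (p n)"
      by (subst has_bochner_integral_cong[OF refl _ refl, where g="\<lambda>\<omega>. indicator (D -` {n} \<inter> space \<Omega>) \<omega>"])
         (auto split: split_indicator)
    then show ?thesis by (rule has_bochner_integral_of_real)
  qed
  define f where "f z n \<omega> = complex_of_real (indicator {n} (D \<omega>)) * exp (z * of_real (\<Sum>i=Suc k..k + n. Y i \<omega>))" for z n \<omega>
  have f_int: "has_bochner_integral \<Omega> (f z n) (of_real (p n) * jump_mgf P z ^ n)" if "z \<in> strip P" for z n
  proof -
    have "indep_var borel (\<lambda>\<omega>. complex_of_real (indicator {n} (D \<omega>))) borel (\<lambda>\<omega>. exp (z * of_real (\<Sum>i=Suc k..k + n. Y i \<omega>)))"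
    proof (rule indep_var_of_indep_set)
      show "indep_set (sets (sigma (space \<Omega>) gen_N)) (sets (sigma (space \<Omega>) gen_Y))"
        using indep_N_Y by (simp only: sets_sigma_generated_events)
      show "(\<lambda>\<omega>. complex_of_real (indicator {n} (D \<omega>))) \<in> borel_measurable (sigma (space \<Omega>) gen_N)"
        by (rule measurable_compose[OF D_gen]) simp
      have "(\<lambda>\<omega>. \<Sum>i=Suc k..k + n. Y i \<omega>) \<in> borel_measurable (sigma (space \<Omega>) gen_Y)"
        by (intro borel_measurable_sum measurable_sigma_gen_Y) auto
      then show "(\<lambda>\<omega>. exp (z * of_real (\<Sum>i=Suc k..k + n. Y i \<omega>))) \<in> borel_measurable (sigma (space \<Omega>) gen_Y)"
        by measurable
    qed (auto simp: space_measure_of_conv)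
    from indep_var_lebesgue_integral[OF this] indep_var_integrable[OF this]
    show ?thesis
      using D_int[of n] jump_sum_transform[OF that, of k n] unfolding f_def has_bochner_integral_iff by simp
  qed
  \<comment> \<open>Since \<open>norm (exp (z * S)) = exp (Re z * S)\<close> for real
    \<open>S\<close>, the norm of a term is the corresponding term at the real point
    \<open>Re z\<close>, which is again in the strip, so its integral is already known.\<close>
  have norm_bound: "(\<integral>\<omega>. norm (f z n \<omega>) \<partial>\<Omega>) \<le> p n * cmod (jump_mgf P (Re z)) ^ n" for n
  proof -
    have "norm (f z n \<omega>) = Re (f (Re z) n \<omega>)" for \<omega>
      by (simp add: f_def norm_mult norm_exp_eq_Re Re_exp split: split_indicator)
    then have "(\<integral>\<omega>. norm (f z n \<omega>) \<partial>\<Omega>) = Re (\<integral>\<omega>. f (Re z) n \<omega> \<partial>\<Omega>)"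
      using f_int[OF strip_real[OF z], of n] by (simp add: has_bochner_integral_iff)
    also have "\<dots> = Re (of_real (p n) * jump_mgf P (Re z) ^ n)"
      using f_int[OF strip_real[OF z], of n] by (simp add: has_bochner_integral_iff)
    also have "\<dots> \<le> cmod (of_real (p n) * jump_mgf P (Re z) ^ n)"
      by (rule complex_Re_le_cmod)
    also have "\<dots> = p n * cmod (jump_mgf P (Re z)) ^ n"
      using p_nonneg by (simp add: norm_mult norm_power)
    finally show ?thesis .
  qed
  define c where "c = rate P * (T - s)"
  \<comment> \<open>Kept polymorphic because the same series is summed over the reals, to bound the
    norms, and over the complex numbers, to find the value.\<close>
  have sums: "(\<lambda>n. of_real (p n) * w ^ n) sums exp (of_real c * (w - 1))"
    for w :: "'b :: {real_normed_field, banach}"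
  proof -
    have "(\<lambda>n. exp (- of_real c) * ((of_real c * w) ^ n /\<^sub>R fact n)) sums (exp (- of_real c) * exp (of_real c * w))"
      by (intro sums_mult exp_converges)
    moreover have "exp (- of_real c) * ((of_real c * w) ^ n /\<^sub>R fact n) = of_real (p n) * w ^ n" for n
      unfolding p c_def[symmetric] exp_of_real[of "- c", symmetric] of_real_mult
      by (simp add: scaleR_conv_of_real power_mult_distrib divide_inverse)
    ultimately show ?thesis by (simp add: algebra_simps flip: exp_add)
  qed
  have suminf_f: "(\<Sum>n. f z n \<omega>) = exp (z * of_real (\<Sum>i=Suc k..k + D \<omega>. Y i \<omega>))" for \<omega>
    by (subst suminf_finite[of "{D \<omega>}"]) (auto simp: f_def split: split_indicator)
  have int_f: "integrable \<Omega> (f z n)" for n using f_int[OF z, of n] by (simp add: has_bochner_integral_iff)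
  have AE: "AE \<omega> in \<Omega>. summable (\<lambda>n. norm (f z n \<omega>))"
    by (intro AE_I2 summable_finite[of "{D _}"]) (auto simp: f_def split: split_indicator)
  have summ: "summable (\<lambda>n. \<integral>\<omega>. norm (f z n \<omega>) \<partial>\<Omega>)"
    by (rule summable_comparison_test'[OF sums_summable[OF sums[of "cmod (jump_mgf P (Re z))"]], of 0])
       (use norm_bound in simp)
  have "(\<lambda>n. \<integral>\<omega>. f z n \<omega> \<partial>\<Omega>) = (\<lambda>n. of_real (p n) * jump_mgf P z ^ n)"
    using f_int[OF z] by (simp add: has_bochner_integral_iff)
  then have "(\<integral>\<omega>. (\<Sum>n. f z n \<omega>) \<partial>\<Omega>) = exp (of_real (rate P * (T - s)) * (jump_mgf P z - 1))"
    using integral_suminf[OF int_f AE summ] sums_unique[OF sums[of "jump_mgf P z"]] by (simp add: c_def)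
  then show ?thesis
    using integrable_suminf[OF int_f AE summ] unfolding suminf_f D_def by (simp add: has_bochner_integral_iff)
qed

text \<open>Product of the Gaussian and the compound Poisson transform, the two parts being
  independent. The value does not depend on \<open>k\<close> because the jumps are identically
  distributed. The case \<open>s = T\<close> is separate because the laws of the driver increments
  are given for \<open>s < T\<close>.\<close>

lemma increment_transform:
  assumes "0 \<le> s" "s \<le> T" and z: "z \<in> strip P"
  shows "has_bochner_integral \<Omega> (\<lambda>\<omega>. exp (z * of_real (increment k s T \<omega>))) (exp (of_real (T - s) * complex_exponent P z))"
proof (cases "s = T")
  case True
  have "increment k T T = (\<lambda>_. 0)" by (intro ext) (simp add: increment_def)
  then show ?thesis unfolding True by (simp add: has_bochner_integral_iff prob_space)
next
  case False
  then have "s < T" using assms by simp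
  define S where "S \<omega> = (\<Sum>i=Suc k..k + (N T \<omega> - N s \<omega>). Y i \<omega>)" for \<omega>
  have normal: "has_bochner_integral \<Omega> (\<lambda>\<omega>. exp ((z * of_real (volatility P)) * of_real (W T \<omega> - W s \<omega>)))
      (exp (of_real (T - s) * (z * of_real (volatility P))\<^sup>2 / 2))"
    using has_bochner_integral_cexp_normal[OF W_distributed[OF assms(1) \<open>s < T\<close>]] \<open>s < T\<close> by simp
  have jumps: "has_bochner_integral \<Omega> (\<lambda>\<omega>. exp (z * of_real (S \<omega>))) (exp (of_real (rate P * (T - s)) * (jump_mgf P z - 1)))"
    unfolding S_def by (rule compound_poisson_transform[OF assms(1) \<open>s < T\<close> z])
  have indep: "indep_var borel (\<lambda>\<omega>. exp ((z * of_real (volatility P)) * of_real (W T \<omega> - W s \<omega>))) borel (\<lambda>\<omega>. exp (z * of_real (S \<omega>)))"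
  proof (rule indep_var_of_indep_set)
    have "sets (sigma (space \<Omega>) (gen_N \<union> gen_Y)) = sigma_sets (space \<Omega>) (gen_N \<union> gen_Y)"
      by (rule sets_measure_of) (auto dest: gen_subset_Pow)
    then show "indep_set (sets (sigma (space \<Omega>) gen_W)) (sets (sigma (space \<Omega>) (gen_N \<union> gen_Y)))"
      using indep_W_NY by (simp only: sets_sigma_generated_events)
    have "(\<lambda>\<omega>. W T \<omega> - W s \<omega>) \<in> borel_measurable (sigma (space \<Omega>) gen_W)"
      using assms by (intro borel_measurable_diff measurable_sigma_gen_W) auto
    then show "(\<lambda>\<omega>. exp ((z * of_real (volatility P)) * of_real (W T \<omega> - W s \<omega>))) \<in> borel_measurable (sigma (space \<Omega>) gen_W)"
      by measurable
    have "(\<lambda>\<omega>. N T \<omega> - N s \<omega>) \<in> measurable (sigma (space \<Omega>) (gen_N \<union> gen_Y)) (count_space UNIV)"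
      using measurable_sigma_gen_NY(1)[of T] measurable_sigma_gen_NY(1)[of s] assms by simp
    then have "S \<in> borel_measurable (sigma (space \<Omega>) (gen_N \<union> gen_Y))"
      unfolding S_def[abs_def]
      by (rule measurable_compose_countable[where f="\<lambda>n \<omega>. \<Sum>i=Suc k..k + n. Y i \<omega>", rotated])
         (auto simp del: One_nat_def intro!: borel_measurable_sum measurable_sigma_gen_NY(2))
    then show "(\<lambda>\<omega>. exp (z * of_real (S \<omega>))) \<in> borel_measurable (sigma (space \<Omega>) (gen_N \<union> gen_Y))"
      by measurable
  qed (auto simp: space_measure_of_conv)
  have prod: "has_bochner_integral \<Omega>
      (\<lambda>\<omega>. exp (z * of_real (drift P * (T - s))) * (exp ((z * of_real (volatility P)) * of_real (W T \<omega> - W s \<omega>)) * exp (z * of_real (S \<omega>))))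
      (exp (z * of_real (drift P * (T - s))) * (exp (of_real (T - s) * (z * of_real (volatility P))\<^sup>2 / 2) * exp (of_real (rate P * (T - s)) * (jump_mgf P z - 1))))"
    using indep_var_lebesgue_integral[OF indep] indep_var_integrable[OF indep] normal jumps
    by (intro has_bochner_integral_mult_right) (simp add: has_bochner_integral_iff)
  moreover have "exp (z * of_real (drift P * (T - s))) * (exp ((z * of_real (volatility P)) * of_real (W T \<omega> - W s \<omega>)) * exp (z * of_real (S \<omega>)))
      = exp (z * of_real (increment k s T \<omega>))" for \<omega>
    unfolding increment_def S_def by (simp add: algebra_simps flip: exp_add)
  moreover have "exp (z * of_real (drift P * (T - s))) * (exp (of_real (T - s) * (z * of_real (volatility P))\<^sup>2 / 2) * exp (of_real (rate P * (T - s)) * (jump_mgf P z - 1)))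
      = exp (of_real (T - s) * complex_exponent P z)"
    unfolding complex_exponent_def by (simp add: algebra_simps power2_eq_square add_divide_distrib diff_divide_distrib flip: exp_add)
  ultimately show ?thesis by simp
qed

lemma increment_measurable: "0 \<le> s \<Longrightarrow> s \<le> T \<Longrightarrow> increment k s T \<in> borel_measurable \<Omega>"
  using indep_var_past_future[of s T "\<lambda>_. 0" k borel "increment k s T" borel] increment_measurable_future
  by (auto dest: indep_var_rv2)

text \<open>The characteristic function is the transform on the imaginary axis, and there only
  \<open>T - s\<close> enters.\<close>

lemma distr_increment:
  assumes "0 \<le> s" "s \<le> T"
  shows "distr \<Omega> borel (increment k s T) = distr \<Omega> borel (increment 0 0 (T - s))"
proof (rule Levy_uniqueness)
  have char: "char (distr \<Omega> borel (increment k s T)) \<xi> = exp (of_real (T - s) * complex_exponent P (\<i> * of_real \<xi>))"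
    if "0 \<le> s" "s \<le> T" for k s T \<xi>
  proof -
    have "char (distr \<Omega> borel (increment k s T)) \<xi> = (\<integral>\<omega>. exp ((\<i> * of_real \<xi>) * of_real (increment k s T \<omega>)) \<partial>\<Omega>)"
      unfolding char_def using increment_measurable[OF that] by (subst integral_distr) (auto simp: mult_ac)
    also have "\<dots> = exp (of_real (T - s) * complex_exponent P (\<i> * of_real \<xi>))"
      using increment_transform[OF that imaginary_in_strip, of "\<i> * of_real \<xi>" k] by (simp add: has_bochner_integral_iff)
    finally show ?thesis .
  qed
  show "char (distr \<Omega> borel (increment k s T)) = char (distr \<Omega> borel (increment 0 0 (T - s)))"
    using assms by (intro ext) (simp add: char)
qed (use assms in \<open>auto intro!: real_distribution_distr increment_measurable\<close>)

end

section \<open>The killed process and its resolvent\<close>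

lemma (in prob_space) nn_integral_indep_var:
  assumes indep: "indep_var S A T B" and F[measurable]: "F \<in> borel_measurable (S \<Otimes>\<^sub>M T)"
  shows "(\<integral>\<^sup>+\<omega>. F (A \<omega>, B \<omega>) \<partial>M) = (\<integral>\<^sup>+\<omega>. \<integral>\<^sup>+\<omega>'. F (A \<omega>, B \<omega>') \<partial>M \<partial>M)"
proof -
  have A[measurable]: "A \<in> measurable M S" and B[measurable]: "B \<in> measurable M T"
    and eq: "distr M S A \<Otimes>\<^sub>M distr M T B = distr M (S \<Otimes>\<^sub>M T) (\<lambda>x. (A x, B x))"
    using indep unfolding indep_var_distribution_eq by auto
  interpret B: prob_space "distr M T B" by (rule prob_space_distr) (rule B)
  have "(\<integral>\<^sup>+\<omega>. F (A \<omega>, B \<omega>) \<partial>M) = (\<integral>\<^sup>+p. F p \<partial>(distr M S A \<Otimes>\<^sub>M distr M T B))"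
    unfolding eq by (subst nn_integral_distr) auto
  also have "\<dots> = (\<integral>\<^sup>+a. \<integral>\<^sup>+b. F (a, b) \<partial>distr M T B \<partial>distr M S A)"
    by (rule B.nn_integral_fst[symmetric]) measurable
  also have "\<dots> = (\<integral>\<^sup>+\<omega>. \<integral>\<^sup>+b. F (A \<omega>, b) \<partial>distr M T B \<partial>M)"
    by (subst nn_integral_distr) auto
  also have "\<dots> = (\<integral>\<^sup>+\<omega>. \<integral>\<^sup>+\<omega>'. F (A \<omega>, B \<omega>') \<partial>M \<partial>M)"
  proof (rule nn_integral_cong)
    fix \<omega> assume "\<omega> \<in> space M"
    then have "(\<lambda>b. F (A \<omega>, b)) \<in> borel_measurable T"
      using measurable_space[OF A] by measurable
    then show "(\<integral>\<^sup>+b. F (A \<omega>, b) \<partial>distr M T B) = (\<integral>\<^sup>+\<omega>'. F (A \<omega>, B \<omega>') \<partial>M)"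
      by (subst nn_integral_distr) auto
  qed
  finally show ?thesis .
qed

lemma nn_integral_split_nat:
  assumes [measurable]: "n \<in> measurable M (count_space UNIV)" "F \<in> borel_measurable M"
  shows "(\<integral>\<^sup>+\<omega>. F \<omega> \<partial>M) = (\<Sum>k::nat. \<integral>\<^sup>+\<omega>. indicator {k} (n \<omega>) * F \<omega> \<partial>M)"
proof -
  have [measurable]: "(\<lambda>\<omega>. indicator {k} (n \<omega>) :: ennreal) \<in> borel_measurable M" for k
    by (rule measurable_compose[OF assms(1)]) simp
  have "F \<omega> = (\<Sum>k. indicator {k} (n \<omega>) * F \<omega>)" for \<omega>
    by (subst suminf_finite[of "{n \<omega>}"]) auto
  then have "(\<integral>\<^sup>+\<omega>. F \<omega> \<partial>M) = (\<integral>\<^sup>+\<omega>. (\<Sum>k. indicator {k} (n \<omega>) * F \<omega>) \<partial>M)" by simp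
  also have "\<dots> = (\<Sum>k. \<integral>\<^sup>+\<omega>. indicator {k} (n \<omega>) * F \<omega> \<partial>M)"
    by (rule nn_integral_suminf) measurable
  finally show ?thesis .
qed

text \<open>A right-continuous path with natural values is constant on some interval to the right of
  \<open>r\<close>, so \<open>J (N t)\<close> is right-continuous for an arbitrary \<open>J\<close>.
  The generality serves both the full jump sum and the one truncated after \<open>k\<close>
  jumps.\<close>

lemma (in mejd_model) process_right_continuous:
  assumes \<omega>: "\<omega> \<in> space \<Omega>" and "0 \<le> r"
  shows "continuous (at_right r) (\<lambda>t. drift P * t + volatility P * W t \<omega> + J (N t \<omega>))"
proof -
  have "((\<lambda>t. N t \<omega>) \<longlongrightarrow> N r \<omega>) (at_right r)"
    using N_right_continuous[OF assms] by (simp add: continuous_within)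
  then have "\<forall>\<^sub>F t in at_right r. N t \<omega> = N r \<omega>" by (simp add: tendsto_discrete)
  then have "\<forall>\<^sub>F t in at_right r. J (N t \<omega>) = J (N r \<omega>)" by eventually_elim simp
  then have "((\<lambda>t. J (N t \<omega>)) \<longlongrightarrow> J (N r \<omega>)) (at_right r)" by (rule tendsto_eventually)
  moreover have "((\<lambda>t. W t \<omega>) \<longlongrightarrow> W r \<omega>) (at_right r)"
  proof -
    have "((\<lambda>t. W t \<omega>) \<longlongrightarrow> W r \<omega>) (at r within {0..})"
      using W_continuous[OF \<omega>] \<open>0 \<le> r\<close> by (simp add: continuous_on_def)
    then show ?thesis by (rule tendsto_within_subset) (use \<open>0 \<le> r\<close> in auto)
  qed
  ultimately show ?thesis unfolding continuous_within by (auto intro!: tendsto_intros)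
qed

section \<open>Occupation time, survival weight and the Markov property\<close>

locale killed_mejd = mejd_model +
  fixes h H \<rho> \<alpha> :: real
  assumes h_less_H: "h < H" and rho_pos: "0 < \<rho>" and alpha_pos: "0 < \<alpha>"
begin

text \<open>The process started at 0; a start at \<open>x\<close> is a translation. Times are
  clamped at 0 because the drivers are unconstrained at negative times, while joint measurability is
  wanted on the whole line.\<close>

definition X :: "real \<Rightarrow> 'a \<Rightarrow> real" where
  "X t \<omega> = mejd_process P W N Y 0 (max 0 t) \<omega>"

lemma mejd_process_eq: "0 \<le> t \<Longrightarrow> mejd_process P W N Y x t \<omega> = x + X t \<omega>"
  by (simp add: X_def mejd_process_def)

lemma X_eq_increment: "\<omega> \<in> space \<Omega> \<Longrightarrow> X t \<omega> = increment 0 0 (max 0 t) \<omega>"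
  by (simp add: X_def mejd_process_def increment_def W_0 N_0)

lemma X_measurable [measurable (raw)]:
  assumes "f \<in> borel_measurable M" "g \<in> measurable M \<Omega>"
  shows "(\<lambda>x. X (f x) (g x)) \<in> borel_measurable M"
proof -
  have "(\<lambda>(r, \<omega>). drift P * max 0 r + volatility P * W (max 0 r) \<omega> + (\<Sum>i=1..N (max 0 r) \<omega>. Y i \<omega>)) \<in> borel_measurable (borel \<Otimes>\<^sub>M \<Omega>)"
  proof (rule borel_measurable_right_continuous_process[where Z="\<lambda>r \<omega>. drift P * r + volatility P * W r \<omega> + (\<Sum>i=1..N r \<omega>. Y i \<omega>)"])
    fix r :: real assume r: "0 \<le> r"
    have "(\<lambda>\<omega>. \<Sum>i=1..N r \<omega>. Y i \<omega>) \<in> borel_measurable \<Omega>"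
      by (rule measurable_compose_countable[OF _ N_measurable[OF r], of "\<lambda>n \<omega>. \<Sum>i=1..n. Y i \<omega>"])
         (intro borel_measurable_sum Y_measurable, simp)
    then show "(\<lambda>\<omega>. drift P * r + volatility P * W r \<omega> + (\<Sum>i=1..N r \<omega>. Y i \<omega>)) \<in> borel_measurable \<Omega>"
      using W_measurable[OF r] by measurable
  qed (rule process_right_continuous)
  then have "(\<lambda>p. X (fst p) (snd p)) \<in> borel_measurable (borel \<Otimes>\<^sub>M \<Omega>)"
    by (simp add: X_def mejd_process_def case_prod_beta')
  from measurable_compose[OF measurable_Pair[OF assms] this] show ?thesis by simp
qed

definition occupation :: "real \<Rightarrow> real \<Rightarrow> 'a \<Rightarrow> real" where
  "occupation x t \<omega> = (LBINT r:{0..t}. indicator {h<..<H} (x + X r \<omega>))"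

lemma occupation_measurable [measurable (raw)]:
  assumes [measurable]: "f \<in> borel_measurable M" "g \<in> measurable M \<Omega>"
  shows "(\<lambda>z. occupation x (f z) (g z)) \<in> borel_measurable M"
  unfolding occupation_def by (rule borel_measurable_indefinite_integral) measurable

lemma occupation_nonneg: "0 \<le> occupation x t \<omega>"
  unfolding occupation_def set_lebesgue_integral_def by (rule integral_nonneg_AE) auto

definition survival :: "real \<Rightarrow> real \<Rightarrow> 'a \<Rightarrow> real" where
  "survival x t \<omega> = exp (- \<rho> * occupation x t \<omega>)"

lemma survival_measurable [measurable (raw)]:
  assumes [measurable]: "f \<in> borel_measurable M" "g \<in> measurable M \<Omega>"
  shows "(\<lambda>z. survival x (f z) (g z)) \<in> borel_measurable M"
  unfolding survival_def by measurable

lemma survival_pos: "0 < survival x t \<omega>" and survival_le_1: "survival x t \<omega> \<le> 1"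
  using occupation_nonneg[of x t \<omega>] rho_pos by (auto simp: survival_def)

text \<open>\<open>\<rho> * kill x s\<close> is the density in \<open>s\<close> of the lost mass
  \<open>1 - survival x T\<close>; it lives on the times at which the path is inside the
  corridor.\<close>

definition kill :: "real \<Rightarrow> real \<Rightarrow> 'a \<Rightarrow> real" where
  "kill x s \<omega> = indicator {h<..<H} (x + X s \<omega>) * survival x s \<omega>"

lemma kill_measurable [measurable (raw)]:
  assumes [measurable]: "f \<in> borel_measurable M" "g \<in> measurable M \<Omega>"
  shows "(\<lambda>z. kill x (f z) (g z)) \<in> borel_measurable M"
  unfolding kill_def by measurable

lemma kill_nonneg: "0 \<le> kill x s \<omega>" and kill_le_1: "kill x s \<omega> \<le> 1"
  using survival_pos[of x s \<omega>] survival_le_1[of x s \<omega>] by (auto simp: kill_def split: split_indicator)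

text \<open>The pathwise identity for the occupation time in \<open>ennreal\<close>, where it can be
  multiplied by any nonnegative function and integrated before finiteness is known.\<close>

lemma survival_identity:
  assumes \<omega>: "\<omega> \<in> space \<Omega>" and "0 \<le> T"
  shows "ennreal (survival x T \<omega>) + ennreal \<rho> * (\<integral>\<^sup>+s. ennreal (indicator {0..T} s * kill x s \<omega>) \<partial>lborel) = 1"
proof -
  have [measurable]: "(\<lambda>_. \<omega>) \<in> measurable borel \<Omega>" using \<omega> by simp
  have int: "integrable lborel (\<lambda>s. indicator {0..T} s * kill x s \<omega>)"
    by (rule Bochner_Integration.integrable_bound[of _ "indicator {0..T} :: real \<Rightarrow> real"])
       (use \<open>0 \<le> T\<close> kill_nonneg kill_le_1 in \<open>auto split: split_indicator intro!: integrable_real_indicator\<close>)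
  have "survival x T \<omega> + \<rho> * (LBINT s:{0..T}. kill x s \<omega>) = 1"
    using exp_occupation_identity[of "\<lambda>r. indicator {h<..<H} (x + X r \<omega>)" \<rho> T] rho_pos \<open>0 \<le> T\<close>
    by (simp add: survival_def kill_def occupation_def indicator_le_1)
  then have "survival x T \<omega> + \<rho> * (\<integral>s. indicator {0..T} s * kill x s \<omega> \<partial>lborel) = 1"
    by (simp add: set_lebesgue_integral_def)
  moreover have "0 \<le> (\<integral>s. indicator {0..T} s * kill x s \<omega> \<partial>lborel)"
    by (rule integral_nonneg_AE) (use kill_nonneg in auto)
  ultimately have "ennreal (survival x T \<omega>) + ennreal \<rho> * ennreal (\<integral>s. indicator {0..T} s * kill x s \<omega> \<partial>lborel) = 1"
    using rho_pos survival_pos[of x T \<omega>] by (simp flip: ennreal_mult ennreal_plus ennreal_1 del: ennreal_1)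
  then show ?thesis
    using int kill_nonneg by (subst nn_integral_eq_integral) auto
qed

text \<open>On \<open>N s = k\<close> the weight \<open>kill x s\<close> and the position at
  \<open>s\<close> are functions of the past with \<open>k\<close> jumps, and
  \<open>X T - X s\<close> is \<open>increment k s T\<close>, which is independent of that past and
  distributed as \<open>X (T - s)\<close>. Summation over \<open>k\<close> removes the
  restriction.\<close>

lemma markov_property:
  fixes f :: "real \<Rightarrow> ennreal"
  assumes st: "0 \<le> s" "s \<le> T" and f[measurable]: "f \<in> borel_measurable borel"
  shows "(\<integral>\<^sup>+\<omega>. ennreal (kill x s \<omega>) * f (x + X T \<omega>) \<partial>\<Omega>) =
    (\<integral>\<^sup>+\<omega>. ennreal (kill x s \<omega>) * (\<integral>\<^sup>+\<omega>'. f (x + X s \<omega> + X (T - s) \<omega>') \<partial>\<Omega>) \<partial>\<Omega>)"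
proof -
  \<comment> \<open>With the jump count capped at \<open>k\<close>, the path involves
    \<open>Y 1\<close>, ..., \<open>Y k\<close> only and is measurable for \<open>past s k\<close>
    everywhere. On \<open>N s = k\<close> the cap is inactive up to time \<open>s\<close>.\<close>
  define Z where "Z k r \<omega> = x + (drift P * r + volatility P * W r \<omega> + (\<Sum>i=1..min (N r \<omega>) k. Y i \<omega>))" for k r \<omega>
  \<comment> \<open>The version of \<open>kill x s\<close> that is measurable for
    \<open>past s k\<close>. The times are clamped to \<open>[0, s]\<close> so that the integrand is
    jointly measurable on the whole line without looking beyond \<open>s\<close>; on the range of
    integration the clamp changes nothing.\<close>
  define K where "K k \<omega> = indicator {h<..<H} (Z k s \<omega>) * exp (- \<rho> * (LBINT r:{0..s}. indicator {h<..<H} (Z k (min (max 0 r) s) \<omega>)))" for k \<omega>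
  define g where "g y = (\<integral>\<^sup>+\<omega>'. f (y + X (T - s) \<omega>') \<partial>\<Omega>)" for y
  have g_meas[measurable]: "g \<in> borel_measurable borel" unfolding g_def[abs_def] by measurable
  have Z_past: "Z k r \<in> borel_measurable (past s k)" if "0 \<le> r" "r \<le> s" for k r
  proof -
    have "(\<lambda>\<omega>. \<Sum>i=1..min (N r \<omega>) k. Y i \<omega>) \<in> borel_measurable (past s k)"
      by (rule measurable_compose_countable[OF _ measurable_past(2)[OF that], of "\<lambda>n \<omega>. \<Sum>i=1..min n k. Y i \<omega>"])
         (intro borel_measurable_sum measurable_past(3), auto)
    then show ?thesis unfolding Z_def[abs_def] using measurable_past(1)[OF that] by measurable
  qed
  have K_past: "K k \<in> borel_measurable (past s k)" for k
  proof -
    have "(\<lambda>(r, \<omega>). Z k (min (max 0 r) s) \<omega>) \<in> borel_measurable (borel \<Otimes>\<^sub>M past s k)"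
    proof (rule borel_measurable_right_continuous_process[where Z="\<lambda>r. Z k (min r s)"])
      fix \<omega> and r :: real assume \<omega>: "\<omega> \<in> space (past s k)" and r: "0 \<le> r"
      show "continuous (at_right r) (\<lambda>r. Z k (min r s) \<omega>)"
      proof (cases "r < s")
        case True
        have "continuous (at_right r) (\<lambda>r. Z k r \<omega>)"
          unfolding Z_def using process_right_continuous[of \<omega> r "\<lambda>n. \<Sum>i=1..min n k. Y i \<omega>"] \<omega> r
          by (auto intro!: continuous_intros)
        then have "((\<lambda>r. Z k r \<omega>) \<longlongrightarrow> Z k r \<omega>) (at_right r)" by (simp add: continuous_within)
        moreover have "\<forall>\<^sub>F u in at_right r. Z k u \<omega> = Z k (min u s) \<omega>"
          using True by (auto simp: eventually_at_right[OF True] intro!: exI[of _ s])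
        ultimately have "((\<lambda>u. Z k (min u s) \<omega>) \<longlongrightarrow> Z k r \<omega>) (at_right r)"
          by (rule Lim_transform_eventually)
        then show ?thesis using True by (simp add: continuous_within)
      next
        case False
        have "((\<lambda>u. Z k (min u s) \<omega>) \<longlongrightarrow> Z k (min r s) \<omega>) (at_right r)"
          by (rule tendsto_eventually) (use False in \<open>auto simp: eventually_at_filter intro!: always_eventually\<close>)
        then show ?thesis by (simp add: continuous_within)
      qed
    qed (use st in \<open>auto intro!: Z_past\<close>)
    then have [measurable]: "(\<lambda>p. Z k (min (max 0 (snd p)) s) (fst p)) \<in> borel_measurable (past s k \<Otimes>\<^sub>M borel)"
      by (subst (asm) measurable_pair_swap_iff) (simp add: case_prod_beta')
    have "(\<lambda>\<omega>. LBINT r:{0..s}. indicator {h<..<H} (Z k (min (max 0 r) s) \<omega>) :: real) \<in> borel_measurable (past s k)"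
      by (rule borel_measurable_indefinite_integral) (simp_all add: case_prod_beta')
    then show ?thesis unfolding K_def[abs_def] using Z_past[of s k] st by measurable
  qed
  have Z_eq: "Z k r \<omega> = x + X r \<omega>" if "\<omega> \<in> space \<Omega>" "N s \<omega> = k" "0 \<le> r" "r \<le> s" for k r \<omega>
  proof -
    have "N r \<omega> \<le> k" using mono_onD[OF N_mono[OF that(1)], of r s] that by auto
    then show ?thesis using that by (simp add: Z_def X_def mejd_process_def min_absorb1)
  qed
  have K_eq: "K k \<omega> = kill x s \<omega>" if "\<omega> \<in> space \<Omega>" "N s \<omega> = k" for k \<omega>
  proof -
    have "(LBINT r:{0..s}. indicator {h<..<H} (Z k (min (max 0 r) s) \<omega>) :: real) = occupation x s \<omega>"
      unfolding occupation_def set_lebesgue_integral_def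
      by (rule Bochner_Integration.integral_cong) (use Z_eq[OF that] in \<open>auto split: split_indicator\<close>)
    then show ?thesis using Z_eq[OF that, of s] st by (simp add: K_def kill_def survival_def)
  qed
  have X_T: "x + X T \<omega> = Z k s \<omega> + increment k s T \<omega>" if "\<omega> \<in> space \<Omega>" "N s \<omega> = k" for k \<omega>
  proof -
    have "k \<le> N T \<omega>" using mono_onD[OF N_mono[OF that(1)], of s T] that st by auto
    then have "(\<Sum>i=1..N T \<omega>. Y i \<omega>) = (\<Sum>i=1..k. Y i \<omega>) + (\<Sum>i=Suc k..k + (N T \<omega> - N s \<omega>). Y i \<omega>)"
      using sum.ub_add_nat[of 1 k "\<lambda>i. Y i \<omega>" "N T \<omega> - k"] that by simp
    then show ?thesis using that st by (simp add: Z_def X_def mejd_process_def increment_def algebra_simps)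
  qed
  have step: "(\<integral>\<^sup>+\<omega>. indicator {k} (N s \<omega>) * (ennreal (kill x s \<omega>) * f (x + X T \<omega>)) \<partial>\<Omega>) =
      (\<integral>\<^sup>+\<omega>. indicator {k} (N s \<omega>) * (ennreal (kill x s \<omega>) * g (x + X s \<omega>)) \<partial>\<Omega>)" for k
  proof -
    \<comment> \<open>The indicator belongs to the past component: it makes the product vanish off
      \<open>N s = k\<close>, so that the capped quantities \<open>K k\<close> and
      \<open>Z k s\<close> may stand for the true ones.\<close>
    define A where "A \<omega> = (indicator {k} (N s \<omega>) * K k \<omega>, Z k s \<omega>)" for \<omega>
    \<comment> \<open>the dummy component is there because indep_var relates variables of the same type\<close>
    define I where "I \<omega> = (increment k s T \<omega>, 0 :: real)" for \<omega>
    define F where "F p = ennreal (fst (fst p)) * f (snd (fst p) + fst (snd p))" for p :: "(real \<times> real) \<times> (real \<times> real)"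
    have "(\<lambda>\<omega>. indicator {k} (N s \<omega>) :: real) \<in> borel_measurable (past s k)"
      by (rule measurable_compose[OF measurable_past(2)]) (use st in auto)
    then have "A \<in> measurable (past s k) (borel \<Otimes>\<^sub>M borel)"
      unfolding A_def[abs_def] using K_past[of k] Z_past[of s k] st
      by (intro measurable_Pair borel_measurable_times) auto
    moreover have "I \<in> measurable (future s T k) (borel \<Otimes>\<^sub>M borel)"
      unfolding I_def[abs_def] by (intro measurable_Pair increment_measurable_future) simp
    ultimately have indep: "indep_var (borel \<Otimes>\<^sub>M borel) A (borel \<Otimes>\<^sub>M borel) I"
      by (rule indep_var_past_future[OF st])
    have [measurable]: "F \<in> borel_measurable ((borel \<Otimes>\<^sub>M borel) \<Otimes>\<^sub>M (borel \<Otimes>\<^sub>M borel))"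
      unfolding F_def by measurable
    have law: "(\<integral>\<^sup>+\<omega>'. f (y + increment k s T \<omega>') \<partial>\<Omega>) = g y" for y
    proof -
      have "(\<integral>\<^sup>+\<omega>'. f (y + increment k s T \<omega>') \<partial>\<Omega>) = (\<integral>\<^sup>+u. f (y + u) \<partial>distr \<Omega> borel (increment k s T))"
        using increment_measurable[OF st] by (subst nn_integral_distr) auto
      also have "\<dots> = (\<integral>\<^sup>+\<omega>'. f (y + increment 0 0 (T - s) \<omega>') \<partial>\<Omega>)"
        unfolding distr_increment[OF st] using increment_measurable[of 0 "T - s"] st by (subst nn_integral_distr) auto
      also have "\<dots> = g y"
        unfolding g_def by (rule nn_integral_cong) (use st in \<open>simp add: X_eq_increment\<close>)
      finally show ?thesis .
    qed
    have "(\<integral>\<^sup>+\<omega>. indicator {k} (N s \<omega>) * (ennreal (kill x s \<omega>) * f (x + X T \<omega>)) \<partial>\<Omega>) = (\<integral>\<^sup>+\<omega>. F (A \<omega>, I \<omega>) \<partial>\<Omega>)"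
      by (rule nn_integral_cong) (auto simp: I_def F_def A_def K_eq X_T split: split_indicator)
    also have "\<dots> = (\<integral>\<^sup>+\<omega>. \<integral>\<^sup>+\<omega>'. F (A \<omega>, I \<omega>') \<partial>\<Omega> \<partial>\<Omega>)"
      by (rule nn_integral_indep_var[OF indep]) measurable
    also have "\<dots> = (\<integral>\<^sup>+\<omega>. ennreal (indicator {k} (N s \<omega>) * K k \<omega>) * g (Z k s \<omega>) \<partial>\<Omega>)"
      unfolding F_def A_def I_def fst_conv snd_conv
      using increment_measurable[OF st, of k] by (subst nn_integral_cmult) (auto simp: law)
    also have "\<dots> = (\<integral>\<^sup>+\<omega>. indicator {k} (N s \<omega>) * (ennreal (kill x s \<omega>) * g (x + X s \<omega>)) \<partial>\<Omega>)"
      by (rule nn_integral_cong) (use st in \<open>auto simp: K_eq Z_eq split: split_indicator\<close>)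
    finally show ?thesis .
  qed
  have "(\<integral>\<^sup>+\<omega>. ennreal (kill x s \<omega>) * f (x + X T \<omega>) \<partial>\<Omega>) = (\<integral>\<^sup>+\<omega>. ennreal (kill x s \<omega>) * g (x + X s \<omega>) \<partial>\<Omega>)"
    by (subst (1 2) nn_integral_split_nat[OF N_measurable[OF st(1)]]) (simp_all add: step)
  then show ?thesis by (simp add: g_def add_ac)
qed

end

lemma measurable_indicator_upto [measurable (raw)]:
  assumes [measurable]: "a \<in> borel_measurable M" "b \<in> borel_measurable M"
  shows "(\<lambda>z. indicator {0..a z :: real} (b z) :: real) \<in> borel_measurable M"
    and "(\<lambda>z. indicator {0..a z :: real} (b z) :: ennreal) \<in> borel_measurable M"
proof -
  have "(\<lambda>z. if 0 \<le> b z \<and> b z \<le> a z then 1 else 0 :: real) \<in> borel_measurable M"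
    and "(\<lambda>z. if 0 \<le> b z \<and> b z \<le> a z then 1 else 0 :: ennreal) \<in> borel_measurable M"
    by measurable
  moreover have "(\<lambda>z. indicator {0..a z} (b z) :: real) = (\<lambda>z. if 0 \<le> b z \<and> b z \<le> a z then 1 else 0)"
    and "(\<lambda>z. indicator {0..a z} (b z) :: ennreal) = (\<lambda>z. if 0 \<le> b z \<and> b z \<le> a z then 1 else 0)"
    by (auto split: split_indicator)
  ultimately show "(\<lambda>z. indicator {0..a z :: real} (b z) :: real) \<in> borel_measurable M"
    and "(\<lambda>z. indicator {0..a z :: real} (b z) :: ennreal) \<in> borel_measurable M"
    by simp_all
qed

section \<open>The resolvent measure, the killed occupation measure and the equation between
  them\<close>

context killed_mejd
begin

definition disc :: "real \<Rightarrow> real" where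
  "disc t = indicator {0..} t * exp (- \<alpha> * t)"

lemma disc_measurable [measurable]: "disc \<in> borel_measurable borel"
  unfolding disc_def[abs_def] by measurable

lemma disc_nonneg: "0 \<le> disc t"
  by (simp add: disc_def)

text \<open>By spatial homogeneity a single measure describes the resolvent: \<open>U w x\<close> is
  the integral of \<open>w (x + u)\<close> against it. It is not normalised; its total mass is
  \<open>1 / \<alpha>\<close>.\<close>

definition resolvent :: "real measure" where
  "resolvent = distr (density (lborel \<Otimes>\<^sub>M \<Omega>) (\<lambda>p. ennreal (disc (fst p)))) borel (\<lambda>p. X (fst p) (snd p))"

definition killed :: "real \<Rightarrow> real measure" where
  "killed x = distr (density (lborel \<Otimes>\<^sub>M \<Omega>) (\<lambda>p. ennreal (disc (fst p) * survival x (fst p) (snd p)))) borel (\<lambda>p. x + X (fst p) (snd p))"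

lemma sets_resolvent [simp, measurable_cong]: "sets resolvent = sets borel"
  and sets_killed [simp, measurable_cong]: "sets (killed x) = sets borel"
  by (simp_all add: resolvent_def killed_def)

lemma space_resolvent [simp]: "space resolvent = UNIV" and space_killed [simp]: "space (killed x) = UNIV"
  by (simp_all add: resolvent_def killed_def)

lemma nn_integral_resolvent:
  assumes [measurable]: "f \<in> borel_measurable borel"
  shows "(\<integral>\<^sup>+u. f u \<partial>resolvent) = (\<integral>\<^sup>+t. ennreal (disc t) * (\<integral>\<^sup>+\<omega>. f (X t \<omega>) \<partial>\<Omega>) \<partial>lborel)"
proof -
  have "(\<integral>\<^sup>+u. f u \<partial>resolvent) = (\<integral>\<^sup>+p. ennreal (disc (fst p)) * f (X (fst p) (snd p)) \<partial>(lborel \<Otimes>\<^sub>M \<Omega>))"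
    unfolding resolvent_def by (subst nn_integral_distr) (simp_all add: nn_integral_density)
  also have "\<dots> = (\<integral>\<^sup>+t. \<integral>\<^sup>+\<omega>. ennreal (disc t) * f (X t \<omega>) \<partial>\<Omega> \<partial>lborel)"
    by (subst nn_integral_fst[symmetric]) simp_all
  also have "\<dots> = (\<integral>\<^sup>+t. ennreal (disc t) * (\<integral>\<^sup>+\<omega>. f (X t \<omega>) \<partial>\<Omega>) \<partial>lborel)"
    by (subst nn_integral_cmult) auto
  finally show ?thesis .
qed

lemma nn_integral_killed:
  assumes [measurable]: "f \<in> borel_measurable borel"
  shows "(\<integral>\<^sup>+y. f y \<partial>killed x) = (\<integral>\<^sup>+t. ennreal (disc t) * (\<integral>\<^sup>+\<omega>. ennreal (survival x t \<omega>) * f (x + X t \<omega>) \<partial>\<Omega>) \<partial>lborel)"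
proof -
  have "(\<integral>\<^sup>+y. f y \<partial>killed x) = (\<integral>\<^sup>+p. ennreal (disc (fst p) * survival x (fst p) (snd p)) * f (x + X (fst p) (snd p)) \<partial>(lborel \<Otimes>\<^sub>M \<Omega>))"
    unfolding killed_def by (subst nn_integral_distr) (simp_all add: nn_integral_density)
  also have "\<dots> = (\<integral>\<^sup>+t. \<integral>\<^sup>+\<omega>. ennreal (disc t * survival x t \<omega>) * f (x + X t \<omega>) \<partial>\<Omega> \<partial>lborel)"
    by (subst nn_integral_fst[symmetric]) simp_all
  also have "\<dots> = (\<integral>\<^sup>+t. ennreal (disc t) * (\<integral>\<^sup>+\<omega>. ennreal (survival x t \<omega>) * f (x + X t \<omega>) \<partial>\<Omega>) \<partial>lborel)"
    by (subst nn_integral_cmult[symmetric]) (auto simp: ennreal_mult disc_nonneg survival_pos less_imp_le mult.assoc)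
  finally show ?thesis .
qed

lemma sigma_finite_resolvent: "sigma_finite_measure resolvent"
proof -
  have "emeasure resolvent UNIV = (\<integral>\<^sup>+u. 1 \<partial>resolvent)" by simp
  also have "\<dots> = (\<integral>\<^sup>+t. ennreal (exp (- \<alpha> * t)) * indicator {0..} t \<partial>lborel)"
    by (subst nn_integral_resolvent) (auto simp: emeasure_space_1 disc_def intro!: nn_integral_cong split: split_indicator)
  also have "\<dots> = ennreal (0 - - exp (- \<alpha> * 0) / \<alpha>)"
  proof (rule nn_integral_FTC_atLeast)
    show "((\<lambda>t. - exp (- \<alpha> * t) / \<alpha>) \<longlongrightarrow> 0) at_top"
      using tendsto_mult_left[OF tendsto_exp_neg_mult_at_top[of "- \<alpha>"], of "- 1 / \<alpha>"] alpha_pos by simp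
  qed (use alpha_pos in \<open>auto intro!: derivative_eq_intros\<close>)
  finally have "emeasure resolvent (space resolvent) \<noteq> \<infinity>" by simp
  then have "finite_measure resolvent" by (rule finite_measureI)
  then show ?thesis by (rule finite_measure.axioms(1))
qed

text \<open>Each path is free, and the part of its mass lost up to time \<open>T\<close> is booked
  at the time \<open>s\<close> of loss; from there on the motion restarts freely. With nonnegative
  \<open>f\<close> all exchanges of integrals are instances of Tonelli's theorem, and finiteness is
  extracted from the equation later.\<close>

theorem forward_resolvent_equation:
  fixes f :: "real \<Rightarrow> ennreal"
  assumes f[measurable]: "f \<in> borel_measurable borel"
  shows "(\<integral>\<^sup>+u. f (x + u) \<partial>resolvent) = (\<integral>\<^sup>+y. f y \<partial>killed x) +
    ennreal \<rho> * (\<integral>\<^sup>+y. indicator {h<..<H} y * (\<integral>\<^sup>+u. f (y + u) \<partial>resolvent) \<partial>killed x)"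
proof -
  define g where "g t y = (\<integral>\<^sup>+\<omega>'. f (y + X t \<omega>') \<partial>\<Omega>)" for t y
  have g_meas[measurable (raw)]: "(\<lambda>z. g (a z) (b z)) \<in> borel_measurable M"
    if [measurable]: "a \<in> borel_measurable M" "b \<in> borel_measurable M" for a b and M :: "'z measure"
    unfolding g_def by measurable
  let ?L = "\<lambda>t \<omega>. \<integral>\<^sup>+s. ennreal (indicator {0..t} s * kill x s \<omega>) \<partial>lborel"
  let ?K = "\<lambda>t. \<integral>\<^sup>+\<omega>. ?L t \<omega> * f (x + X t \<omega>) \<partial>\<Omega>"
  let ?S = "\<lambda>t. \<integral>\<^sup>+\<omega>. ennreal (survival x t \<omega>) * f (x + X t \<omega>) \<partial>\<Omega>"
  let ?G = "\<lambda>s t. \<integral>\<^sup>+\<omega>. ennreal (kill x s \<omega>) * g t (x + X s \<omega>) \<partial>\<Omega>"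
  let ?E = "\<lambda>s. \<integral>\<^sup>+\<omega>. ennreal (survival x s \<omega>) * (indicator {h<..<H} (x + X s \<omega>) * (\<integral>\<^sup>+u. f (x + X s \<omega> + u) \<partial>resolvent)) \<partial>\<Omega>"
  have "(\<integral>\<^sup>+u. f (x + u) \<partial>resolvent) = (\<integral>\<^sup>+t. ennreal (disc t) * (\<integral>\<^sup>+\<omega>. f (x + X t \<omega>) \<partial>\<Omega>) \<partial>lborel)"
    by (rule nn_integral_resolvent) measurable
  also have "\<dots> = (\<integral>\<^sup>+t. ennreal (disc t) * ?S t +
      ennreal \<rho> * (ennreal (disc t) * ?K t) \<partial>lborel)"
  proof (rule nn_integral_cong)
    fix t :: real
    show "ennreal (disc t) * (\<integral>\<^sup>+\<omega>. f (x + X t \<omega>) \<partial>\<Omega>) = ennreal (disc t) * ?S t +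
      ennreal \<rho> * (ennreal (disc t) * ?K t)"
    proof (cases "0 \<le> t")
      case True
      have "(\<integral>\<^sup>+\<omega>. f (x + X t \<omega>) \<partial>\<Omega>) = (\<integral>\<^sup>+\<omega>. ennreal (survival x t \<omega>) * f (x + X t \<omega>) +
          ennreal \<rho> * (?L t \<omega> * f (x + X t \<omega>)) \<partial>\<Omega>)"
      proof (rule nn_integral_cong)
        fix \<omega> assume "\<omega> \<in> space \<Omega>"
        then have "f (x + X t \<omega>) = (ennreal (survival x t \<omega>) + ennreal \<rho> * ?L t \<omega>) * f (x + X t \<omega>)"
          using survival_identity[OF _ True, of \<omega> x] by simp
        then show "f (x + X t \<omega>) = ennreal (survival x t \<omega>) * f (x + X t \<omega>) +
          ennreal \<rho> * (?L t \<omega> * f (x + X t \<omega>))"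
          by (simp add: distrib_right mult.assoc)
      qed
      also have "\<dots> = ?S t +
          ennreal \<rho> * ?K t"
        by (simp add: nn_integral_add nn_integral_cmult)
      finally show ?thesis by (simp add: distrib_left mult.left_commute)
    qed (simp add: disc_def)
  qed
  also have "\<dots> = (\<integral>\<^sup>+y. f y \<partial>killed x) + ennreal \<rho> *
      (\<integral>\<^sup>+t. ennreal (disc t) * ?K t \<partial>lborel)"
    by (simp add: nn_integral_add nn_integral_cmult nn_integral_killed)
  also have "(\<integral>\<^sup>+t. ennreal (disc t) * ?K t \<partial>lborel)
    = (\<integral>\<^sup>+y. indicator {h<..<H} y * (\<integral>\<^sup>+u. f (y + u) \<partial>resolvent) \<partial>killed x)"
  proof -
    have "?K t
        = (\<integral>\<^sup>+s. indicator {0..t} s * ?G s (t - s) \<partial>lborel)" for t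
    proof -
      have "?K t
          = (\<integral>\<^sup>+\<omega>. \<integral>\<^sup>+s. ennreal (indicator {0..t} s * kill x s \<omega>) * f (x + X t \<omega>) \<partial>lborel \<partial>\<Omega>)"
        by (intro nn_integral_cong nn_integral_multc[symmetric]) measurable
      also have "\<dots> = (\<integral>\<^sup>+s. \<integral>\<^sup>+\<omega>. ennreal (indicator {0..t} s * kill x s \<omega>) * f (x + X t \<omega>) \<partial>\<Omega> \<partial>lborel)"
      proof -
        interpret pair_sigma_finite lborel \<Omega> ..
        show ?thesis by (rule Fubini') measurable
      qed
      also have "\<dots> = (\<integral>\<^sup>+s. indicator {0..t} s * ?G s (t - s) \<partial>lborel)"
        by (rule nn_integral_cong) (auto simp: g_def markov_property split: split_indicator)
      finally show ?thesis .
    qed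
    then have "(\<integral>\<^sup>+t. ennreal (disc t) * ?K t \<partial>lborel)
      = (\<integral>\<^sup>+t. \<integral>\<^sup>+s. ennreal (disc t) * (indicator {0..t} s * ?G s (t - s)) \<partial>lborel \<partial>lborel)"
      by (intro nn_integral_cong, simp only:) (intro nn_integral_cmult[symmetric]; measurable)
    also have "\<dots> = (\<integral>\<^sup>+s. \<integral>\<^sup>+t. ennreal (disc t) * (indicator {0..t} s * ?G s (t - s)) \<partial>lborel \<partial>lborel)"
      by (rule lborel_pair.Fubini') measurable
    also have "\<dots> = (\<integral>\<^sup>+s. ennreal (disc s) * (\<integral>\<^sup>+\<omega>. ennreal (survival x s \<omega>) *
        (indicator {h<..<H} (x + X s \<omega>) * (\<integral>\<^sup>+u. f (x + X s \<omega> + u) \<partial>resolvent)) \<partial>\<Omega>) \<partial>lborel)"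
    proof (rule nn_integral_cong)
      fix s :: real
      have "(\<integral>\<^sup>+t. ennreal (disc t) * (indicator {0..t} s * ?G s (t - s)) \<partial>lborel)
          = (\<integral>\<^sup>+t. ennreal (disc (s + t)) * (indicator {0..s + t} s * ?G s t) \<partial>lborel)"
        by (subst nn_integral_real_affine[where c=1 and t=s]) (simp_all add: indicator_def)
      also have "\<dots> = (\<integral>\<^sup>+t. ennreal (disc s) * (ennreal (disc t) * ?G s t) \<partial>lborel)"
      proof (rule nn_integral_cong)
        fix t :: real
        \<comment> \<open>After the shift by \<open>s\<close> the discount factor splits into one
          for each leg. The indicator of \<open>0 \<le> s \<le> s + t\<close> is exactly the
          condition that both legs have nonnegative duration.\<close>
        have "disc (s + t) * indicator {0..s + t} s = disc s * disc t"
          by (auto simp: disc_def distrib_left exp_diff exp_minus exp_add divide_inverse split: split_indicator)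
        then have "ennreal (disc (s + t)) * indicator {0..s + t} s = ennreal (disc s) * ennreal (disc t)"
          using disc_nonneg by (auto simp flip: ennreal_mult split: split_indicator_asm)
        then show "ennreal (disc (s + t)) * (indicator {0..s + t} s * ?G s t)
          = ennreal (disc s) * (ennreal (disc t) * ?G s t)"
          by (simp flip: mult.assoc)
      qed
      also have "\<dots> = ennreal (disc s) * (\<integral>\<^sup>+t. \<integral>\<^sup>+\<omega>. ennreal (disc t) * (ennreal (kill x s \<omega>) * g t (x + X s \<omega>)) \<partial>\<Omega> \<partial>lborel)"
        by (simp add: nn_integral_cmult)
      also have "(\<integral>\<^sup>+t. \<integral>\<^sup>+\<omega>. ennreal (disc t) * (ennreal (kill x s \<omega>) * g t (x + X s \<omega>)) \<partial>\<Omega> \<partial>lborel)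
          = (\<integral>\<^sup>+\<omega>. \<integral>\<^sup>+t. ennreal (disc t) * (ennreal (kill x s \<omega>) * g t (x + X s \<omega>)) \<partial>lborel \<partial>\<Omega>)"
      proof -
        interpret pair_sigma_finite \<Omega> lborel ..
        show ?thesis by (rule Fubini') measurable
      qed
      also have "\<dots> = ?E s"
      proof (rule nn_integral_cong)
        fix \<omega> assume "\<omega> \<in> space \<Omega>"
        have "(\<integral>\<^sup>+t. ennreal (disc t) * (ennreal (kill x s \<omega>) * g t (x + X s \<omega>)) \<partial>lborel) =
            ennreal (kill x s \<omega>) * (\<integral>\<^sup>+t. ennreal (disc t) * g t (x + X s \<omega>) \<partial>lborel)"
          by (subst nn_integral_cmult[symmetric]) (auto simp: mult.left_commute)
        also have "(\<integral>\<^sup>+t. ennreal (disc t) * g t (x + X s \<omega>) \<partial>lborel) = (\<integral>\<^sup>+u. f (x + X s \<omega> + u) \<partial>resolvent)"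
          unfolding g_def by (rule nn_integral_resolvent[symmetric]) measurable
        finally show "(\<integral>\<^sup>+t. ennreal (disc t) * (ennreal (kill x s \<omega>) * g t (x + X s \<omega>)) \<partial>lborel) =
          ennreal (survival x s \<omega>) * (indicator {h<..<H} (x + X s \<omega>) * (\<integral>\<^sup>+u. f (x + X s \<omega> + u) \<partial>resolvent))"
          by (auto simp: kill_def split: split_indicator)
      qed
      finally show "(\<integral>\<^sup>+t. ennreal (disc t) * (indicator {0..t} s * ?G s (t - s)) \<partial>lborel)
        = ennreal (disc s) * ?E s" .
    qed
    also have "\<dots> = (\<integral>\<^sup>+y. indicator {h<..<H} y * (\<integral>\<^sup>+u. f (y + u) \<partial>resolvent) \<partial>killed x)"
    proof -
      interpret sigma_finite_measure resolvent by (rule sigma_finite_resolvent)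
      show ?thesis by (rule nn_integral_killed[symmetric]) measurable
    qed
    finally show ?thesis .
  qed
  finally show ?thesis .
qed

end

lemma (in prob_space) indep_set_commute: "indep_set A B \<Longrightarrow> indep_set B A"
  unfolding indep_sets2_eq by (metis Int_commute mult.commute)

section \<open>Transform of the resolvent and absence of atoms\<close>

context killed_mejd
begin

lemma exp_X_expectation:
  assumes "complex_of_real c \<in> strip P" "0 \<le> t"
  shows "has_bochner_integral \<Omega> (\<lambda>\<omega>. exp (c * X t \<omega>)) (exp (t * levy_exponent P c))"
proof -
  have "has_bochner_integral \<Omega> (\<lambda>\<omega>. Re (exp (of_real c * of_real (increment 0 0 t \<omega>)))) (Re (exp (of_real (t - 0) * complex_exponent P (of_real c))))"
    using assms by (intro has_bochner_integral_bounded_linear[OF bounded_linear_Re] increment_transform) auto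
  then have "has_bochner_integral \<Omega> (\<lambda>\<omega>. exp (c * increment 0 0 t \<omega>)) (exp (t * levy_exponent P c))"
    unfolding complex_exponent_of_real by (simp add: Re_exp)
  then show ?thesis
    by (rule has_bochner_integral_cong[THEN iffD1, rotated -1]) (use assms in \<open>auto simp: X_eq_increment\<close>)
qed

text \<open>The expectation of \<open>exp (c * X t)\<close> grows like
  \<open>exp (t * levy_exponent P c)\<close>, so \<open>levy_exponent P c < \<alpha>\<close> is
  precisely what lets the discount win.\<close>

lemma nn_integral_exp_resolvent:
  assumes c: "complex_of_real c \<in> strip P" "levy_exponent P c < \<alpha>"
  shows "(\<integral>\<^sup>+u. ennreal (exp (c * u)) \<partial>resolvent) = ennreal (1 / (\<alpha> - levy_exponent P c))"
proof -
  define a where "a = levy_exponent P c - \<alpha>"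
  have "(\<integral>\<^sup>+u. ennreal (exp (c * u)) \<partial>resolvent) = (\<integral>\<^sup>+t. ennreal (disc t) * (\<integral>\<^sup>+\<omega>. ennreal (exp (c * X t \<omega>)) \<partial>\<Omega>) \<partial>lborel)"
    by (rule nn_integral_resolvent) measurable
  also have "\<dots> = (\<integral>\<^sup>+t. ennreal (exp (a * t)) * indicator {0..} t \<partial>lborel)"
  proof (rule nn_integral_cong)
    fix t :: real
    show "ennreal (disc t) * (\<integral>\<^sup>+\<omega>. ennreal (exp (c * X t \<omega>)) \<partial>\<Omega>) = ennreal (exp (a * t)) * indicator {0..} t"
    proof (cases "0 \<le> t")
      case True
      have "(\<integral>\<^sup>+\<omega>. ennreal (exp (c * X t \<omega>)) \<partial>\<Omega>) = ennreal (exp (t * levy_exponent P c))"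
        using exp_X_expectation[OF c(1) True] by (subst nn_integral_eq_integral) (auto simp: has_bochner_integral_iff)
      then have "ennreal (disc t) * (\<integral>\<^sup>+\<omega>. ennreal (exp (c * X t \<omega>)) \<partial>\<Omega>) = ennreal (disc t * exp (t * levy_exponent P c))"
        by (simp add: ennreal_mult disc_nonneg)
      also have "disc t * exp (t * levy_exponent P c) = exp (a * t)"
        using True by (simp add: disc_def a_def algebra_simps flip: exp_add)
      finally show ?thesis using True by simp
    qed (simp add: disc_def)
  qed
  also have "\<dots> = ennreal (0 - exp (a * 0) / a)"
  proof (rule nn_integral_FTC_atLeast)
    show "((\<lambda>t. exp (a * t) / a) \<longlongrightarrow> 0) at_top"
      by (rule tendsto_divide_zero) (rule tendsto_exp_neg_mult_at_top, use c in \<open>simp add: a_def\<close>)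
  qed (use c in \<open>auto simp: a_def intro!: derivative_eq_intros\<close>)
  also have "0 - exp (a * 0) / a = 1 / (\<alpha> - levy_exponent P c)"
    using c by (simp add: a_def divide_simps)
  finally show ?thesis .
qed

lemma levy_exponent_0: "levy_exponent P 0 = 0"
proof -
  have "(\<Sum>i=1..num_up P. weight_up P i * eta P i / eta P i) = (\<Sum>i=1..num_up P. weight_up P i)"
    "(\<Sum>j=1..num_down P. weight_down P j * theta P j / theta P j) = (\<Sum>j=1..num_down P. weight_down P j)"
    using eta_ge(2)[OF params] theta_ge(2)[OF params] by (auto intro!: sum.cong simp: less_imp_neq[symmetric])
  then show ?thesis using params by (simp add: levy_exponent_def mejd_parameters_def)
qed

lemma finite_measure_resolvent: "finite_measure resolvent"
  using nn_integral_exp_resolvent[of 0] imaginary_in_strip[of 0] levy_exponent_0 alpha_pos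
  by (intro finite_measureI) simp

lemma integrable_exp_resolvent:
  assumes "complex_of_real (Re z) \<in> strip P" "levy_exponent P (Re z) < \<alpha>"
  shows "integrable resolvent (\<lambda>u. exp (z * of_real u))"
proof (rule integrableI_bounded)
  have "(\<integral>\<^sup>+u. ennreal (norm (exp (z * of_real u))) \<partial>resolvent) = ennreal (1 / (\<alpha> - levy_exponent P (Re z)))"
    using nn_integral_exp_resolvent[OF assms] by (simp add: norm_exp_eq_Re)
  then show "(\<integral>\<^sup>+u. ennreal (norm (exp (z * of_real u))) \<partial>resolvent) < \<infinity>" by simp
qed simp

text \<open>At time 1 the modulus of an expectation is at most the expectation of the modulus. On
  the imaginary axis the bound is 0, which keeps \<open>\<alpha> - complex_exponent P s\<close> away
  from 0.\<close>

lemma complex_exponent_Re_le: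
  assumes "z \<in> strip P"
  shows "Re (complex_exponent P z) \<le> levy_exponent P (Re z)"
proof -
  have z: "has_bochner_integral \<Omega> (\<lambda>\<omega>. exp (z * of_real (increment 0 0 1 \<omega>))) (exp (complex_exponent P z))"
    using increment_transform[of 0 1 z 0] assms by simp
  have "exp (Re (complex_exponent P z)) = norm (\<integral>\<omega>. exp (z * of_real (increment 0 0 1 \<omega>)) \<partial>\<Omega>)"
    using z by (simp add: has_bochner_integral_iff norm_exp_eq_Re)
  also have "\<dots> \<le> (\<integral>\<omega>. norm (exp (z * of_real (increment 0 0 1 \<omega>))) \<partial>\<Omega>)"
    by (rule integral_norm_bound)
  also have "\<dots> = (\<integral>\<omega>. exp (Re z * X 1 \<omega>) \<partial>\<Omega>)"
    by (rule Bochner_Integration.integral_cong) (auto simp: norm_exp_eq_Re X_eq_increment)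
  also have "\<dots> = exp (levy_exponent P (Re z))"
    using exp_X_expectation[OF strip_real[OF assms], of 1] by (simp add: has_bochner_integral_iff)
  finally show ?thesis by simp
qed

lemma resolvent_transform:
  assumes z: "z \<in> strip P" "levy_exponent P (Re z) < \<alpha>"
  shows "(\<integral>u. exp (z * of_real u) \<partial>resolvent) = 1 / (of_real \<alpha> - complex_exponent P z)"
proof -
  define a where "a = complex_exponent P z - of_real \<alpha>"
  have a: "Re a < 0" using complex_exponent_Re_le[OF z(1)] z(2) by (simp add: a_def)
  have int: "integrable (lborel \<Otimes>\<^sub>M \<Omega>) (\<lambda>p. disc (fst p) *\<^sub>R exp (z * of_real (X (fst p) (snd p))))"
    using integrable_exp_resolvent[OF strip_real[OF z(1)] z(2)] disc_nonneg unfolding resolvent_def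
    by (subst (asm) integrable_distr_eq) (auto simp: integrable_density)
  interpret pair_sigma_finite lborel \<Omega> ..
  have "(\<integral>u. exp (z * of_real u) \<partial>resolvent) = (\<integral>p. disc (fst p) *\<^sub>R exp (z * of_real (X (fst p) (snd p))) \<partial>(lborel \<Otimes>\<^sub>M \<Omega>))"
    unfolding resolvent_def using disc_nonneg by (subst integral_distr) (auto simp: integral_density)
  also have "\<dots> = (\<integral>t. \<integral>\<omega>. disc t *\<^sub>R exp (z * of_real (X t \<omega>)) \<partial>\<Omega> \<partial>lborel)"
    using integral_fst'[OF int] by simp
  also have "\<dots> = (\<integral>t. indicator {0..} t *\<^sub>R exp (a * of_real t) \<partial>lborel)"
  proof (rule Bochner_Integration.integral_cong[OF refl])
    fix t :: real
    show "(\<integral>\<omega>. disc t *\<^sub>R exp (z * of_real (X t \<omega>)) \<partial>\<Omega>) = indicator {0..} t *\<^sub>R exp (a * of_real t)"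
    proof (cases "0 \<le> t")
      case True
      have "(\<integral>\<omega>. exp (z * of_real (X t \<omega>)) \<partial>\<Omega>) = (\<integral>\<omega>. exp (z * of_real (increment 0 0 t \<omega>)) \<partial>\<Omega>)"
        by (rule Bochner_Integration.integral_cong) (use True in \<open>auto simp: X_eq_increment\<close>)
      also have "\<dots> = exp (of_real t * complex_exponent P z)"
        using increment_transform[of 0 t z 0] True z by (simp add: has_bochner_integral_iff)
      finally have "(\<integral>\<omega>. disc t *\<^sub>R exp (z * of_real (X t \<omega>)) \<partial>\<Omega>) = of_real (disc t) * exp (of_real t * complex_exponent P z)"
        by (simp add: scaleR_conv_of_real)
      also have "\<dots> = exp (a * of_real t)"
        using True by (simp add: disc_def a_def algebra_simps exp_of_real[symmetric] flip: exp_add)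
      finally show ?thesis using True by simp
    qed (simp add: disc_def)
  qed
  also have "\<dots> = (\<integral>t. indicator {0<..} t *\<^sub>R exp (a * of_real t) \<partial>lborel)"
    by (rule integral_discrete_difference[where X="{0}"]) (auto split: split_indicator)
  also have "\<dots> = - exp (a * of_real 0) / a"
    using has_bochner_integral_cexp_Ioi[OF a, of 0] unfolding has_bochner_integral_iff by blast
  also have "\<dots> = 1 / (of_real \<alpha> - complex_exponent P z)"
    by (simp add: a_def) (metis minus_diff_eq minus_divide_right)
  finally show ?thesis .
qed

text \<open>Given the jump sum, which is independent of the Brownian part, \<open>X t\<close> is a
  nonconstant affine image of a normal variable and hits a given point with probability 0.\<close>

lemma prob_X_eq_0:
  assumes vol: "0 < volatility P" and "0 < t"
  shows "(\<integral>\<^sup>+\<omega>. indicator {c} (X t \<omega>) \<partial>\<Omega>) = 0"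
proof -
  define S where "S \<omega> = (\<Sum>i=1..N t \<omega>. Y i \<omega>)" for \<omega>
  define V where "V \<omega> = W t \<omega> - W 0 \<omega>" for \<omega>
  define F where "F p = (indicator {c} (drift P * t + volatility P * snd p + fst p) :: ennreal)" for p :: "real \<times> real"
  have indep: "indep_var borel S borel V"
  proof (rule indep_var_of_indep_set)
    have "sets (sigma (space \<Omega>) (gen_N \<union> gen_Y)) = sigma_sets (space \<Omega>) (gen_N \<union> gen_Y)"
      by (rule sets_measure_of) (auto dest: gen_subset_Pow)
    then show "indep_set (sets (sigma (space \<Omega>) (gen_N \<union> gen_Y))) (sets (sigma (space \<Omega>) gen_W))"
      using indep_set_commute[OF indep_W_NY] by (simp only: sets_sigma_generated_events)
    show "V \<in> borel_measurable (sigma (space \<Omega>) gen_W)"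
      unfolding V_def[abs_def] using assms by (intro borel_measurable_diff measurable_sigma_gen_W) auto
    have "N t \<in> measurable (sigma (space \<Omega>) (gen_N \<union> gen_Y)) (count_space UNIV)"
      using assms by (intro measurable_sigma_gen_NY(1)) auto
    then show "S \<in> borel_measurable (sigma (space \<Omega>) (gen_N \<union> gen_Y))"
      unfolding S_def[abs_def]
      by (rule measurable_compose_countable[where f="\<lambda>n \<omega>. \<Sum>i=1..n. Y i \<omega>", rotated])
         (auto simp del: One_nat_def intro!: borel_measurable_sum measurable_sigma_gen_NY(2))
  qed (auto simp: space_measure_of_conv)
  have null: "(\<integral>\<^sup>+\<omega>. F (a, V \<omega>) \<partial>\<Omega>) = 0" for a
  proof -
    have W: "distributed \<Omega> lborel V (normal_density 0 (sqrt t))"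
      unfolding V_def[abs_def] using W_distributed[of 0 t] \<open>0 < t\<close> by simp
    have "(\<integral>\<^sup>+\<omega>. F (a, V \<omega>) \<partial>\<Omega>) = (\<integral>\<^sup>+b. F (a, b) \<partial>distr \<Omega> lborel V)"
      using distributed_measurable[OF W] by (subst nn_integral_distr) (auto simp: F_def)
    also have "\<dots> = (\<integral>\<^sup>+b. ennreal (normal_density 0 (sqrt t) b) * F (a, b) \<partial>lborel)"
      unfolding distributed_distr_eq_density[OF W] by (rule nn_integral_density) (auto simp: F_def)
    also have "\<dots> = 0"
    proof (subst nn_integral_0_iff_AE)
      have "AE b in lborel. b \<noteq> (c - a - drift P * t) / volatility P" by (rule AE_lborel_singleton)
      then show "AE b in lborel. ennreal (normal_density 0 (sqrt t) b) * F (a, b) = 0"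
        by eventually_elim (use vol in \<open>auto simp: F_def field_simps split: split_indicator\<close>)
    qed (simp add: F_def)
    finally show ?thesis .
  qed
  have "(\<integral>\<^sup>+\<omega>. indicator {c} (X t \<omega>) \<partial>\<Omega>) = (\<integral>\<^sup>+\<omega>. F (S \<omega>, V \<omega>) \<partial>\<Omega>)"
    using \<open>0 < t\<close> by (intro nn_integral_cong) (auto simp: F_def S_def V_def X_def mejd_process_def W_0)
  also have "\<dots> = (\<integral>\<^sup>+\<omega>. \<integral>\<^sup>+\<omega>'. F (S \<omega>, V \<omega>') \<partial>\<Omega> \<partial>\<Omega>)"
    by (rule nn_integral_indep_var[OF indep]) (auto simp: F_def)
  finally show ?thesis by (simp add: null)
qed

lemma AE_resolvent_neq:
  assumes "0 < volatility P"
  shows "AE u in resolvent. u \<noteq> c"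
proof -
  have "emeasure resolvent {c} = (\<integral>\<^sup>+u. indicator {c} u \<partial>resolvent)" by simp
  also have "\<dots> = (\<integral>\<^sup>+t. ennreal (disc t) * (\<integral>\<^sup>+\<omega>. indicator {c} (X t \<omega>) \<partial>\<Omega>) \<partial>lborel)"
    by (rule nn_integral_resolvent) simp
  also have "\<dots> = 0"
  proof (subst nn_integral_0_iff_AE)
    have "AE t in lborel. t \<noteq> (0::real)" by (rule AE_lborel_singleton)
    then show "AE t in lborel. ennreal (disc t) * (\<integral>\<^sup>+\<omega>. indicator {c} (X t \<omega>) \<partial>\<Omega>) = 0"
    proof eventually_elim
      case (elim t)
      then show ?case using prob_X_eq_0[OF assms, of t c] by (cases "0 < t") (auto simp: disc_def)
    qed
  qed measurable
  finally show ?thesis by (intro AE_I[where N="{c}"]) auto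
qed

text \<open>Without atoms the resolvent does not charge the finitely many \<open>u\<close> for which
  \<open>x + u\<close> is a discontinuity of \<open>w\<close>, so dominated convergence applies.
  This is what later upgrades an identity almost everywhere to one at every point.\<close>

lemma isCont_resolvent:
  fixes w :: "real \<Rightarrow> real"
  assumes vol: "0 < volatility P" and w[measurable]: "w \<in> borel_measurable borel" and bound: "\<And>y. \<bar>w y\<bar> \<le> B"
    and "finite F" and cont: "\<And>y. y \<notin> F \<Longrightarrow> isCont w y"
  shows "isCont (\<lambda>x. \<integral>u. w (x + u) \<partial>resolvent) x"
proof (rule continuous_at_sequentiallyI)
  fix xs assume xs: "xs \<longlonglongrightarrow> x"
  interpret finite_measure resolvent by (rule finite_measure_resolvent)
  show "(\<lambda>n. \<integral>u. w (xs n + u) \<partial>resolvent) \<longlonglongrightarrow> (\<integral>u. w (x + u) \<partial>resolvent)"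
  proof (rule integral_dominated_convergence[where w="\<lambda>_. B"])
    have "AE u in resolvent. \<forall>c\<in>F. u \<noteq> c - x"
      using \<open>finite F\<close> by (intro AE_finite_allI AE_resolvent_neq vol)
    then show "AE u in resolvent. (\<lambda>n. w (xs n + u)) \<longlonglongrightarrow> w (x + u)"
    proof eventually_elim
      case (elim u)
      then have "isCont w (x + u)" by (intro cont) force
      then show ?case by (rule isCont_tendsto_compose) (intro tendsto_intros xs)
    qed
  qed (use bound in auto)
qed

end

section \<open>The resolvent equation for signed functions, the Fourier multiplier and the
  discounted payoff\<close>

context killed_mejd
begin

text \<open>The exponential bound makes the free resolvent finite, and the equation then bounds both
  terms on its right-hand side; integrability against the killed measure needs no separate estimate.
  Positivity of \<open>\<rho>\<close> transfers finiteness from the product to the second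
  integral.\<close>

lemma resolvent_equation_nonneg:
  fixes f :: "real \<Rightarrow> real"
  assumes c: "complex_of_real c \<in> strip P" "levy_exponent P c < \<alpha>"
    and f[measurable]: "f \<in> borel_measurable borel" and bound: "\<And>y. 0 \<le> f y" "\<And>y. f y \<le> C * exp (c * y)"
  defines "U \<equiv> \<lambda>y. \<integral>u. f (y + u) \<partial>resolvent"
  shows "\<And>y. integrable resolvent (\<lambda>u. f (y + u))" "integrable (killed x) f"
    "integrable (killed x) (\<lambda>y. indicator {h<..<H} y * U y)"
    "(\<integral>y. f y \<partial>killed x) + \<rho> * (\<integral>y. indicator {h<..<H} y * U y \<partial>killed x) = U x"
proof -
  interpret R: finite_measure resolvent by (rule finite_measure_resolvent)
  have exp_int: "integrable resolvent (\<lambda>u. exp (c * u))"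
    by (rule integrableI_nn_integral_finite[OF _ _ nn_integral_exp_resolvent[OF c]]) (use c in auto)
  show int: "integrable resolvent (\<lambda>u. f (y + u))" for y
  proof (rule Bochner_Integration.integrable_bound)
    show "integrable resolvent (\<lambda>u. C * exp (c * y) * exp (c * u))"
      by (intro integrable_mult_right exp_int)
    show "AE u in resolvent. norm (f (y + u)) \<le> norm (C * exp (c * y) * exp (c * u))"
    proof (rule AE_I2)
      fix u
      have "C * exp (c * (y + u)) = C * exp (c * y) * exp (c * u)" by (simp add: distrib_left exp_add)
      then show "norm (f (y + u)) \<le> norm (C * exp (c * y) * exp (c * u))"
        using bound(1)[of "y + u"] bound(2)[of "y + u"] unfolding real_norm_def by linarith
    qed
  qed simp
  have [measurable]: "U \<in> borel_measurable borel" unfolding U_def by measurable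
  have U: "(\<integral>\<^sup>+u. ennreal (f (y + u)) \<partial>resolvent) = ennreal (U y)" for y
    unfolding U_def by (rule nn_integral_eq_integral[OF int]) (use bound in auto)
  have U_nonneg: "0 \<le> U y" for y unfolding U_def by (rule integral_nonneg_AE) (use bound in auto)
  have eq: "ennreal (U x) = (\<integral>\<^sup>+y. ennreal (f y) \<partial>killed x) +
      ennreal \<rho> * (\<integral>\<^sup>+y. ennreal (indicator {h<..<H} y * U y) \<partial>killed x)"
    using forward_resolvent_equation[of "\<lambda>y. ennreal (f y)" x] unfolding U
    by (simp add: ennreal_mult' ennreal_indicator)
  then have fin: "(\<integral>\<^sup>+y. ennreal (f y) \<partial>killed x) < \<infinity>" "(\<integral>\<^sup>+y. ennreal (indicator {h<..<H} y * U y) \<partial>killed x) < \<infinity>"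
  proof -
    have *: "(\<integral>\<^sup>+y. ennreal (f y) \<partial>killed x) + ennreal \<rho> * (\<integral>\<^sup>+y. ennreal (indicator {h<..<H} y * U y) \<partial>killed x) < \<infinity>"
      unfolding eq[symmetric] by simp
    then show "(\<integral>\<^sup>+y. ennreal (f y) \<partial>killed x) < \<infinity>" by (auto simp: ennreal_add_eq_top top.not_eq_extremum[symmetric])
    show "(\<integral>\<^sup>+y. ennreal (indicator {h<..<H} y * U y) \<partial>killed x) < \<infinity>"
      using * rho_pos by (auto simp: ennreal_add_eq_top ennreal_mult_eq_top_iff top.not_eq_extremum[symmetric])
  qed
  show int_f: "integrable (killed x) f"
    by (rule integrableI_nonneg) (use bound fin in auto)
  show int_U: "integrable (killed x) (\<lambda>y. indicator {h<..<H} y * U y)"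
    by (rule integrableI_nonneg) (use U_nonneg fin in auto)
  have nn: "0 \<le> (\<integral>y. f y \<partial>killed x)" "0 \<le> (\<integral>y. indicator {h<..<H} y * U y \<partial>killed x)"
    using bound U_nonneg by (auto intro!: integral_nonneg_AE)
  have "ennreal (U x) = ennreal (\<integral>y. f y \<partial>killed x) + ennreal \<rho> * ennreal (\<integral>y. indicator {h<..<H} y * U y \<partial>killed x)"
    unfolding eq using bound U_nonneg
    by (subst nn_integral_eq_integral[OF int_f], simp, subst nn_integral_eq_integral[OF int_U], simp_all)
  also have "\<dots> = ennreal ((\<integral>y. f y \<partial>killed x) + \<rho> * (\<integral>y. indicator {h<..<H} y * U y \<partial>killed x))"
    using nn rho_pos by (simp add: ennreal_mult ennreal_plus)
  finally show "(\<integral>y. f y \<partial>killed x) + \<rho> * (\<integral>y. indicator {h<..<H} y * U y \<partial>killed x) = U x"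
    using nn rho_pos U_nonneg[of x] by (subst (asm) ennreal_inj) auto
qed

lemma resolvent_equation:
  fixes w :: "real \<Rightarrow> real"
  assumes c: "complex_of_real c \<in> strip P" "levy_exponent P c < \<alpha>"
    and w[measurable]: "w \<in> borel_measurable borel" and bound: "\<And>y. \<bar>w y\<bar> \<le> C * exp (c * y)"
  defines "U \<equiv> \<lambda>y. \<integral>u. w (y + u) \<partial>resolvent"
  shows "\<And>y. integrable resolvent (\<lambda>u. w (y + u))"
    "(\<integral>y. w y + \<rho> * (indicator {h<..<H} y * U y) \<partial>killed x) = U x"
proof -
  define p q where "p y = max (w y) 0" and "q y = max (- w y) 0" for y
  have [measurable]: "p \<in> borel_measurable borel" "q \<in> borel_measurable borel"
    unfolding p_def[abs_def] q_def[abs_def] by measurable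
  have w_eq: "w y = p y - q y" for y by (auto simp: p_def q_def)
  have pb: "0 \<le> p y" "p y \<le> C * exp (c * y)" and qb: "0 \<le> q y" "q y \<le> C * exp (c * y)" for y
    using bound[of y] by (auto simp: p_def q_def)
  note p = resolvent_equation_nonneg[OF c _ pb] and q = resolvent_equation_nonneg[OF c _ qb]
  show "integrable resolvent (\<lambda>u. w (y + u))" for y
    unfolding w_eq using p(1) q(1) by simp
  have U: "U y = (\<integral>u. p (y + u) \<partial>resolvent) - (\<integral>u. q (y + u) \<partial>resolvent)" for y
    unfolding U_def w_eq using p(1) q(1) by simp
  have "(\<integral>y. w y + \<rho> * (indicator {h<..<H} y * U y) \<partial>killed x) =
    (\<integral>y. (p y + \<rho> * (indicator {h<..<H} y * (\<integral>u. p (y + u) \<partial>resolvent))) -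
      (q y + \<rho> * (indicator {h<..<H} y * (\<integral>u. q (y + u) \<partial>resolvent))) \<partial>killed x)"
    by (rule Bochner_Integration.integral_cong) (auto simp: w_eq U algebra_simps)
  also have "\<dots> = (\<integral>y. p y + \<rho> * (indicator {h<..<H} y * (\<integral>u. p (y + u) \<partial>resolvent)) \<partial>killed x) -
      (\<integral>y. q y + \<rho> * (indicator {h<..<H} y * (\<integral>u. q (y + u) \<partial>resolvent)) \<partial>killed x)"
    using p(2,3) q(2,3)
    by (intro Bochner_Integration.integral_diff Bochner_Integration.integrable_add integrable_mult_right) auto
  also have "\<dots> = U x"
    using p(2-4) q(2-4) by (simp add: U integrable_mult_right)
  finally show "(\<integral>y. w y + \<rho> * (indicator {h<..<H} y * U y) \<partial>killed x) = U x" .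
qed

text \<open>The resolvent integrates \<open>w (x + u)\<close>, a correlation and not a convolution,
  so translating by \<open>u\<close> produces \<open>iexp (- \<xi> * u)\<close> and the multiplier
  is evaluated at \<open>- \<i> * \<xi>\<close>.\<close>

lemma fourier_resolvent:
  fixes w :: "real \<Rightarrow> real"
  assumes w: "integrable lborel w"
  shows "integrable lborel (\<lambda>x. \<integral>u. w (x + u) \<partial>resolvent)"
    "(CLBINT x. iexp (\<xi> * x) * of_real (\<integral>u. w (x + u) \<partial>resolvent)) =
      1 / (of_real \<alpha> - complex_exponent P (- \<i> * of_real \<xi>)) * (CLBINT x. iexp (\<xi> * x) * of_real (w x))"
proof -
  interpret R: finite_measure resolvent by (rule finite_measure_resolvent)
  interpret pair_sigma_finite resolvent lborel ..
  have [measurable]: "w \<in> borel_measurable borel" using borel_measurable_integrable[OF w] by simp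
  have shift: "integrable lborel (\<lambda>x. w (x + u))" for u
    using lborel_integrable_real_affine[OF w, of 1 u] by (simp add: add.commute)
  have norm_shift: "(\<integral>x. \<bar>w (x + u)\<bar> \<partial>lborel) = (\<integral>x. \<bar>w x\<bar> \<partial>lborel)" for u
    by (subst (2) lborel_integral_real_affine[where c=1 and t=u]) (simp_all add: add.commute)
  have prod: "integrable (resolvent \<Otimes>\<^sub>M lborel) (\<lambda>(u, x). w (x + u))"
    by (rule Fubini_integrable) (use shift in \<open>auto simp: norm_shift\<close>)
  show "integrable lborel (\<lambda>x. \<integral>u. w (x + u) \<partial>resolvent)"
    using integrable_snd[OF prod] by simp
  have prod': "integrable (resolvent \<Otimes>\<^sub>M lborel) (\<lambda>(u, x). iexp (\<xi> * x) * complex_of_real (w (x + u)))"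
    by (rule Bochner_Integration.integrable_bound[OF prod]) (auto simp: norm_mult)
  have "(CLBINT x. iexp (\<xi> * x) * of_real (\<integral>u. w (x + u) \<partial>resolvent)) = (CLBINT x. \<integral>u. iexp (\<xi> * x) * of_real (w (x + u)) \<partial>resolvent)"
    by (simp flip: integral_complex_of_real)
  also have "\<dots> = (\<integral>u. (CLBINT x. iexp (\<xi> * x) * of_real (w (x + u))) \<partial>resolvent)"
    by (rule Fubini_integral) (use prod' in simp)
  also have "\<dots> = (\<integral>u. exp ((- \<i> * of_real \<xi>) * of_real u) * (CLBINT x. iexp (\<xi> * x) * of_real (w x)) \<partial>resolvent)"
  proof (rule Bochner_Integration.integral_cong[OF refl])
    fix u
    have "(CLBINT x. iexp (\<xi> * x) * of_real (w x)) = (CLBINT x. iexp (\<xi> * (x + u)) * of_real (w (x + u)))"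
      by (subst lborel_integral_real_affine[where c=1 and t=u]) (simp_all add: add.commute)
    also have "\<dots> = (CLBINT x. iexp (\<xi> * u) * (iexp (\<xi> * x) * of_real (w (x + u))))"
      by (rule Bochner_Integration.integral_cong) (simp_all add: algebra_simps exp_add)
    also have "\<dots> = iexp (\<xi> * u) * (CLBINT x. iexp (\<xi> * x) * of_real (w (x + u)))"
      by (rule integral_mult_right_zero)
    finally show "(CLBINT x. iexp (\<xi> * x) * of_real (w (x + u))) = exp ((- \<i> * of_real \<xi>) * of_real u) * (CLBINT x. iexp (\<xi> * x) * of_real (w x))"
      by (simp add: exp_minus mult.assoc)
  qed
  also have "\<dots> = (\<integral>u. exp ((- \<i> * of_real \<xi>) * of_real u) \<partial>resolvent) * (CLBINT x. iexp (\<xi> * x) * of_real (w x))"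
    by (rule integral_mult_left_zero)
  also have "(\<integral>u. exp ((- \<i> * of_real \<xi>) * of_real u) \<partial>resolvent) = 1 / (of_real \<alpha> - complex_exponent P (- \<i> * of_real \<xi>))"
    using imaginary_in_strip levy_exponent_0 alpha_pos by (intro resolvent_transform) auto
  finally show "(CLBINT x. iexp (\<xi> * x) * of_real (\<integral>u. w (x + u) \<partial>resolvent)) =
      1 / (of_real \<alpha> - complex_exponent P (- \<i> * of_real \<xi>)) * (CLBINT x. iexp (\<xi> * x) * of_real (w x))" .
qed

lemma payoff_eq:
  assumes "0 \<le> T"
  shows "discounted_payoff h H \<rho> c (mejd_process P W N Y x) T = (\<lambda>\<omega>. survival x T \<omega> * exp (c * (x + X T \<omega>)))"
proof
  fix \<omega>
  have "(LBINT t:{0..T}. indicator {h<..<H} (mejd_process P W N Y x t \<omega>)) = occupation x T \<omega>"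
    unfolding occupation_def set_lebesgue_integral_def
    by (rule Bochner_Integration.integral_cong) (auto simp: mejd_process_eq split: split_indicator)
  then show "discounted_payoff h H \<rho> c (mejd_process P W N Y x) T \<omega> = survival x T \<omega> * exp (c * (x + X T \<omega>))"
    using assms unfolding discounted_payoff_def survival_def exp_add by (simp add: mejd_process_eq)
qed

lemma integrable_payoff:
  assumes "complex_of_real c \<in> strip P" "0 \<le> T"
  shows "integrable \<Omega> (discounted_payoff h H \<rho> c (mejd_process P W N Y x) T)"
proof -
  have "integrable \<Omega> (\<lambda>\<omega>. survival x T \<omega> * exp (c * (x + X T \<omega>)))"
  proof (rule Bochner_Integration.integrable_bound)
    show "integrable \<Omega> (\<lambda>\<omega>. exp (c * x) * exp (c * X T \<omega>))"
      using exp_X_expectation[OF assms] by (simp add: has_bochner_integral_iff)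
    show "AE \<omega> in \<Omega>. norm (survival x T \<omega> * exp (c * (x + X T \<omega>))) \<le> norm (exp (c * x) * exp (c * X T \<omega>))"
    proof (rule AE_I2)
      fix \<omega>
      have "survival x T \<omega> * exp (c * (x + X T \<omega>)) \<le> 1 * exp (c * (x + X T \<omega>))"
        by (intro mult_right_mono survival_le_1) simp
      then show "norm (survival x T \<omega> * exp (c * (x + X T \<omega>))) \<le> norm (exp (c * x) * exp (c * X T \<omega>))"
        using survival_pos[of x T \<omega>] by (simp add: distrib_left exp_add)
    qed
  qed measurable
  then show ?thesis unfolding payoff_eq[OF assms(2)] .
qed

lemma discounted_expectation:
  fixes c x :: real
  assumes c: "complex_of_real c \<in> strip P" "levy_exponent P c < \<alpha>"
  defines "E \<equiv> \<lambda>T. expectation (discounted_payoff h H \<rho> c (mejd_process P W N Y x) T)"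
  shows "set_integrable lborel {0..} (\<lambda>T. \<alpha> * exp (- \<alpha> * T) * E T)"
    "(LBINT T:{0..}. \<alpha> * exp (- \<alpha> * T) * E T) = (\<integral>y. \<alpha> * exp (c * y) \<partial>killed x)"
proof -
  interpret pair_sigma_finite lborel \<Omega> ..
  have "integrable (killed x) (\<lambda>y. exp (c * y))"
    by (rule resolvent_equation_nonneg(2)[OF c, where C=1]) auto
  then have int: "integrable (lborel \<Otimes>\<^sub>M \<Omega>) (\<lambda>p. (disc (fst p) * survival x (fst p) (snd p)) * exp (c * (x + X (fst p) (snd p))))"
    unfolding killed_def using disc_nonneg survival_pos
    by (subst (asm) integrable_distr_eq) (auto simp: integrable_density less_imp_le)
  have eq: "indicator {0..} T *\<^sub>R (\<alpha> * exp (- \<alpha> * T) * E T) = \<alpha> * (\<integral>\<omega>. (disc T * survival x T \<omega>) * exp (c * (x + X T \<omega>)) \<partial>\<Omega>)" for T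
  proof (cases "0 \<le> T")
    case True
    then have "E T = (\<integral>\<omega>. survival x T \<omega> * exp (c * (x + X T \<omega>)) \<partial>\<Omega>)"
      unfolding E_def by (simp add: payoff_eq cong: Bochner_Integration.integral_cong)
    then show ?thesis using True by (simp add: disc_def mult.assoc)
  qed (simp add: disc_def)
  have int': "integrable lborel (\<lambda>T. \<integral>\<omega>. (disc T * survival x T \<omega>) * exp (c * (x + X T \<omega>)) \<partial>\<Omega>)"
    using integrable_fst'[OF int] by simp
  then show "set_integrable lborel {0..} (\<lambda>T. \<alpha> * exp (- \<alpha> * T) * E T)"
    unfolding set_integrable_def eq by (rule integrable_mult_right)
  have "(LBINT T:{0..}. \<alpha> * exp (- \<alpha> * T) * E T) = \<alpha> * (\<integral>T. (\<integral>\<omega>. (disc T * survival x T \<omega>) * exp (c * (x + X T \<omega>)) \<partial>\<Omega>) \<partial>lborel)"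
    unfolding set_lebesgue_integral_def eq by simp
  also have "\<dots> = \<alpha> * (\<integral>p. (disc (fst p) * survival x (fst p) (snd p)) * exp (c * (x + X (fst p) (snd p))) \<partial>(lborel \<Otimes>\<^sub>M \<Omega>))"
    using integral_fst'[OF int] by simp
  also have "(\<integral>p. (disc (fst p) * survival x (fst p) (snd p)) * exp (c * (x + X (fst p) (snd p))) \<partial>(lborel \<Otimes>\<^sub>M \<Omega>)) = (\<integral>y. exp (c * y) \<partial>killed x)"
    unfolding killed_def using disc_nonneg survival_pos
    by (subst integral_distr) (auto simp: integral_density less_imp_le)
  finally show "(LBINT T:{0..}. \<alpha> * exp (- \<alpha> * T) * E T) = (\<integral>y. \<alpha> * exp (c * y) \<partial>killed x)"
    by simp
qed

end

section \<open>The roots and the linear system\<close>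

lemma strict_mono_on_atLeastAtMost_Suc:
  fixes f :: "nat \<Rightarrow> real"
  assumes "\<And>i. i \<in> {1..m} \<Longrightarrow> f i < f (i + 1)"
  shows "strict_mono_on {1..m + 1} f"
proof (rule strict_mono_onI)
  fix i k :: nat assume "i \<in> {1..m + 1}" "k \<in> {1..m + 1}" "i < k"
  then have "Suc i \<le> k" "1 \<le> i" "k \<le> m + 1" by auto
  then show "f i < f k"
  proof (induction k rule: dec_induct)
    case base
    then show ?case using assms[of i] by simp
  next
    case (step k)
    then show ?case using assms[of k] by simp
  qed
qed

text \<open>A pole lies between consecutive roots of the same sign, so both families are strictly
  increasing. Injectivity follows, and positivity is inherited from the first member.\<close>

lemma root_facts:
  assumes "mejd_parameters P" and R: "root_assumption P a \<beta> g"
  shows "\<And>i. i \<in> {1..num_up P + 1} \<Longrightarrow> 0 < \<beta> i \<and> \<beta> i \<notin> levy_poles P \<and> levy_exponent P (\<beta> i) = a"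
    and "\<And>j. j \<in> {1..num_down P + 1} \<Longrightarrow> 0 < g j \<and> - g j \<notin> levy_poles P \<and> levy_exponent P (- g j) = a"
    and "inj_on \<beta> {1..num_up P + 1}" and "inj_on g {1..num_down P + 1}"
proof -
  have mono: "strict_mono_on {1..num_up P + 1} \<beta>" "strict_mono_on {1..num_down P + 1} g"
  proof -
    have "\<beta> i < \<beta> (i + 1)" if "i \<in> {1..num_up P}" for i
      using R that by (meson less_trans root_assumption_def)
    then show "strict_mono_on {1..num_up P + 1} \<beta>" by (rule strict_mono_on_atLeastAtMost_Suc)
    have "g j < g (j + 1)" if "j \<in> {1..num_down P}" for j
      using R that by (meson less_trans root_assumption_def)
    then show "strict_mono_on {1..num_down P + 1} g" by (rule strict_mono_on_atLeastAtMost_Suc)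
  qed
  then show "inj_on \<beta> {1..num_up P + 1}" "inj_on g {1..num_down P + 1}"
    by (auto intro: strict_mono_on_imp_inj_on)
  have roots: "{\<zeta>. \<zeta> \<notin> levy_poles P \<and> levy_exponent P \<zeta> = a} = \<beta> ` {1..num_up P + 1} \<union> (\<lambda>j. - g j) ` {1..num_down P + 1}"
    and pos: "0 < \<beta> 1" "0 < g 1"
    using R by (auto simp: root_assumption_def)
  show "0 < \<beta> i \<and> \<beta> i \<notin> levy_poles P \<and> levy_exponent P (\<beta> i) = a" if "i \<in> {1..num_up P + 1}" for i
  proof -
    have "\<beta> i \<in> {\<zeta>. \<zeta> \<notin> levy_poles P \<and> levy_exponent P \<zeta> = a}" unfolding roots using that by blast
    moreover have "\<beta> 1 \<le> \<beta> i" using that strict_mono_on_leD[OF mono(1), of 1 i] by auto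
    ultimately show ?thesis using pos by auto
  qed
  show "0 < g j \<and> - g j \<notin> levy_poles P \<and> levy_exponent P (- g j) = a" if "j \<in> {1..num_down P + 1}" for j
  proof -
    have "- g j \<in> {\<zeta>. \<zeta> \<notin> levy_poles P \<and> levy_exponent P \<zeta> = a}" unfolding roots using that by blast
    moreover have "g 1 \<le> g j" using that strict_mono_on_leD[OF mono(2), of 1 j] by auto
    ultimately show ?thesis using pos by auto
  qed
qed

text \<open>Without a Gaussian part \<open>G - a\<close> has at most \<open>m + n + 1\<close> zeros, one less than the root
  assumption demands.\<close>

lemma volatility_pos:
  assumes P: "mejd_parameters P" and R: "root_assumption P a \<beta> g"
  shows "0 < volatility P"
proof (rule ccontr)
  assume "\<not> 0 < volatility P"
  then have vol: "volatility P = 0" using P by (simp add: mejd_parameters_def)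
  define I where "I = {1..num_up P} <+> {1..num_down P}"
  define e where "e = case_sum (eta P) (\<lambda>j. - theta P j)"
  \<comment> \<open>Downward terms are brought to the form \<open>c / (e - x)\<close> with
    \<open>e = - \<theta>\<close> by
    \<open>\<theta> / (\<theta> + x) = - \<theta> / (- \<theta> - x)\<close>; hence the minus sign
    in the second branch.\<close>
  define c where "c = case_sum (\<lambda>i. rate P * prob_up P * weight_up P i * eta P i) (\<lambda>j. - rate P * prob_down P * weight_down P j * theta P j)"
  have G: "levy_exponent P x = drift P * x - rate P + (\<Sum>i\<in>I. c i / (e i - x))" for x
  proof -
    have "(\<Sum>i\<in>I. c i / (e i - x)) =
        (\<Sum>i=1..num_up P. rate P * prob_up P * (weight_up P i * eta P i / (eta P i - x))) +
        (\<Sum>j=1..num_down P. rate P * prob_down P * (weight_down P j * theta P j / (theta P j + x)))"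
      unfolding I_def by (subst sum.Plus) (auto simp: c_def e_def minus_divide_divide[of _ "_ + _", symmetric] intro!: arg_cong2[where f="(+)"] sum.cong)
    then show ?thesis
      by (simp add: levy_exponent_def vol sum_distrib_left algebra_simps)
  qed
  have poles: "levy_poles P = e ` I"
    by (simp add: levy_poles_def I_def e_def Plus_def image_Un image_image)
  have "{x. x \<notin> e ` I \<and> drift P * x + (- rate P - a) + (\<Sum>i\<in>I. c i / (e i - x)) = 0} =
      {\<zeta>. \<zeta> \<notin> levy_poles P \<and> levy_exponent P \<zeta> = a}"
    unfolding poles G by (auto simp: algebra_simps)
  also have "\<dots> = \<beta> ` {1..num_up P + 1} \<union> (\<lambda>j. - g j) ` {1..num_down P + 1}"
    using R by (simp add: root_assumption_def)
  finally have zeros: "{x. x \<notin> e ` I \<and> drift P * x + (- rate P - a) + (\<Sum>i\<in>I. c i / (e i - x)) = 0} =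
      \<beta> ` {1..num_up P + 1} \<union> (\<lambda>j. - g j) ` {1..num_down P + 1}" .
  have "card (\<beta> ` {1..num_up P + 1} \<union> (\<lambda>j. - g j) ` {1..num_down P + 1}) =
      card (\<beta> ` {1..num_up P + 1}) + card ((\<lambda>j. - g j) ` {1..num_down P + 1})"
  proof (rule card_Un_disjoint)
    show "\<beta> ` {1..num_up P + 1} \<inter> (\<lambda>j. - g j) ` {1..num_down P + 1} = {}"
    proof (rule equals0I)
      fix x assume "x \<in> \<beta> ` {1..num_up P + 1} \<inter> (\<lambda>j. - g j) ` {1..num_down P + 1}"
      then obtain i j where "i \<in> {1..num_up P + 1}" "j \<in> {1..num_down P + 1}" "\<beta> i = - g j" by blast
      then show False using root_facts(1)[OF P R, of i] root_facts(2)[OF P R, of j] by linarith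
    qed
  qed auto
  also have "card ((\<lambda>j. - g j) ` {1..num_down P + 1}) = num_down P + 1"
    using root_facts(4)[OF P R] by (subst card_image) (auto simp: inj_on_def)
  also have "card (\<beta> ` {1..num_up P + 1}) = num_up P + 1"
    using root_facts(3)[OF P R] by (subst card_image) auto
  finally have "num_up P + num_down P + 2 \<le> card I + 1"
    using card_zeros_partial_fractions_le[of I e "drift P" "- rate P - a" c] unfolding zeros by (simp add: I_def)
  then show False by (simp add: I_def card_Plus)
qed

text \<open>The jump part of \<open>(G z - G s) / (z - s)\<close>. As a function of \<open>z\<close>
  it is a combination of \<open>1 / (\<eta> - z)\<close> and \<open>1 / (\<theta> + z)\<close>, the
  entries of \<open>v_vec\<close> from the third on, with coefficients depending on \<open>s\<close>
  alone.\<close>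

abbreviation jump_quotient :: "mejd \<Rightarrow> complex \<Rightarrow> complex \<Rightarrow> complex" where
  "jump_quotient P s z \<equiv> of_real (rate P) * (of_real (prob_up P) * (\<Sum>i=1..num_up P. of_real (weight_up P i * eta P i) / (of_real (eta P i) - s) * (1 / (of_real (eta P i) - z)))
      - of_real (prob_down P) * (\<Sum>j=1..num_down P. of_real (weight_down P j * theta P j) / (of_real (theta P j) + s) * (1 / (of_real (theta P j) + z))))"

lemma exponent_difference_quotient:
  fixes z s :: complex
  assumes nz: "\<And>i. i \<in> {1..num_up P} \<Longrightarrow> of_real (eta P i) \<noteq> z \<and> of_real (eta P i) \<noteq> s"
    "\<And>j. j \<in> {1..num_down P} \<Longrightarrow> of_real (theta P j) + z \<noteq> 0 \<and> of_real (theta P j) + s \<noteq> 0" and "z \<noteq> s"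
  shows "(complex_exponent P z - complex_exponent P s) / (z - s) = of_real (drift P) + of_real ((volatility P)\<^sup>2) / 2 * (z + s)
    + jump_quotient P s z"
proof -
  let ?up = "\<lambda>x. (\<Sum>i=1..num_up P. of_real (weight_up P i * eta P i) / (of_real (eta P i) - x))"
  let ?down = "\<lambda>x. (\<Sum>j=1..num_down P. of_real (weight_down P j * theta P j) / (of_real (theta P j) + x))"
  have up: "?up z - ?up s
      = (z - s) * (\<Sum>i=1..num_up P. of_real (weight_up P i * eta P i) / (of_real (eta P i) - s) * (1 / (of_real (eta P i) - z)))"
  proof -
    have "A / (e - z) - A / (e - s) = (z - s) * (A / (e - s) * (1 / (e - z)))" if "e \<noteq> z \<and> e \<noteq> s" for A e :: complex
      using that by (simp add: divide_simps) (simp add: algebra_simps)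
    then show ?thesis using nz(1) unfolding sum_subtractf[symmetric] sum_distrib_left by (intro sum.cong) auto
  qed
  have down: "?down z - ?down s
      = - (z - s) * (\<Sum>j=1..num_down P. of_real (weight_down P j * theta P j) / (of_real (theta P j) + s) * (1 / (of_real (theta P j) + z)))"
  proof -
    have "A / (e + z) - A / (e + s) = - (z - s) * (A / (e + s) * (1 / (e + z)))" if "e + z \<noteq> 0 \<and> e + s \<noteq> 0" for A e :: complex
      using that by (simp add: divide_simps) (simp add: algebra_simps)
    then show ?thesis using nz(2) unfolding sum_subtractf[symmetric] sum_distrib_left by (intro sum.cong) auto
  qed
  have "complex_exponent P z - complex_exponent P s = of_real (drift P) * (z - s) + of_real ((volatility P)\<^sup>2) / 2 * (z\<^sup>2 - s\<^sup>2)
    + of_real (rate P) * (of_real (prob_up P) * (?up z - ?up s)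
      + of_real (prob_down P) * (?down z - ?down s))"
  proof -
    have "(D * z + V * z\<^sup>2 + R * (p * A + q * B - 1)) - (D * s + V * s\<^sup>2 + R * (p * A' + q * B' - 1)) =
      D * (z - s) + V * (z\<^sup>2 - s\<^sup>2) + R * (p * (A - A') + q * (B - B'))" for D V R p q A A' B B' :: complex
      by (simp add: algebra_simps)
    then show ?thesis unfolding complex_exponent_def jump_mgf_def .
  qed
  also have "\<dots> = (z - s) * (of_real (drift P) + of_real ((volatility P)\<^sup>2) / 2 * (z + s)
    + jump_quotient P s z)"
  proof -
    have "D * (z - s) + V * (z\<^sup>2 - s\<^sup>2) + R * (p * ((z - s) * A) + q * (- (z - s) * B)) =
      (z - s) * (D + V * (z + s) + R * (p * A - q * B))" for D V R p q A B :: complex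
      by (simp add: algebra_simps power2_eq_square)
    then show ?thesis unfolding up down .
  qed
  finally show ?thesis using \<open>z \<noteq> s\<close> by simp
qed

lemma dim_v_vec [simp]: "dim_vec (v_vec P a) = sys_dim P"
  by (simp add: v_vec_def sys_dim_def)

lemma v_vec_carrier [simp]: "v_vec P a \<in> carrier_vec (sys_dim P)"
  by (rule carrier_vecI) simp

lemma v_vec_index:
  shows "v_vec P a $ 0 = 1" and "v_vec P a $ 1 = a"
    and "i \<in> {1..num_up P} \<Longrightarrow> v_vec P a $ (i + 1) = 1 / (eta P i - a)"
    and "j \<in> {1..num_down P} \<Longrightarrow> v_vec P a $ (num_up P + 1 + j) = 1 / (theta P j + a)"
  unfolding v_vec_def vec_of_list_index by (auto simp: nth_append nth_Cons' simp del: upt_Suc)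

text \<open>A finite signed combination of nodes, given as coefficient-node pairs, that annihilates
  \<open>v\<close> also annihilates \<open>z \<mapsto> (G z - G s) / (z - s)\<close>, which depends linearly on \<open>v z\<close>.\<close>

definition combine :: "(real \<times> real) list \<Rightarrow> (real \<Rightarrow> complex) \<Rightarrow> complex" where
  "combine L f = (\<Sum>(q, z)\<leftarrow>L. of_real q * f z)"

lemma combine_Nil [simp]: "combine [] f = 0"
  and combine_Cons [simp]: "combine ((q, z) # L) f = of_real q * f z + combine L f"
  and combine_append [simp]: "combine (L @ K) f = combine L f + combine K f"
  by (simp_all add: combine_def)

lemma combine_add: "combine L (\<lambda>z. f z + g z) = combine L f + combine L g"
  and combine_diff: "combine L (\<lambda>z. f z - g z) = combine L f - combine L g"
  and combine_mult: "combine L (\<lambda>z. c * f z) = c * combine L f"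
  by (induction L) (auto simp: algebra_simps)

lemma combine_sum: "combine L (\<lambda>z. \<Sum>i\<in>I. f i z) = (\<Sum>i\<in>I. combine L (f i))"
  by (induction L) (auto simp: algebra_simps sum.distrib sum_distrib_left)

lemma combine_map_upt:
  "combine (map (\<lambda>i. (q i, z i)) [1..<k + 2]) f = (\<Sum>i=1..k + 1. of_real (q i) * f (z i))"
proof -
  have "set [1..<k + 2] = {1..k + 1}" by auto
  then show ?thesis
    unfolding combine_def by (simp add: o_def interv_sum_list_conv_sum_set_nat del: upt_Suc)
qed

lemma combine_cong: "(\<And>q z. (q, z) \<in> set L \<Longrightarrow> f z = g z) \<Longrightarrow> combine L f = combine L g"
  unfolding combine_def by (rule arg_cong[where f=sum_list]) (auto intro!: map_cong)

text \<open>Under the combination \<open>a - G s\<close> is split into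
  \<open>(a - G z) + (G z - G s)\<close>, and the second summand over \<open>z - s\<close> is
  annihilated. A nonzero imaginary \<open>s\<close> meets neither a node nor a pole, all of which
  are real.\<close>

lemma combine_exponent:
  fixes s :: complex
  assumes P: "mejd_parameters P" and s: "Re s = 0" "s \<noteq> 0"
    and nodes: "\<And>q z. (q, z) \<in> set L \<Longrightarrow> z \<notin> levy_poles P"
    and null: "\<And>r. r < sys_dim P \<Longrightarrow> combine L (\<lambda>z. of_real (v_vec P z $ r)) = 0"
  shows "(a - complex_exponent P s) * combine L (\<lambda>z. 1 / (of_real z - s)) = combine L (\<lambda>z. (a - complex_exponent P (of_real z)) / (of_real z - s))"
proof -
  have s_nonreal: "complex_of_real z - s \<noteq> 0" for z using s by (auto simp: complex_eq_iff)
  have null_1: "combine L (\<lambda>z. 1) = 0" and null_id: "combine L of_real = 0"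
    using null[of 0] null[of 1] by (simp_all add: v_vec_index[simplified] sys_dim_def)
  have null_eta: "combine L (\<lambda>z. 1 / (of_real (eta P i) - of_real z)) = 0" if "i \<in> {1..num_up P}" for i
    using null[of "i + 1"] that by (simp add: v_vec_index(3)[OF that, simplified] sys_dim_def)
  have null_theta: "combine L (\<lambda>z. 1 / (of_real (theta P j) + of_real z)) = 0" if "j \<in> {1..num_down P}" for j
    using null[of "num_up P + 1 + j"] that by (simp add: v_vec_index(4)[OF that, simplified] sys_dim_def)
  have "combine L (\<lambda>z. (complex_exponent P (of_real z) - complex_exponent P s) / (of_real z - s)) =
    combine L (\<lambda>z. (of_real (drift P) + of_real ((volatility P)\<^sup>2) / 2 * s) * 1 + of_real ((volatility P)\<^sup>2) / 2 * of_real z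
    + jump_quotient P s (of_real z))"
  proof (rule combine_cong)
    fix q z assume "(q, z) \<in> set L"
    from nodes[OF this] have z: "z \<noteq> eta P i" if "i \<in> {1..num_up P}" for i using that by (auto simp: levy_poles_def)
    from nodes[OF \<open>(q, z) \<in> set L\<close>] have z': "z \<noteq> - theta P j" if "j \<in> {1..num_down P}" for j using that by (auto simp: levy_poles_def)
    have nz1: "complex_of_real (eta P i) \<noteq> of_real z \<and> complex_of_real (eta P i) \<noteq> s" if "i \<in> {1..num_up P}" for i
      using z[OF that] s by (auto simp: complex_eq_iff)
    have nz2: "complex_of_real (theta P j) + of_real z \<noteq> 0 \<and> complex_of_real (theta P j) + s \<noteq> 0" if "j \<in> {1..num_down P}" for j
      using z'[OF that] s by (auto simp: complex_eq_iff)
    have "complex_of_real z \<noteq> s" using s_nonreal[of z] by auto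
    from exponent_difference_quotient[OF nz1 nz2 this]
    show "(complex_exponent P (of_real z) - complex_exponent P s) / (of_real z - s) = (of_real (drift P) + of_real ((volatility P)\<^sup>2) / 2 * s) * 1 + of_real ((volatility P)\<^sup>2) / 2 * of_real z
    + jump_quotient P s (of_real z)"
      by (simp add: algebra_simps)
  qed
  also have "\<dots> = 0"
    unfolding combine_add combine_diff combine_mult combine_sum by (simp add: null_1 null_id null_eta null_theta)
  finally have *: "combine L (\<lambda>z. (complex_exponent P (of_real z) - complex_exponent P s) / (of_real z - s)) = 0" .
  have "(a - complex_exponent P s) * combine L (\<lambda>z. 1 / (of_real z - s)) =
      combine L (\<lambda>z. (a - complex_exponent P (of_real z)) / (of_real z - s) + (complex_exponent P (of_real z) - complex_exponent P s) / (of_real z - s))"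
    unfolding combine_mult[symmetric] by (rule combine_cong) (simp add: diff_divide_distrib)
  then show ?thesis unfolding combine_add * by simp
qed

section \<open>Coordinates of the block matrices and vectors\<close>

lemma nth_two_blocks:
  shows "i \<in> {1..p + 1} \<Longrightarrow> (map f [1..<p + 2] @ map g [1..<q + 2]) ! (i - 1) = f i"
    and "j \<in> {1..q + 1} \<Longrightarrow> (map f [1..<p + 2] @ map g [1..<q + 2]) ! (p + j) = g j"
  by (auto simp: nth_append simp del: upt_Suc)

text \<open>Families are numbered from 1 and columns from 0, and the first block has
  \<open>p + 1\<close> columns: \<open>i\<close> sits in column \<open>i - 1\<close>, and
  \<open>j\<close> of the second block in column \<open>(p + 1) + (j - 1) = p + j\<close>.\<close>

lemma sum_two_blocks:
  fixes F :: "nat \<Rightarrow> 'b :: comm_monoid_add"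
  shows "(\<Sum>k<p + q + 2. F k) = (\<Sum>i=1..p + 1. F (i - 1)) + (\<Sum>j=1..q + 1. F (p + j))"
proof -
  have "(\<Sum>k<p + q + 2. F k) = (\<Sum>k=0..<p + 1. F k) + (\<Sum>k=p + 1..<p + q + 2. F k)"
    unfolding atLeast0LessThan[symmetric] by (rule sum.atLeastLessThan_concat[symmetric]) auto
  also have "(\<Sum>k=0..<p + 1. F k) = (\<Sum>i=1..p + 1. F (i - 1))"
    by (rule sum.reindex_bij_witness[of _ "\<lambda>i. i - 1" Suc]) auto
  also have "(\<Sum>k=p + 1..<p + q + 2. F k) = (\<Sum>j=1..q + 1. F (p + j))"
    by (rule sum.reindex_bij_witness[of _ "\<lambda>j. p + j" "\<lambda>k. k - p"]) auto
  finally show ?thesis .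
qed

lemma vec_of_list_append: "vec_of_list (xs @ ys) = vec_of_list xs @\<^sub>v vec_of_list ys"
  by (rule eq_vecI) (auto simp: vec_of_list_index nth_append)

lemma mult_mat_two_blocks:
  assumes A: "A \<in> carrier_mat d (p + q + 2)" and "r < d"
    and f: "\<And>i. i \<in> {1..p + 1} \<Longrightarrow> A $$ (r, i - 1) = f i" and g: "\<And>j. j \<in> {1..q + 1} \<Longrightarrow> A $$ (r, p + j) = g j"
  shows "(A *\<^sub>v vec_of_list (map a [1..<p + 2] @ map b [1..<q + 2])) $ r = (\<Sum>i=1..p + 1. a i * f i) + (\<Sum>j=1..q + 1. b j * g j :: real)"
proof -
  let ?xs = "map a [1..<p + 2] @ map b [1..<q + 2]"
  have "(A *\<^sub>v vec_of_list ?xs) $ r = (\<Sum>k<p + q + 2. A $$ (r, k) * ?xs ! k)"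
    using A \<open>r < d\<close> by (auto simp: scalar_prod_def vec_of_list_index atLeast0LessThan simp del: upt_Suc intro!: sum.cong)
  also have "\<dots> = (\<Sum>i=1..p + 1. a i * f i) + (\<Sum>j=1..q + 1. b j * g j)"
    unfolding sum_two_blocks by (intro arg_cong2[where f="(+)"] sum.cong refl) (simp_all only: nth_two_blocks f g mult.commute)
  finally show ?thesis .
qed

lemma two_blocks_columns:
  assumes "r < d" "\<And>i. f i \<in> carrier_vec d" "\<And>j. g j \<in> carrier_vec d" "d = p + q + 2"
  shows "i \<in> {1..p + 1} \<Longrightarrow> mat_of_cols d (map f [1..<p + 2] @ map g [1..<q + 2]) $$ (r, i - 1) = f i $ r"
    and "j \<in> {1..q + 1} \<Longrightarrow> mat_of_cols d (map f [1..<p + 2] @ map g [1..<q + 2]) $$ (r, p + j) = g j $ r"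
    and "mat_of_cols d (map f [1..<p + 2] @ map g [1..<q + 2]) \<in> carrier_mat d (p + q + 2)"
  using assms by (auto simp: mat_of_cols_index nth_append simp del: upt_Suc)

lemma mult_diag_index:
  assumes "A \<in> carrier_mat d d" "r < d" "k < d"
  shows "(A * mat_diag d e) $$ (r, k) = A $$ (r, k) * (e k :: real)"
  using assms by (subst mat_diag_mult_right[OF assms(1)]) simp

context
  fixes P :: mejd and h H :: real and \<beta> g \<beta>' g' \<omega>L \<nu>0 \<nu>U \<omega>0 :: "nat \<Rightarrow> real"
begin

lemma M_mat_index:
  assumes "r < sys_dim P"
  shows "i \<in> {1..num_up P + 1} \<Longrightarrow> M_mat P \<beta> g' $$ (r, i - 1) = v_vec P (\<beta> i) $ r"
    and "j \<in> {1..num_down P + 1} \<Longrightarrow> M_mat P \<beta> g' $$ (r, num_up P + j) = v_vec P (- g' j) $ r"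
    and "M_mat P \<beta> g' \<in> carrier_mat (sys_dim P) (sys_dim P)"
proof -
  have d: "sys_dim P = num_up P + num_down P + 2" by (simp add: sys_dim_def)
  note two = two_blocks_columns[where f="\<lambda>i. v_vec P (\<beta> i)" and g="\<lambda>j. v_vec P (- g' j)", OF assms v_vec_carrier v_vec_carrier d]
  show "i \<in> {1..num_up P + 1} \<Longrightarrow> M_mat P \<beta> g' $$ (r, i - 1) = v_vec P (\<beta> i) $ r"
    and "j \<in> {1..num_down P + 1} \<Longrightarrow> M_mat P \<beta> g' $$ (r, num_up P + j) = v_vec P (- g' j) $ r"
    unfolding M_mat_def by (rule two(1), assumption, rule two(2), assumption)
  show "M_mat P \<beta> g' \<in> carrier_mat (sys_dim P) (sys_dim P)"
    using two(3) unfolding M_mat_def d[symmetric] .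
qed

lemma N_mat_index:
  assumes "r < sys_dim P"
  shows "j \<in> {1..num_down P + 1} \<Longrightarrow> N_mat P g \<beta>' $$ (r, j - 1) = v_vec P (- g j) $ r"
    and "i \<in> {1..num_up P + 1} \<Longrightarrow> N_mat P g \<beta>' $$ (r, num_down P + i) = v_vec P (\<beta>' i) $ r"
    and "N_mat P g \<beta>' \<in> carrier_mat (sys_dim P) (sys_dim P)"
proof -
  have d: "sys_dim P = num_down P + num_up P + 2" by (simp add: sys_dim_def)
  note two = two_blocks_columns[where f="\<lambda>j. v_vec P (- g j)" and g="\<lambda>i. v_vec P (\<beta>' i)", OF assms v_vec_carrier v_vec_carrier d]
  show "j \<in> {1..num_down P + 1} \<Longrightarrow> N_mat P g \<beta>' $$ (r, j - 1) = v_vec P (- g j) $ r"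
    and "i \<in> {1..num_up P + 1} \<Longrightarrow> N_mat P g \<beta>' $$ (r, num_down P + i) = v_vec P (\<beta>' i) $ r"
    unfolding N_mat_def by (rule two(1), assumption, rule two(2), assumption)
  show "N_mat P g \<beta>' \<in> carrier_mat (sys_dim P) (sys_dim P)"
    using two(3) unfolding N_mat_def d[symmetric] .
qed

lemma Z_beta_index:
  "j \<in> {1..num_down P + 1} \<Longrightarrow> (replicate (num_down P + 1) 0 @ map (\<lambda>i. exp (\<beta>' i * (h - H))) [1..<num_up P + 2]) ! (j - 1) = 0"
  "i \<in> {1..num_up P + 1} \<Longrightarrow> (replicate (num_down P + 1) 0 @ map (\<lambda>i. exp (\<beta>' i * (h - H))) [1..<num_up P + 2]) ! (num_down P + i) = exp (\<beta>' i * (h - H))"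
  by (auto simp: nth_append simp del: upt_Suc replicate_Suc)

lemma Z_gamma_index:
  "i \<in> {1..num_up P + 1} \<Longrightarrow> (replicate (num_up P + 1) 0 @ map (\<lambda>j. exp (g' j * (h - H))) [1..<num_down P + 2]) ! (i - 1) = 0"
  "j \<in> {1..num_down P + 1} \<Longrightarrow> (replicate (num_up P + 1) 0 @ map (\<lambda>j. exp (g' j * (h - H))) [1..<num_down P + 2]) ! (num_up P + j) = exp (g' j * (h - H))"
  by (auto simp: nth_append simp del: upt_Suc replicate_Suc)

lemma B_mat_carrier: "B_mat P h H \<beta> g \<beta>' g' \<in> carrier_mat (sys_dim P + sys_dim P) (sys_dim P + sys_dim P)"
proof -
  have "0 < sys_dim P" by (simp add: sys_dim_def)
  then show ?thesis
    unfolding B_mat_def by (intro four_block_carrier_mat M_mat_index(3) N_mat_index(3))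
qed

text \<open>The first block row is the matching at \<open>h\<close>, the second the matching at
  \<open>H\<close>. The zeros of \<open>Z_beta\<close> and \<open>Z_gamma\<close> remove from each
  the outer solution living at the other end of the corridor; the inner exponentials occur in both,
  damped by the width \<open>H - h\<close> at the end where they are not normalised.\<close>

lemma B_mat_mult_Q:
  assumes r: "r < sys_dim P"
  shows "(B_mat P h H \<beta> g \<beta>' g' *\<^sub>v Q_vec P \<omega>L \<nu>0 \<nu>U \<omega>0) $ r =
      (\<Sum>i=1..num_up P + 1. \<omega>L i * v_vec P (\<beta> i) $ r) + (\<Sum>j=1..num_down P + 1. \<nu>0 j * v_vec P (- g' j) $ r)
      + (\<Sum>i=1..num_up P + 1. \<omega>0 i * exp (\<beta>' i * (h - H)) * v_vec P (\<beta>' i) $ r)"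
    and "(B_mat P h H \<beta> g \<beta>' g' *\<^sub>v Q_vec P \<omega>L \<nu>0 \<nu>U \<omega>0) $ (sys_dim P + r) =
      (\<Sum>j=1..num_down P + 1. \<nu>0 j * exp (g' j * (h - H)) * v_vec P (- g' j) $ r)
      + (\<Sum>j=1..num_down P + 1. \<nu>U j * v_vec P (- g j) $ r) + (\<Sum>i=1..num_up P + 1. \<omega>0 i * v_vec P (\<beta>' i) $ r)"
proof -
  let ?S = "sys_dim P" and ?m = "num_up P" and ?n = "num_down P"
  define q1 where "q1 = vec_of_list (map \<omega>L [1..<?m + 2] @ map \<nu>0 [1..<?n + 2])"
  define q2 where "q2 = vec_of_list (map \<nu>U [1..<?n + 2] @ map \<omega>0 [1..<?m + 2])"
  define Zb where "Zb = Z_beta P h H \<beta>'"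
  define Zg where "Zg = Z_gamma P h H g'"
  have S: "?S = ?m + ?n + 2" "?S = ?n + ?m + 2" by (simp_all add: sys_dim_def)
  have M: "M_mat P \<beta> g' \<in> carrier_mat ?S ?S" and N: "N_mat P g \<beta>' \<in> carrier_mat ?S ?S"
    by (rule M_mat_index(3)[OF r], rule N_mat_index(3)[OF r])
  have NZ: "N_mat P g \<beta>' * Zb \<in> carrier_mat ?S ?S" and MZ: "M_mat P \<beta> g' * Zg \<in> carrier_mat ?S ?S"
    using M N by (auto simp: Zb_def Zg_def Z_beta_def Z_gamma_def)
  have q: "q1 \<in> carrier_vec ?S" "q2 \<in> carrier_vec ?S"
    by (auto simp: q1_def q2_def sys_dim_def intro!: carrier_vecI simp del: upt_Suc)
  have Q: "Q_vec P \<omega>L \<nu>0 \<nu>U \<omega>0 = q1 @\<^sub>v q2"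
    unfolding Q_vec_def q1_def q2_def by (simp only: append_assoc vec_of_list_append[symmetric])
  have BQ: "B_mat P h H \<beta> g \<beta>' g' *\<^sub>v Q_vec P \<omega>L \<nu>0 \<nu>U \<omega>0 =
      (M_mat P \<beta> g' *\<^sub>v q1 + (N_mat P g \<beta>' * Zb) *\<^sub>v q2) @\<^sub>v ((M_mat P \<beta> g' * Zg) *\<^sub>v q1 + N_mat P g \<beta>' *\<^sub>v q2)"
    unfolding Q B_mat_def Zb_def[symmetric] Zg_def[symmetric] by (rule four_block_mat_mult_vec[OF M NZ MZ N q])
  have Mq: "(M_mat P \<beta> g' *\<^sub>v q1) $ r = (\<Sum>i=1..?m + 1. \<omega>L i * v_vec P (\<beta> i) $ r) + (\<Sum>j=1..?n + 1. \<nu>0 j * v_vec P (- g' j) $ r)"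
    unfolding q1_def by (rule mult_mat_two_blocks[OF M[unfolded S(1)] r[unfolded S(1)]]) (erule M_mat_index[OF r])+
  have Nq: "(N_mat P g \<beta>' *\<^sub>v q2) $ r = (\<Sum>j=1..?n + 1. \<nu>U j * v_vec P (- g j) $ r) + (\<Sum>i=1..?m + 1. \<omega>0 i * v_vec P (\<beta>' i) $ r)"
    unfolding q2_def by (rule mult_mat_two_blocks[OF N[unfolded S(2)] r[unfolded S(2)]]) (erule N_mat_index[OF r])+
  have NZq: "((N_mat P g \<beta>' * Zb) *\<^sub>v q2) $ r = (\<Sum>j=1..?n + 1. \<nu>U j * 0) + (\<Sum>i=1..?m + 1. \<omega>0 i * (v_vec P (\<beta>' i) $ r * exp (\<beta>' i * (h - H))))"
    unfolding q2_def
  proof (rule mult_mat_two_blocks[OF NZ[unfolded S(2)] r[unfolded S(2)]])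
    show "(N_mat P g \<beta>' * Zb) $$ (r, j - 1) = 0" if "j \<in> {1..?n + 1}" for j
    proof -
      have "j - 1 < ?S" using that by (auto simp: S)
      then show ?thesis unfolding Zb_def Z_beta_def mult_diag_index[OF N r \<open>j - 1 < ?S\<close>] Z_beta_index(1)[OF that] by simp
    qed
    show "(N_mat P g \<beta>' * Zb) $$ (r, ?n + i) = v_vec P (\<beta>' i) $ r * exp (\<beta>' i * (h - H))" if "i \<in> {1..?m + 1}" for i
    proof -
      have "?n + i < ?S" using that by (auto simp: S)
      then show ?thesis
        unfolding Zb_def Z_beta_def mult_diag_index[OF N r \<open>?n + i < ?S\<close>] Z_beta_index(2)[OF that] N_mat_index(2)[OF r that] by simp
    qed
  qed
  have MZq: "((M_mat P \<beta> g' * Zg) *\<^sub>v q1) $ r = (\<Sum>i=1..?m + 1. \<omega>L i * 0) + (\<Sum>j=1..?n + 1. \<nu>0 j * (v_vec P (- g' j) $ r * exp (g' j * (h - H))))"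
    unfolding q1_def
  proof (rule mult_mat_two_blocks[OF MZ[unfolded S(1)] r[unfolded S(1)]])
    show "(M_mat P \<beta> g' * Zg) $$ (r, i - 1) = 0" if "i \<in> {1..?m + 1}" for i
    proof -
      have "i - 1 < ?S" using that by (auto simp: S)
      then show ?thesis unfolding Zg_def Z_gamma_def mult_diag_index[OF M r \<open>i - 1 < ?S\<close>] Z_gamma_index(1)[OF that] by simp
    qed
    show "(M_mat P \<beta> g' * Zg) $$ (r, ?m + j) = v_vec P (- g' j) $ r * exp (g' j * (h - H))" if "j \<in> {1..?n + 1}" for j
    proof -
      have "?m + j < ?S" using that by (auto simp: S)
      then show ?thesis
        unfolding Zg_def Z_gamma_def mult_diag_index[OF M r \<open>?m + j < ?S\<close>] Z_gamma_index(2)[OF that] M_mat_index(2)[OF r that] by simp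
    qed
  qed
  show "(B_mat P h H \<beta> g \<beta>' g' *\<^sub>v Q_vec P \<omega>L \<nu>0 \<nu>U \<omega>0) $ r =
      (\<Sum>i=1..num_up P + 1. \<omega>L i * v_vec P (\<beta> i) $ r) + (\<Sum>j=1..num_down P + 1. \<nu>0 j * v_vec P (- g' j) $ r)
      + (\<Sum>i=1..num_up P + 1. \<omega>0 i * exp (\<beta>' i * (h - H)) * v_vec P (\<beta>' i) $ r)"
    using M N NZ MZ r Mq NZq by (simp only: BQ) (simp add: mult_ac)
  show "(B_mat P h H \<beta> g \<beta>' g' *\<^sub>v Q_vec P \<omega>L \<nu>0 \<nu>U \<omega>0) $ (sys_dim P + r) =
      (\<Sum>j=1..num_down P + 1. \<nu>0 j * exp (g' j * (h - H)) * v_vec P (- g' j) $ r)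
      + (\<Sum>j=1..num_down P + 1. \<nu>U j * v_vec P (- g j) $ r) + (\<Sum>i=1..num_up P + 1. \<omega>0 i * v_vec P (\<beta>' i) $ r)"
    using M N NZ MZ r MZq Nq by (simp only: BQ) (simp add: mult_ac)
qed

end

lemma Q_vec_carrier: "Q_vec P \<omega>L \<nu>0 \<nu>U \<omega>0 \<in> carrier_vec (sys_dim P + sys_dim P)"
  by (rule carrier_vecI) (simp add: Q_vec_def sys_dim_def del: upt_Suc)

lemma V_vec_carrier: "V_vec P h H c cU c0 \<in> carrier_vec (sys_dim P + sys_dim P)"
  by (simp add: V_vec_def)

lemma V_vec_index:
  assumes "r < sys_dim P"
  shows "V_vec P h H c cU c0 $ r = (cU - c0) * (exp (c * h) * v_vec P c $ r)"
    and "V_vec P h H c cU c0 $ (sys_dim P + r) = (cU - c0) * (exp (c * H) * v_vec P c $ r)"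
  using assms by (simp_all add: V_vec_def)

text \<open>Turns an abstract solution vector back into four coefficient families. The blocks start
  at positions 0, \<open>m + 1\<close>, \<open>m + n + 2\<close> and \<open>m + 2 * n + 3\<close>;
  the witnesses are shifted by one because the families start at index 1.\<close>

lemma Q_vec_surj:
  assumes "v \<in> carrier_vec (sys_dim P + sys_dim P)"
  shows "\<exists>\<omega>L \<nu>0 \<nu>U \<omega>0. v = Q_vec P \<omega>L \<nu>0 \<nu>U \<omega>0"
proof (intro exI eq_vecI)
  let ?m = "num_up P" and ?n = "num_down P"
  show "dim_vec v = dim_vec (Q_vec P (\<lambda>i. v $ (i - 1)) (\<lambda>j. v $ (?m + j)) (\<lambda>j. v $ (?m + ?n + 1 + j)) (\<lambda>i. v $ (?m + ?n + ?n + 2 + i)))"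
    unfolding carrier_vecD[OF assms] carrier_vecD[OF Q_vec_carrier] ..
  fix k assume "k < dim_vec (Q_vec P (\<lambda>i. v $ (i - 1)) (\<lambda>j. v $ (?m + j)) (\<lambda>j. v $ (?m + ?n + 1 + j)) (\<lambda>i. v $ (?m + ?n + ?n + 2 + i)))"
  then have "k < sys_dim P + sys_dim P" using carrier_vecD[OF Q_vec_carrier[of P]] by metis
  then show "v $ k = Q_vec P (\<lambda>i. v $ (i - 1)) (\<lambda>j. v $ (?m + j)) (\<lambda>j. v $ (?m + ?n + 1 + j)) (\<lambda>i. v $ (?m + ?n + ?n + 2 + i)) $ k"
    unfolding Q_vec_def vec_of_list_index
    by (auto simp: nth_append sys_dim_def simp del: upt_Suc intro!: arg_cong[where f="\<lambda>k. v $ k"])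
qed

section \<open>Verification of the piecewise exponential solution\<close>

text \<open>The case \<open>\<kappa> = 1\<close> is the solution sought, the case \<open>\<kappa> = 0\<close> the kernel of \<open>B\<close>. The function \<open>f\<close> of
  the introduction is \<open>shifted\<close>, and \<open>source\<close> is \<open>- \<rho> 1\<^sub>D (f - \<kappa> c\<^sub>U exp (c \<cdot>))\<close>.\<close>

locale mejd_candidate = killed_mejd P \<Omega> W N Y h H \<rho> \<alpha>
  for P :: mejd and \<Omega> :: "'a measure" and W N Y h H \<rho> \<alpha> +
  fixes \<beta> g \<beta>' g' :: "nat \<Rightarrow> real" and c \<kappa> :: real and \<omega>L \<nu>0 \<nu>U \<omega>0 :: "nat \<Rightarrow> real" and cU c0 :: real
  assumes roots: "root_assumption P \<alpha> \<beta> g" and roots': "root_assumption P (\<alpha> + \<rho>) \<beta>' g'"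
    and c_nonneg: "0 \<le> c" and c_less: "c < min (eta P 1) (theta P 1)" and G_c: "levy_exponent P c < \<alpha>"
    and cU: "cU = \<alpha> / (levy_exponent P c - \<alpha>)" and c0: "c0 = \<alpha> / (levy_exponent P c - (\<alpha> + \<rho>))"
    and BQ: "B_mat P h H \<beta> g \<beta>' g' *\<^sub>v Q_vec P \<omega>L \<nu>0 \<nu>U \<omega>0 = \<kappa> \<cdot>\<^sub>v V_vec P h H c cU c0"
begin

text \<open>One shape for the middle branch of \<open>shifted\<close> and for \<open>source\<close>,
  so that its transform is computed once. The exponentials are normalised to 1 at \<open>H\<close>
  and at \<open>h\<close> respectively, as in the blocks of \<open>B\<close>.\<close>

definition mid :: "(nat \<Rightarrow> real) \<Rightarrow> (nat \<Rightarrow> real) \<Rightarrow> real \<Rightarrow> real \<Rightarrow> real" where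
  "mid A B C x = (\<Sum>i=1..num_up P + 1. A i * exp (\<beta>' i * (x - H))) + (\<Sum>j=1..num_down P + 1. B j * exp (- g' j * (x - h))) + C * exp (c * x)"

abbreviation "mid_v \<equiv> mid (\<lambda>i. - \<omega>0 i) (\<lambda>j. - \<nu>0 j) (\<kappa> * (cU - c0))"

text \<open>This is \<open>- \<rho>\<close> times \<open>mid_v\<close> minus
  \<open>\<kappa> * cU * exp (c * x)\<close>; the last coefficient is
  \<open>- \<rho> * (\<kappa> * (cU - c0) - \<kappa> * cU)\<close>.\<close>

abbreviation "mid_w \<equiv> mid (\<lambda>i. \<rho> * \<omega>0 i) (\<lambda>j. \<rho> * \<nu>0 j) (\<rho> * \<kappa> * c0)"

definition shifted :: "real \<Rightarrow> real" where
  "shifted x = (if x \<le> h then \<Sum>i=1..num_up P + 1. \<omega>L i * exp (\<beta> i * (x - h))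
     else if x < H then mid_v x
     else \<Sum>j=1..num_down P + 1. \<nu>U j * exp (- g j * (x - H)))"

definition source :: "real \<Rightarrow> real" where
  "source x = indicator {h<..<H} x * mid_w x"

lemma source_eq: "source x = - \<rho> * (indicator {h<..<H} x * (shifted x - \<kappa> * cU * exp (c * x)))"
proof (cases "x \<in> {h<..<H}")
  case True
  then show ?thesis
    by (simp add: source_def shifted_def mid_def sum_negf sum_distrib_left algebra_simps)
qed (simp add: source_def)

lemma c_strip: "complex_of_real c \<in> strip P"
  using c_nonneg c_less params by (simp add: strip_def mejd_parameters_def)

lemma c_not_pole: "c \<notin> levy_poles P"
proof
  assume "c \<in> levy_poles P"
  then consider i where "i \<in> {1..num_up P}" "c = eta P i" | j where "j \<in> {1..num_down P}" "c = - theta P j"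
    by (auto simp: levy_poles_def)
  then show False
    using c_nonneg c_less eta_ge(1)[OF params] theta_ge(2)[OF params] by cases force+
qed

text \<open>The boundary terms at \<open>h\<close> in the Fourier transform of
  \<open>shifted\<close>, stripped of the factor \<open>exp (- s * h)\<close>; \<open>L2\<close> is
  the analogue at \<open>H\<close> with the opposite overall sign. The two block rows of the linear
  system say that \<open>L1\<close> and \<open>L2\<close> annihilate every entry of
  \<open>v_vec\<close>.\<close>

definition L1 :: "(real \<times> real) list" where
  "L1 = map (\<lambda>i. (\<omega>L i, \<beta> i)) [1..<num_up P + 2] @ map (\<lambda>j. (\<nu>0 j, - g' j)) [1..<num_down P + 2]
    @ map (\<lambda>i. (\<omega>0 i * exp (\<beta>' i * (h - H)), \<beta>' i)) [1..<num_up P + 2] @ [(- (\<kappa> * (cU - c0) * exp (c * h)), c)]"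

definition L2 :: "(real \<times> real) list" where
  "L2 = map (\<lambda>j. (\<nu>0 j * exp (g' j * (h - H)), - g' j)) [1..<num_down P + 2] @ map (\<lambda>j. (\<nu>U j, - g j)) [1..<num_down P + 2]
    @ map (\<lambda>i. (\<omega>0 i, \<beta>' i)) [1..<num_up P + 2] @ [(- (\<kappa> * (cU - c0) * exp (c * H)), c)]"

lemma combine_L1: "combine L1 f = (\<Sum>i=1..num_up P + 1. of_real (\<omega>L i) * f (\<beta> i)) + (\<Sum>j=1..num_down P + 1. of_real (\<nu>0 j) * f (- g' j))
    + (\<Sum>i=1..num_up P + 1. of_real (\<omega>0 i * exp (\<beta>' i * (h - H))) * f (\<beta>' i)) - of_real (\<kappa> * (cU - c0) * exp (c * h)) * f c"
  unfolding L1_def combine_append combine_map_upt by simp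

lemma combine_L2: "combine L2 f = (\<Sum>j=1..num_down P + 1. of_real (\<nu>0 j * exp (g' j * (h - H))) * f (- g' j)) + (\<Sum>j=1..num_down P + 1. of_real (\<nu>U j) * f (- g j))
    + (\<Sum>i=1..num_up P + 1. of_real (\<omega>0 i) * f (\<beta>' i)) - of_real (\<kappa> * (cU - c0) * exp (c * H)) * f c"
  unfolding L2_def combine_append combine_map_upt by simp

lemma matching:
  assumes r: "r < sys_dim P"
  shows "(\<Sum>i=1..num_up P + 1. \<omega>L i * v_vec P (\<beta> i) $ r) + (\<Sum>j=1..num_down P + 1. \<nu>0 j * v_vec P (- g' j) $ r)
      + (\<Sum>i=1..num_up P + 1. \<omega>0 i * exp (\<beta>' i * (h - H)) * v_vec P (\<beta>' i) $ r) = \<kappa> * (cU - c0) * exp (c * h) * v_vec P c $ r"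
    and "(\<Sum>j=1..num_down P + 1. \<nu>0 j * exp (g' j * (h - H)) * v_vec P (- g' j) $ r)
      + (\<Sum>j=1..num_down P + 1. \<nu>U j * v_vec P (- g j) $ r) + (\<Sum>i=1..num_up P + 1. \<omega>0 i * v_vec P (\<beta>' i) $ r) = \<kappa> * (cU - c0) * exp (c * H) * v_vec P c $ r"
proof -
  have d: "dim_vec (V_vec P h H c cU c0) = sys_dim P + sys_dim P" by (rule carrier_vecD[OF V_vec_carrier])
  show "(\<Sum>i=1..num_up P + 1. \<omega>L i * v_vec P (\<beta> i) $ r) + (\<Sum>j=1..num_down P + 1. \<nu>0 j * v_vec P (- g' j) $ r)
      + (\<Sum>i=1..num_up P + 1. \<omega>0 i * exp (\<beta>' i * (h - H)) * v_vec P (\<beta>' i) $ r) = \<kappa> * (cU - c0) * exp (c * h) * v_vec P c $ r"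
    unfolding B_mat_mult_Q(1)[OF r, of h H \<beta> g \<beta>' g' \<omega>L \<nu>0 \<nu>U \<omega>0, symmetric] BQ using r by (simp add: d V_vec_index mult.assoc)
  show "(\<Sum>j=1..num_down P + 1. \<nu>0 j * exp (g' j * (h - H)) * v_vec P (- g' j) $ r)
      + (\<Sum>j=1..num_down P + 1. \<nu>U j * v_vec P (- g j) $ r) + (\<Sum>i=1..num_up P + 1. \<omega>0 i * v_vec P (\<beta>' i) $ r) = \<kappa> * (cU - c0) * exp (c * H) * v_vec P c $ r"
    unfolding B_mat_mult_Q(2)[OF r, of h H \<beta> g \<beta>' g' \<omega>L \<nu>0 \<nu>U \<omega>0, symmetric] BQ using r by (simp add: d V_vec_index mult.assoc)
qed

lemma combine_null:
  assumes "r < sys_dim P"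
  shows "combine L1 (\<lambda>z. of_real (v_vec P z $ r)) = 0" "combine L2 (\<lambda>z. of_real (v_vec P z $ r)) = 0"
proof -
  have "combine L1 (\<lambda>z. of_real (v_vec P z $ r)) = of_real (((\<Sum>i=1..num_up P + 1. \<omega>L i * v_vec P (\<beta> i) $ r) + (\<Sum>j=1..num_down P + 1. \<nu>0 j * v_vec P (- g' j) $ r)
      + (\<Sum>i=1..num_up P + 1. \<omega>0 i * exp (\<beta>' i * (h - H)) * v_vec P (\<beta>' i) $ r)) - \<kappa> * (cU - c0) * exp (c * h) * v_vec P c $ r)"
    by (simp only: combine_L1 of_real_add of_real_sum of_real_mult of_real_diff)
  then show "combine L1 (\<lambda>z. of_real (v_vec P z $ r)) = 0" by (simp only: matching(1)[OF assms] diff_self of_real_0)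
  have "combine L2 (\<lambda>z. of_real (v_vec P z $ r)) = of_real (((\<Sum>j=1..num_down P + 1. \<nu>0 j * exp (g' j * (h - H)) * v_vec P (- g' j) $ r)
      + (\<Sum>j=1..num_down P + 1. \<nu>U j * v_vec P (- g j) $ r) + (\<Sum>i=1..num_up P + 1. \<omega>0 i * v_vec P (\<beta>' i) $ r)) - \<kappa> * (cU - c0) * exp (c * H) * v_vec P c $ r)"
    by (simp only: combine_L2 of_real_add of_real_sum of_real_mult of_real_diff)
  then show "combine L2 (\<lambda>z. of_real (v_vec P z $ r)) = 0" by (simp only: matching(2)[OF assms] diff_self of_real_0)
qed

lemma nodes_not_poles:
  "(q, z) \<in> set L1 \<Longrightarrow> z \<notin> levy_poles P" "(q, z) \<in> set L2 \<Longrightarrow> z \<notin> levy_poles P"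
proof -
  have up: "\<beta> i \<notin> levy_poles P" "\<beta>' i \<notin> levy_poles P" if "i \<in> set [1..<num_up P + 2]" for i
    using root_facts(1)[OF params roots, of i] root_facts(1)[OF params roots', of i] that by (auto simp del: upt_Suc)
  have down: "- g j \<notin> levy_poles P" "- g' j \<notin> levy_poles P" if "j \<in> set [1..<num_down P + 2]" for j
    using root_facts(2)[OF params roots, of j] root_facts(2)[OF params roots', of j] that by (auto simp del: upt_Suc)
  show "(q, z) \<in> set L1 \<Longrightarrow> z \<notin> levy_poles P" "(q, z) \<in> set L2 \<Longrightarrow> z \<notin> levy_poles P"
    unfolding L1_def L2_def set_append set_map using up down c_not_pole by (auto simp del: set_upt upt_Suc)
qed

text \<open>The row with index 0 of each block, where \<open>v_vec\<close> has the entry 1: the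
  branches take equal values at \<open>h\<close> and at \<open>H\<close>, so \<open>shifted\<close>
  is continuous.\<close>

lemma left_right_match:
  "(\<Sum>i=1..num_up P + 1. \<omega>L i * exp (\<beta> i * (h - h))) = mid_v h"
  "mid_v H = (\<Sum>j=1..num_down P + 1. \<nu>U j * exp (- g j * (H - H)))"
proof -
  have "- g' j * (H - h) = g' j * (h - H)" for j by (simp add: algebra_simps)
  then show "(\<Sum>i=1..num_up P + 1. \<omega>L i * exp (\<beta> i * (h - h))) = mid_v h"
    "mid_v H = (\<Sum>j=1..num_down P + 1. \<nu>U j * exp (- g j * (H - H)))"
    using matching[of 0] unfolding mid_def by (simp_all add: v_vec_index sys_dim_def sum_negf)
qed

lemma continuous_on_mid: "continuous_on S (mid A B C)"
  unfolding mid_def[abs_def] by (intro continuous_intros)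

lemma continuous_on_shifted: "continuous_on UNIV shifted"
proof -
  have shifted_eq: "shifted = (\<lambda>x. if x \<le> h then \<Sum>i=1..num_up P + 1. \<omega>L i * exp (\<beta> i * (x - h))
     else if x \<le> H then mid_v x
     else \<Sum>j=1..num_down P + 1. \<nu>U j * exp (- g j * (x - H)))"
  proof
    fix x
    show "shifted x = (if x \<le> h then \<Sum>i=1..num_up P + 1. \<omega>L i * exp (\<beta> i * (x - h))
     else if x \<le> H then mid_v x
     else \<Sum>j=1..num_down P + 1. \<nu>U j * exp (- g j * (x - H)))"
      unfolding shifted_def using left_right_match(2) by (cases "x = H") auto
  qed
  show ?thesis
    unfolding shifted_eq
  proof (rule continuous_on_cases_le)
    show "continuous_on {x \<in> UNIV. h \<le> x} (\<lambda>x. if x \<le> H then mid_v x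
     else \<Sum>j=1..num_down P + 1. \<nu>U j * exp (- g j * (x - H)))"
      by (rule continuous_on_cases_le) (use left_right_match(2) in \<open>auto intro!: continuous_intros continuous_on_mid\<close>)
  qed (use left_right_match(1) h_less_H in \<open>auto intro!: continuous_intros\<close>)
qed

lemma shifted_measurable [measurable]: "shifted \<in> borel_measurable borel"
  by (rule borel_measurable_continuous_onI[OF continuous_on_shifted])

lemma source_measurable [measurable]: "source \<in> borel_measurable borel"
  using borel_measurable_continuous_onI[OF continuous_on_mid[of UNIV]] unfolding source_def[abs_def] by measurable

lemma source_bounded: "\<exists>B\<ge>0. \<forall>x. \<bar>source x\<bar> \<le> B"
proof -
  have "compact (mid_w ` {h..H})"
    by (intro compact_continuous_image continuous_on_mid) simp
  then obtain B where B: "\<forall>x\<in>{h..H}. \<bar>mid_w x\<bar> \<le> B"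
    by (auto dest!: compact_imp_bounded simp: bounded_real)
  then have "0 \<le> B" using h_less_H by (force intro: order_trans[OF abs_ge_zero])
  then show ?thesis using B by (intro exI[of _ B]) (auto simp: source_def split: split_indicator)
qed

lemma isCont_source:
  assumes "y \<notin> {h, H}"
  shows "isCont source y"
proof (cases "y \<in> {h<..<H}")
  case True
  have "\<forall>\<^sub>F x in nhds y. x \<in> {h<..<H}" using True by (intro eventually_nhds_in_open) auto
  then have "\<forall>\<^sub>F x in nhds y. source x = mid_w x"
    by eventually_elim (simp add: source_def)
  moreover have "isCont (mid_w) y"
    using continuous_on_mid[of UNIV] by (simp add: continuous_on_eq_continuous_at)
  ultimately show ?thesis by (simp add: isCont_cong)
next
  case False
  have "\<forall>\<^sub>F x in nhds y. x \<in> - {h..H}" using False assms by (intro eventually_nhds_in_open) auto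
  then have "\<forall>\<^sub>F x in nhds y. source x = 0" by eventually_elim (auto simp: source_def)
  then show ?thesis by (simp add: isCont_cong[of source "\<lambda>_. 0"])
qed

section \<open>Fourier transforms of the candidate and of its source\<close>

context
  fixes \<xi> :: real and s :: complex
  assumes \<xi>: "\<xi> \<noteq> 0" and s: "s = - \<i> * of_real \<xi>"
begin

text \<open>With this sign of \<open>s\<close> the Fourier kernel is \<open>exp (- s * x)\<close>:
  exponentials integrate to multiples of \<open>1 / (\<zeta> - s)\<close>, and \<open>s\<close> is
  also the point at which the multiplier of the resolvent is taken.\<close>

lemma iexp_eq: "iexp (\<xi> * x) * of_real (exp (\<zeta> * (x - x0))) = of_real (exp (- \<zeta> * x0)) * exp ((of_real \<zeta> - s) * of_real x)"
  unfolding s exp_of_real[symmetric] by (simp add: algebra_simps flip: exp_add)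

lemma left_term:
  assumes "0 < \<zeta>"
  shows "has_bochner_integral lborel (\<lambda>x. indicator {..<h} x *\<^sub>R (iexp (\<xi> * x) * of_real (exp (\<zeta> * (x - h))))) (exp (- s * of_real h) * (1 / (of_real \<zeta> - s)))"
proof -
  have "has_bochner_integral lborel (\<lambda>x. of_real (exp (- \<zeta> * h)) * (indicator {..<h} x *\<^sub>R exp ((of_real \<zeta> - s) * of_real x)))
      (of_real (exp (- \<zeta> * h)) * (exp ((of_real \<zeta> - s) * of_real h) / (of_real \<zeta> - s)))"
    by (intro has_bochner_integral_mult_right has_bochner_integral_cexp_Iio) (use assms in \<open>simp add: s\<close>)
  moreover have "of_real (exp (- \<zeta> * h)) * (exp ((of_real \<zeta> - s) * of_real h) / (of_real \<zeta> - s)) = exp (- s * of_real h) * (1 / (of_real \<zeta> - s))"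
    unfolding exp_of_real[symmetric] by (simp add: algebra_simps flip: exp_add)
  ultimately show ?thesis unfolding iexp_eq by (simp only: mult_scaleR_right)
qed

lemma right_term:
  assumes "0 < \<zeta>"
  shows "has_bochner_integral lborel (\<lambda>x. indicator {H<..} x *\<^sub>R (iexp (\<xi> * x) * of_real (exp (- \<zeta> * (x - H))))) (- exp (- s * of_real H) * (1 / (of_real (- \<zeta>) - s)))"
proof -
  have "has_bochner_integral lborel (\<lambda>x. of_real (exp (- (- \<zeta>) * H)) * (indicator {H<..} x *\<^sub>R exp ((of_real (- \<zeta>) - s) * of_real x)))
      (of_real (exp (- (- \<zeta>) * H)) * (- exp ((of_real (- \<zeta>) - s) * of_real H) / (of_real (- \<zeta>) - s)))"
    by (intro has_bochner_integral_mult_right has_bochner_integral_cexp_Ioi) (use assms in \<open>simp add: s\<close>)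
  moreover have "of_real (exp (- (- \<zeta>) * H)) * (- exp ((of_real (- \<zeta>) - s) * of_real H) / (of_real (- \<zeta>) - s)) = - exp (- s * of_real H) * (1 / (of_real (- \<zeta>) - s))"
    unfolding exp_of_real[symmetric] by (simp add: algebra_simps flip: exp_add)
  ultimately show ?thesis unfolding iexp_eq by (simp only: mult_scaleR_right)
qed

text \<open>On the bounded corridor the sign of \<open>\<zeta>\<close> is free, and
  \<open>\<zeta> = 0\<close> occurs when \<open>c = 0\<close>; \<open>\<xi> \<noteq> 0\<close> keeps
  the denominator nonzero then as well.\<close>

lemma mid_term:
  "has_bochner_integral lborel (\<lambda>x. indicator {h<..<H} x *\<^sub>R (iexp (\<xi> * x) * of_real (exp (\<zeta> * (x - x0)))))
    ((exp (- s * of_real H) * of_real (exp (\<zeta> * (H - x0))) - exp (- s * of_real h) * of_real (exp (\<zeta> * (h - x0)))) * (1 / (of_real \<zeta> - s)))"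
proof -
  have nz: "of_real \<zeta> - s \<noteq> 0" using \<xi> by (auto simp: s complex_eq_iff)
  have "has_bochner_integral lborel (\<lambda>x. of_real (exp (- \<zeta> * x0)) * (indicator {h<..<H} x *\<^sub>R exp ((of_real \<zeta> - s) * of_real x)))
      (of_real (exp (- \<zeta> * x0)) * ((exp ((of_real \<zeta> - s) * of_real H) - exp ((of_real \<zeta> - s) * of_real h)) / (of_real \<zeta> - s)))"
    by (intro has_bochner_integral_mult_right has_bochner_integral_cexp_Ioo nz h_less_H)
  moreover have "of_real (exp (- \<zeta> * x0)) * exp ((of_real \<zeta> - s) * of_real y) = exp (- s * of_real y) * of_real (exp (\<zeta> * (y - x0)))" for y
    unfolding exp_of_real[symmetric] by (simp add: algebra_simps flip: exp_add)
  then have "of_real (exp (- \<zeta> * x0)) * ((exp ((of_real \<zeta> - s) * of_real H) - exp ((of_real \<zeta> - s) * of_real h)) / (of_real \<zeta> - s))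
      = (exp (- s * of_real H) * of_real (exp (\<zeta> * (H - x0))) - exp (- s * of_real h) * of_real (exp (\<zeta> * (h - x0)))) * (1 / (of_real \<zeta> - s))"
    by (simp add: right_diff_distrib)
  ultimately show ?thesis unfolding iexp_eq by (simp only: mult_scaleR_right)
qed

abbreviation F :: "real \<Rightarrow> complex" where "F z \<equiv> 1 / (of_real z - s)"

lemma fourier_mid:
  "has_bochner_integral lborel (\<lambda>x. indicator {h<..<H} x *\<^sub>R (iexp (\<xi> * x) * of_real (mid A B C x)))
    (exp (- s * of_real H) * ((\<Sum>i=1..num_up P + 1. of_real (A i) * F (\<beta>' i)) + (\<Sum>j=1..num_down P + 1. of_real (B j * exp (g' j * (h - H))) * F (- g' j)) + of_real (C * exp (c * H)) * F c)
     - exp (- s * of_real h) * ((\<Sum>i=1..num_up P + 1. of_real (A i * exp (\<beta>' i * (h - H))) * F (\<beta>' i)) + (\<Sum>j=1..num_down P + 1. of_real (B j) * F (- g' j)) + of_real (C * exp (c * h)) * F c))"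
proof -
  have hb: "has_bochner_integral lborel
     (\<lambda>x. (\<Sum>i=1..num_up P + 1. of_real (A i) * (indicator {h<..<H} x *\<^sub>R (iexp (\<xi> * x) * of_real (exp (\<beta>' i * (x - H))))))
       + (\<Sum>j=1..num_down P + 1. of_real (B j) * (indicator {h<..<H} x *\<^sub>R (iexp (\<xi> * x) * of_real (exp (- g' j * (x - h))))))
       + of_real C * (indicator {h<..<H} x *\<^sub>R (iexp (\<xi> * x) * of_real (exp (c * (x - 0))))))
     ((\<Sum>i=1..num_up P + 1. of_real (A i) * ((exp (- s * of_real H) * of_real (exp (\<beta>' i * (H - H))) - exp (- s * of_real h) * of_real (exp (\<beta>' i * (h - H)))) * F (\<beta>' i)))
      + (\<Sum>j=1..num_down P + 1. of_real (B j) * ((exp (- s * of_real H) * of_real (exp (- g' j * (H - h))) - exp (- s * of_real h) * of_real (exp (- g' j * (h - h)))) * F (- g' j)))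
      + of_real C * ((exp (- s * of_real H) * of_real (exp (c * (H - 0))) - exp (- s * of_real h) * of_real (exp (c * (h - 0)))) * F c))"
    by (intro has_bochner_integral_add has_bochner_integral_sum has_bochner_integral_mult_right mid_term)
  have f_eq: "(\<Sum>i=1..num_up P + 1. of_real (A i) * (indicator {h<..<H} x *\<^sub>R (iexp (\<xi> * x) * of_real (exp (\<beta>' i * (x - H))))))
       + (\<Sum>j=1..num_down P + 1. of_real (B j) * (indicator {h<..<H} x *\<^sub>R (iexp (\<xi> * x) * of_real (exp (- g' j * (x - h))))))
       + of_real C * (indicator {h<..<H} x *\<^sub>R (iexp (\<xi> * x) * of_real (exp (c * (x - 0)))))
      = indicator {h<..<H} x *\<^sub>R (iexp (\<xi> * x) * of_real (mid A B C x))" for x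
    unfolding mid_def of_real_add of_real_sum of_real_mult distrib_left sum_distrib_left scaleR_sum_right scaleR_add_right
    by (intro arg_cong2[where f="(+)"] sum.cong refl) (simp_all add: mult_ac)
  have e1: "(\<Sum>i=1..num_up P + 1. of_real (A i) * ((exp (- s * of_real H) * of_real (exp (\<beta>' i * (H - H))) - exp (- s * of_real h) * of_real (exp (\<beta>' i * (h - H)))) * F (\<beta>' i)))
      = exp (- s * of_real H) * (\<Sum>i=1..num_up P + 1. of_real (A i) * F (\<beta>' i)) - exp (- s * of_real h) * (\<Sum>i=1..num_up P + 1. of_real (A i * exp (\<beta>' i * (h - H))) * F (\<beta>' i))"
    unfolding sum_distrib_left sum_subtractf[symmetric] by (intro sum.cong refl) (simp add: algebra_simps diff_divide_distrib)
  have e2: "(\<Sum>j=1..num_down P + 1. of_real (B j) * ((exp (- s * of_real H) * of_real (exp (- g' j * (H - h))) - exp (- s * of_real h) * of_real (exp (- g' j * (h - h)))) * F (- g' j)))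
      = exp (- s * of_real H) * (\<Sum>j=1..num_down P + 1. of_real (B j * exp (g' j * (h - H))) * F (- g' j)) - exp (- s * of_real h) * (\<Sum>j=1..num_down P + 1. of_real (B j) * F (- g' j))"
  proof -
    have "- g' j * (H - h) = g' j * (h - H)" for j by (simp add: algebra_simps)
    then show ?thesis
      unfolding sum_distrib_left sum_subtractf[symmetric] by (intro sum.cong refl) (simp add: right_diff_distrib left_diff_distrib diff_divide_distrib mult_ac)
  qed
  have alg: "(eH * X1 - eh * X2) + (eH * Y1 - eh * Y2) + C' * ((eH * a - eh * b) * Fc) =
      eH * (X1 + Y1 + C' * a * Fc) - eh * (X2 + Y2 + C' * b * Fc)" for eH eh X1 X2 Y1 Y2 C' a b Fc :: complex
    by (simp add: algebra_simps)
  show ?thesis using hb unfolding f_eq e1 e2 alg by (simp only: of_real_mult diff_0_right)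
qed

text \<open>The contributions of the three branches are regrouped by endpoint. At \<open>h\<close>
  the lower limit of the middle integral contributes a minus sign, which meets the minus signs of
  \<open>\<omega>0\<close> and \<open>\<nu>0\<close> in \<open>mid_v\<close>; this gives the
  positive entries of \<open>L1\<close>.\<close>

lemma fourier_shifted:
  "has_bochner_integral lborel (\<lambda>x. iexp (\<xi> * x) * of_real (shifted x)) (exp (- s * of_real h) * combine L1 F - exp (- s * of_real H) * combine L2 F)"
proof -
  define left where "left x = (\<Sum>i=1..num_up P + 1. \<omega>L i * exp (\<beta> i * (x - h)))" for x
  define right where "right x = (\<Sum>j=1..num_down P + 1. \<nu>U j * exp (- g j * (x - H)))" for x
  have "has_bochner_integral lborel (\<lambda>x. \<Sum>i=1..num_up P + 1. of_real (\<omega>L i) * (indicator {..<h} x *\<^sub>R (iexp (\<xi> * x) * of_real (exp (\<beta> i * (x - h))))))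
    (\<Sum>i=1..num_up P + 1. of_real (\<omega>L i) * (exp (- s * of_real h) * F (\<beta> i)))"
    using root_facts(1)[OF params roots] by (intro has_bochner_integral_sum has_bochner_integral_mult_right left_term) auto
  then have L: "has_bochner_integral lborel (\<lambda>x. indicator {..<h} x *\<^sub>R (iexp (\<xi> * x) * of_real (left x)))
    (exp (- s * of_real h) * (\<Sum>i=1..num_up P + 1. of_real (\<omega>L i) * F (\<beta> i)))"
    unfolding left_def of_real_sum of_real_mult sum_distrib_left scaleR_sum_right by (simp only: mult_scaleR_right mult.left_commute)
  have "has_bochner_integral lborel (\<lambda>x. \<Sum>j=1..num_down P + 1. of_real (\<nu>U j) * (indicator {H<..} x *\<^sub>R (iexp (\<xi> * x) * of_real (exp (- g j * (x - H))))))
    (\<Sum>j=1..num_down P + 1. of_real (\<nu>U j) * (- exp (- s * of_real H) * F (- g j)))"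
    using root_facts(2)[OF params roots] by (intro has_bochner_integral_sum has_bochner_integral_mult_right right_term) auto
  then have R: "has_bochner_integral lborel (\<lambda>x. indicator {H<..} x *\<^sub>R (iexp (\<xi> * x) * of_real (right x)))
    (- exp (- s * of_real H) * (\<Sum>j=1..num_down P + 1. of_real (\<nu>U j) * F (- g j)))"
    unfolding right_def of_real_sum of_real_mult sum_distrib_left scaleR_sum_right by (simp only: mult_scaleR_right mult.left_commute)
  note M = fourier_mid[of "\<lambda>i. - \<omega>0 i" "\<lambda>j. - \<nu>0 j" "\<kappa> * (cU - c0)"]
  have "has_bochner_integral lborel (\<lambda>x. indicator {..<h} x *\<^sub>R (iexp (\<xi> * x) * of_real (left x)) + indicator {h<..<H} x *\<^sub>R (iexp (\<xi> * x) * of_real (mid_v x))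
      + indicator {H<..} x *\<^sub>R (iexp (\<xi> * x) * of_real (right x)))
    (exp (- s * of_real h) * combine L1 F - exp (- s * of_real H) * combine L2 F)"
  proof -
    have "(eh * l + (eH * (- X1 + - Y2 + Ch) - eh * (- X2 + - Y1 + CH))) + - eH * r
        = eh * (l + Y1 + X2 - CH) - eH * (Y2 + r + X1 - Ch)" for eh eH l r X1 X2 Y1 Y2 Ch CH :: complex
      by (simp add: algebra_simps)
    then show ?thesis
      using has_bochner_integral_add[OF has_bochner_integral_add[OF L M] R]
      unfolding combine_L1 combine_L2 by (simp only: of_real_minus mult_minus_left sum_negf)
  qed
  then show ?thesis
    using h_less_H
    by (subst has_bochner_integral_discrete_difference[where X="{h, H}" and
          g="\<lambda>x. indicator {..<h} x *\<^sub>R (iexp (\<xi> * x) * of_real (left x)) + indicator {h<..<H} x *\<^sub>R (iexp (\<xi> * x) * of_real (mid_v x))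
      + indicator {H<..} x *\<^sub>R (iexp (\<xi> * x) * of_real (right x))"])
       (auto simp: shifted_def left_def right_def split: split_indicator simp del: of_real_sum sum.cl_ivl_Suc)
qed

text \<open>After \<open>a - G s\<close> has been replaced by \<open>a - G z\<close> with
  \<open>a = \<alpha>\<close>, the outer roots contribute nothing, the inner ones a factor
  \<open>- \<rho>\<close>, and the node \<open>c\<close> the coefficient computed in
  \<open>coef\<close>. What remains are the boundary terms of the middle integral of
  \<open>mid_w\<close>.\<close>

lemma fourier_source:
  "has_bochner_integral lborel (\<lambda>x. iexp (\<xi> * x) * of_real (source x))
    ((of_real \<alpha> - complex_exponent P s) * (exp (- s * of_real h) * combine L1 F - exp (- s * of_real H) * combine L2 F))"
proof -
  define X1 where "X1 = (\<Sum>i=1..num_up P + 1. of_real (\<omega>0 i) * F (\<beta>' i))"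
  define X2 where "X2 = (\<Sum>i=1..num_up P + 1. of_real (\<omega>0 i * exp (\<beta>' i * (h - H))) * F (\<beta>' i))"
  define Y1 where "Y1 = (\<Sum>j=1..num_down P + 1. of_real (\<nu>0 j) * F (- g' j))"
  define Y2 where "Y2 = (\<Sum>j=1..num_down P + 1. of_real (\<nu>0 j * exp (g' j * (h - H))) * F (- g' j))"
  have sRe: "Re s = 0" "s \<noteq> 0" using \<xi> by (auto simp: s)
  define D where "D z = (of_real \<alpha> - complex_exponent P (of_real z)) / (of_real z - s)" for z :: real
  have D_eq: "D z = of_real (\<alpha> - levy_exponent P z) * F z" for z
    by (simp add: D_def complex_exponent_of_real)
  have D_\<beta>: "D (\<beta> i) = 0" and D_\<beta>': "D (\<beta>' i) = - of_real \<rho> * F (\<beta>' i)" if "i \<in> {1..num_up P + 1}" for i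
    using root_facts(1)[OF params roots that] root_facts(1)[OF params roots' that] by (simp_all add: D_eq)
  have D_g: "D (- g j) = 0" and D_g': "D (- g' j) = - of_real \<rho> * F (- g' j)" if "j \<in> {1..num_down P + 1}" for j
    using root_facts(2)[OF params roots that] root_facts(2)[OF params roots' that] by (simp_all add: D_eq)
  \<comment> \<open>The node \<open>c\<close> is in general a root at neither level. The values of
    \<open>cU\<close> and \<open>c0\<close> make \<open>\<alpha> - G c\<close>, applied to the jump
    \<open>cU - c0\<close> of the exponential coefficient, produce the exponential part of the
    source.\<close>
  have coef: "(cU - c0) * (\<alpha> - levy_exponent P c) = \<rho> * c0"
  proof -
    have "levy_exponent P c - \<alpha> \<noteq> 0" "levy_exponent P c - (\<alpha> + \<rho>) \<noteq> 0" using G_c rho_pos by auto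
    then show ?thesis unfolding cU c0 by (simp add: divide_simps) (simp add: algebra_simps)
  qed
  have D_c: "of_real (\<kappa> * (cU - c0) * e) * D c = of_real (\<rho> * \<kappa> * c0 * e) * F c" for e
  proof -
    have "of_real (\<kappa> * (cU - c0) * e) * D c = of_real (\<kappa> * e * ((cU - c0) * (\<alpha> - levy_exponent P c))) * F c"
      unfolding D_eq by (simp add: mult_ac)
    then show ?thesis unfolding coef by (simp add: mult_ac)
  qed
  have E1: "(of_real \<alpha> - complex_exponent P s) * combine L1 F = - of_real \<rho> * Y1 - of_real \<rho> * X2 - of_real (\<rho> * \<kappa> * c0 * exp (c * h)) * F c"
  proof -
    have "(of_real \<alpha> - complex_exponent P s) * combine L1 F = combine L1 D"
      unfolding D_def by (rule combine_exponent[OF params sRe nodes_not_poles(1) combine_null(1)])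
    also have "\<dots> = (\<Sum>i=1..num_up P + 1. of_real (\<omega>L i) * 0) + (\<Sum>j=1..num_down P + 1. of_real (\<nu>0 j) * (- of_real \<rho> * F (- g' j)))
        + (\<Sum>i=1..num_up P + 1. of_real (\<omega>0 i * exp (\<beta>' i * (h - H))) * (- of_real \<rho> * F (\<beta>' i))) - of_real (\<rho> * \<kappa> * c0 * exp (c * h)) * F c"
      unfolding combine_L1 D_c
      by (intro arg_cong2[where f="(+)"] arg_cong2[where f="(-)"] sum.cong refl) (simp_all only: D_\<beta> D_\<beta>' D_g')
    also have "\<dots> = - of_real \<rho> * Y1 - of_real \<rho> * X2 - of_real (\<rho> * \<kappa> * c0 * exp (c * h)) * F c"
      unfolding Y1_def X2_def sum_distrib_left by (simp only: mult.left_commute mult_zero_right sum.neutral_const) (simp add: sum_negf del: sum.cl_ivl_Suc)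
    finally show ?thesis .
  qed
  have E2: "(of_real \<alpha> - complex_exponent P s) * combine L2 F = - of_real \<rho> * Y2 - of_real \<rho> * X1 - of_real (\<rho> * \<kappa> * c0 * exp (c * H)) * F c"
  proof -
    have "(of_real \<alpha> - complex_exponent P s) * combine L2 F = combine L2 D"
      unfolding D_def by (rule combine_exponent[OF params sRe nodes_not_poles(2) combine_null(2)])
    also have "\<dots> = (\<Sum>j=1..num_down P + 1. of_real (\<nu>0 j * exp (g' j * (h - H))) * (- of_real \<rho> * F (- g' j))) + (\<Sum>j=1..num_down P + 1. of_real (\<nu>U j) * 0)
        + (\<Sum>i=1..num_up P + 1. of_real (\<omega>0 i) * (- of_real \<rho> * F (\<beta>' i))) - of_real (\<rho> * \<kappa> * c0 * exp (c * H)) * F c"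
      unfolding combine_L2 D_c
      by (intro arg_cong2[where f="(+)"] arg_cong2[where f="(-)"] sum.cong refl) (simp_all only: D_g D_\<beta>' D_g')
    also have "\<dots> = - of_real \<rho> * Y2 - of_real \<rho> * X1 - of_real (\<rho> * \<kappa> * c0 * exp (c * H)) * F c"
      unfolding Y2_def X1_def sum_distrib_left by (simp only: mult.left_commute mult_zero_right sum.neutral_const) (simp add: sum_negf del: sum.cl_ivl_Suc)
    finally show ?thesis .
  qed
  have W: "indicator {h<..<H} x *\<^sub>R (iexp (\<xi> * x) * of_real (mid A B C x)) = iexp (\<xi> * x) * of_real (indicator {h<..<H} x * mid A B C x)" for x A B C
    by (simp split: split_indicator)
  have scale: "(\<Sum>i\<in>I. of_real (\<rho> * u i) * f i) = of_real \<rho> * (\<Sum>i\<in>I. of_real (u i) * f i)" for I :: "nat set" and u and f :: "nat \<Rightarrow> complex"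
    by (simp add: sum_distrib_left mult.assoc)
  have "has_bochner_integral lborel (\<lambda>x. iexp (\<xi> * x) * of_real (source x))
     (exp (- s * of_real H) * (of_real \<rho> * X1 + of_real \<rho> * Y2 + of_real (\<rho> * \<kappa> * c0 * exp (c * H)) * F c)
     - exp (- s * of_real h) * (of_real \<rho> * X2 + of_real \<rho> * Y1 + of_real (\<rho> * \<kappa> * c0 * exp (c * h)) * F c))"
    using fourier_mid[of "\<lambda>i. \<rho> * \<omega>0 i" "\<lambda>j. \<rho> * \<nu>0 j" "\<rho> * \<kappa> * c0"]
    unfolding W source_def[symmetric] mult.assoc[of \<rho> "\<omega>0 _"] mult.assoc[of \<rho> "\<nu>0 _"] scale
    by (simp only: X1_def X2_def Y1_def Y2_def)
  moreover have "exp (- s * of_real H) * (of_real \<rho> * X1 + of_real \<rho> * Y2 + of_real (\<rho> * \<kappa> * c0 * exp (c * H)) * F c)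
     - exp (- s * of_real h) * (of_real \<rho> * X2 + of_real \<rho> * Y1 + of_real (\<rho> * \<kappa> * c0 * exp (c * h)) * F c)
     = (of_real \<alpha> - complex_exponent P s) * (exp (- s * of_real h) * combine L1 F - exp (- s * of_real H) * combine L2 F)"
  proof -
    have "(of_real \<alpha> - complex_exponent P s) * (exp (- s * of_real h) * combine L1 F - exp (- s * of_real H) * combine L2 F) =
      exp (- s * of_real h) * ((of_real \<alpha> - complex_exponent P s) * combine L1 F) - exp (- s * of_real H) * ((of_real \<alpha> - complex_exponent P s) * combine L2 F)"
      by (simp only: right_diff_distrib mult.left_commute)
    then show ?thesis unfolding E1 E2 by (simp add: algebra_simps)
  qed
  ultimately show ?thesis by (simp only:)
qed

end

lemma integrable_of_fourier:
  fixes f :: "real \<Rightarrow> real"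
  assumes [measurable]: "f \<in> borel_measurable borel" and "integrable lborel (\<lambda>x. iexp (\<xi> * x) * complex_of_real (f x))"
  shows "integrable lborel f"
  by (rule Bochner_Integration.integrable_bound[OF assms(2)]) (auto simp: norm_mult)

text \<open>Equal transforms give equality almost everywhere. The difference of the two sides is
  continuous, by the matching at \<open>h\<close> and \<open>H\<close> and by the absence of atoms,
  so its zero set is closed and of full measure, hence the whole line.\<close>

lemma shifted_eq_resolvent: "shifted x = (\<integral>u. source (x + u) \<partial>resolvent)"
proof -
  have int_shifted: "integrable lborel shifted"
    using integrable_of_fourier[OF shifted_measurable, of 1] fourier_shifted[of 1 "- \<i> * of_real 1"] unfolding has_bochner_integral_iff by simp
  have int_source: "integrable lborel source"
    using integrable_of_fourier[OF source_measurable, of 1] fourier_source[of 1 "- \<i> * of_real 1"] unfolding has_bochner_integral_iff by simp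
  have "AE x in lborel. shifted x = (\<integral>u. source (x + u) \<partial>resolvent)"
  proof (rule fourier_transform_eq_imp_AE_eq[OF int_shifted fourier_resolvent(1)[OF int_source]])
    fix \<xi> :: real assume \<xi>: "\<xi> \<noteq> 0"
    define s where "s = - \<i> * of_real \<xi>"
    have "Re (complex_exponent P s) \<le> 0"
      using complex_exponent_Re_le[of s] imaginary_in_strip[of s] levy_exponent_0 by (simp add: s_def)
    then have "of_real \<alpha> - complex_exponent P s \<noteq> 0" using alpha_pos by (auto simp: complex_eq_iff)
    then show "(CLBINT x. iexp (\<xi> * x) * of_real (shifted x)) = (CLBINT x. iexp (\<xi> * x) * of_real (\<integral>u. source (x + u) \<partial>resolvent))"
      using fourier_shifted[OF \<xi> s_def] fourier_source[OF \<xi> s_def] fourier_resolvent(2)[OF int_source, of \<xi>, folded s_def]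
      unfolding has_bochner_integral_iff by simp
  qed
  then have AE: "AE x in lebesgue. x \<in> {x. shifted x - (\<integral>u. source (x + u) \<partial>resolvent) = 0}"
    by (intro AE_completion) simp
  obtain B where B: "\<And>x. \<bar>source x\<bar> \<le> B" using source_bounded by auto
  have "isCont (\<lambda>x. \<integral>u. source (x + u) \<partial>resolvent) y" for y
    by (rule isCont_resolvent[OF volatility_pos[OF params roots] source_measurable B, of "{h, H}"]) (auto intro: isCont_source)
  then have "continuous_on UNIV (\<lambda>x. shifted x - (\<integral>u. source (x + u) \<partial>resolvent))"
    by (intro continuous_on_diff continuous_on_shifted) (simp add: continuous_on_eq_continuous_at)
  then have "closed {x. shifted x - (\<integral>u. source (x + u) \<partial>resolvent) = 0}"
    by (rule closed_Collect_eq) (rule continuous_on_const)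
  from mem_closed_if_AE_lebesgue[OF this AE, of x] show ?thesis by simp
qed

text \<open>The function \<open>w\<close> adds the source to
  \<open>\<kappa> * \<alpha> * exp (c * y)\<close>. Its resolvent is
  \<open>shifted y - \<kappa> * cU * exp (c * y)\<close>, because
  \<open>- cU = \<alpha> / (\<alpha> - G c)\<close>, and then the killing term in the resolvent
  equation cancels the source.\<close>

lemma candidate_solution:
  "\<kappa> * (\<integral>y. \<alpha> * exp (c * y) \<partial>killed x) = shifted x - \<kappa> * cU * exp (c * x)"
proof -
  define w where "w y = \<kappa> * \<alpha> * exp (c * y) + source y" for y
  obtain B where B: "0 \<le> B" "\<And>x. \<bar>source x\<bar> \<le> B" using source_bounded by auto
  \<comment> \<open>The source is bounded and vanishes to the left of \<open>h\<close>; as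
    \<open>c \<ge> 0\<close>, the factor \<open>exp (c * (y - h))\<close> is at least 1 on its
    support, which fits the source under the same exponential bound as the payoff.\<close>
  have source_exp: "\<bar>source y\<bar> \<le> B * exp (- c * h) * exp (c * y)" for y
  proof (cases "h < y")
    case True
    then have "1 \<le> exp (- c * h) * exp (c * y)"
      using c_nonneg by (simp add: mult_left_mono flip: exp_add)
    then have "B * 1 \<le> B * (exp (- c * h) * exp (c * y))" by (rule mult_left_mono) (rule B)
    then show ?thesis using B(2)[of y] by (simp add: mult.assoc)
  qed (use B(1) in \<open>simp add: source_def\<close>)
  have bound: "\<bar>w y\<bar> \<le> (\<bar>\<kappa> * \<alpha>\<bar> + B * exp (- c * h)) * exp (c * y)" for y
  proof -
    have "\<bar>w y\<bar> \<le> \<bar>\<kappa> * \<alpha> * exp (c * y)\<bar> + \<bar>source y\<bar>" unfolding w_def by (rule abs_triangle_ineq)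
    also have "\<bar>\<kappa> * \<alpha> * exp (c * y)\<bar> = \<bar>\<kappa> * \<alpha>\<bar> * exp (c * y)" by (simp add: abs_mult)
    finally show ?thesis using source_exp[of y] by (simp add: distrib_right)
  qed
  have [measurable]: "w \<in> borel_measurable borel" unfolding w_def[abs_def] by measurable
  have U: "(\<integral>u. w (y + u) \<partial>resolvent) = shifted y - \<kappa> * cU * exp (c * y)" for y
  proof -
    have int_exp: "integrable resolvent (\<lambda>u. exp (c * u))"
      by (rule integrableI_nn_integral_finite[OF _ _ nn_integral_exp_resolvent[OF c_strip G_c]]) (use G_c in auto)
    have val: "(\<integral>u. exp (c * u) \<partial>resolvent) = 1 / (\<alpha> - levy_exponent P c)"
      using nn_integral_exp_resolvent[OF c_strip G_c] G_c by (intro integral_eq_nn_integral[THEN trans]) auto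
    have int_source: "integrable resolvent (\<lambda>u. source (y + u))"
      by (rule resolvent_equation(1)[OF c_strip G_c source_measurable source_exp])
    have "(\<integral>u. w (y + u) \<partial>resolvent) = (\<integral>u. \<kappa> * \<alpha> * exp (c * y) * exp (c * u) + source (y + u) \<partial>resolvent)"
      unfolding w_def by (rule Bochner_Integration.integral_cong) (simp_all add: distrib_left exp_add)
    also have "\<dots> = \<kappa> * \<alpha> * exp (c * y) * (1 / (\<alpha> - levy_exponent P c)) + shifted y"
      using int_exp int_source by (simp add: val shifted_eq_resolvent)
    also have "\<dots> = shifted y - \<kappa> * cU * exp (c * y)"
      using G_c by (simp add: cU divide_simps) (simp add: algebra_simps)
    finally show ?thesis .
  qed
  have "w y + \<rho> * (indicator {h<..<H} y * (\<integral>u. w (y + u) \<partial>resolvent)) = \<kappa> * (\<alpha> * exp (c * y))" for y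
    unfolding U by (simp add: w_def source_eq algebra_simps)
  then have "(\<integral>y. \<kappa> * (\<alpha> * exp (c * y)) \<partial>killed x) = (\<integral>u. w (x + u) \<partial>resolvent)"
    using resolvent_equation(2)[OF c_strip G_c _ bound, of x] by simp
  then show ?thesis unfolding U by simp
qed

end

text \<open>With \<open>\<kappa> = 0\<close> the payoff drops out of the resolvent identity and
  \<open>shifted\<close> vanishes identically. Each branch is a combination of distinct exponentials
  on an interval of positive length, so its coefficients vanish.\<close>

lemma (in mejd_candidate) trivial_kernel:
  assumes "\<kappa> = 0"
  shows "Q_vec P \<omega>L \<nu>0 \<nu>U \<omega>0 = 0\<^sub>v (sys_dim P + sys_dim P)"
proof -
  have shifted_0: "shifted x = 0" for x using candidate_solution[of x] assms by simp
  have \<omega>L: "\<omega>L i = 0" if "i \<in> {1..num_up P + 1}" for i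
  proof -
    have "\<forall>i\<in>{1..num_up P + 1}. \<omega>L i * exp (- \<beta> i * h) = 0"
    proof (rule exponentials_linearly_independent)
      show "inj_on \<beta> {1..num_up P + 1}" by (rule root_facts(3)[OF params roots])
      fix x assume "h - 1 < x" "x < h"
      then have "(\<Sum>i=1..num_up P + 1. \<omega>L i * exp (\<beta> i * (x - h))) = 0" using shifted_0[of x] by (simp add: shifted_def)
      moreover have "\<omega>L i * exp (\<beta> i * (x - h)) = \<omega>L i * exp (- \<beta> i * h) * exp (\<beta> i * x)" for i
        by (simp add: algebra_simps flip: exp_add)
      ultimately show "(\<Sum>i=1..num_up P + 1. \<omega>L i * exp (- \<beta> i * h) * exp (\<beta> i * x)) = 0" by (simp only:)
    qed auto
    then show ?thesis using that by auto
  qed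
  have \<nu>U: "\<nu>U j = 0" if "j \<in> {1..num_down P + 1}" for j
  proof -
    have "\<forall>j\<in>{1..num_down P + 1}. \<nu>U j * exp (g j * H) = 0"
    proof (rule exponentials_linearly_independent)
      show "inj_on (\<lambda>j. - g j) {1..num_down P + 1}" using root_facts(4)[OF params roots] by (auto simp: inj_on_def)
      fix x assume "H < x" "x < H + 1"
      then have "(\<Sum>j=1..num_down P + 1. \<nu>U j * exp (- g j * (x - H))) = 0" using shifted_0[of x] h_less_H by (simp add: shifted_def)
      moreover have "\<nu>U j * exp (- g j * (x - H)) = \<nu>U j * exp (g j * H) * exp (- g j * x)" for j
        by (simp add: algebra_simps flip: exp_add)
      ultimately show "(\<Sum>j=1..num_down P + 1. \<nu>U j * exp (g j * H) * exp (- g j * x)) = 0" by (simp only:)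
    qed auto
    then show ?thesis using that by auto
  qed
  \<comment> \<open>The inner branch mixes two families; the disjoint sum treats them as one.
    Exponents of different families differ because \<open>\<beta>'\<close> is positive and
    \<open>- g'\<close> is negative.\<close>
  define I where "I = {1..num_up P + 1} <+> {1..num_down P + 1}"
  define z where "z = case_sum \<beta>' (\<lambda>j. - g' j)"
  define q where "q = case_sum (\<lambda>i. \<omega>0 i * exp (- \<beta>' i * H)) (\<lambda>j. \<nu>0 j * exp (g' j * h))"
  have "\<forall>k\<in>I. q k = 0"
  proof (rule exponentials_linearly_independent)
    show "finite I" by (simp add: I_def)
    have ne: "\<beta>' i \<noteq> - g' j" if "i \<in> {1..num_up P + 1}" "j \<in> {1..num_down P + 1}" for i j
      using root_facts(1)[OF params roots' that(1)] root_facts(2)[OF params roots' that(2)] by linarith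
    show "inj_on z I"
    proof (rule inj_onI)
      fix x y assume "x \<in> I" "y \<in> I" and z: "z x = z y"
      then consider (uu) a b where "x = Inl a" "y = Inl b" "a \<in> {1..num_up P + 1}" "b \<in> {1..num_up P + 1}"
        | (ud) a b where "x = Inl a" "y = Inr b" "a \<in> {1..num_up P + 1}" "b \<in> {1..num_down P + 1}"
        | (du) a b where "x = Inr a" "y = Inl b" "a \<in> {1..num_down P + 1}" "b \<in> {1..num_up P + 1}"
        | (dd) a b where "x = Inr a" "y = Inr b" "a \<in> {1..num_down P + 1}" "b \<in> {1..num_down P + 1}"
        unfolding I_def by (elim PlusE) metis+
      then show "x = y"
      proof cases
        case (uu a b)
        then show ?thesis using z inj_onD[OF root_facts(3)[OF params roots'], of a b] by (simp add: z_def)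
      next
        case (ud a b)
        then show ?thesis using z ne[of a b] by (simp add: z_def)
      next
        case (du a b)
        then show ?thesis using z ne[of b a] by (simp add: z_def)
      next
        case (dd a b)
        then show ?thesis using z inj_onD[OF root_facts(4)[OF params roots'], of a b] by (simp add: z_def)
      qed
    qed
    show "h < H" by (rule h_less_H)
    fix x assume x: "h < x" "x < H"
    have "(\<Sum>k\<in>I. q k * exp (z k * x)) = (\<Sum>i=1..num_up P + 1. \<omega>0 i * exp (- \<beta>' i * H) * exp (\<beta>' i * x)) + (\<Sum>j=1..num_down P + 1. \<nu>0 j * exp (g' j * h) * exp (- g' j * x))"
      unfolding I_def by (subst sum.Plus) (simp_all add: q_def z_def del: sum.cl_ivl_Suc)
    also have "\<dots> = (\<Sum>i=1..num_up P + 1. \<omega>0 i * exp (\<beta>' i * (x - H))) + (\<Sum>j=1..num_down P + 1. \<nu>0 j * exp (- g' j * (x - h)))"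
      by (intro arg_cong2[where f="(+)"] sum.cong refl) (simp_all add: algebra_simps flip: exp_add)
    also have "\<dots> = - shifted x"
      using x unfolding shifted_def mid_def by (simp add: assms sum_negf del: sum.cl_ivl_Suc)
    finally show "(\<Sum>k\<in>I. q k * exp (z k * x)) = 0" by (simp add: shifted_0)
  qed
  then have \<omega>0: "\<omega>0 i = 0" if "i \<in> {1..num_up P + 1}" for i
    using that by (auto simp: I_def q_def dest!: bspec[of _ _ "Inl i"] intro: InlI)
  have \<nu>0: "\<nu>0 j = 0" if "j \<in> {1..num_down P + 1}" for j
    using \<open>\<forall>k\<in>I. q k = 0\<close> that by (auto simp: I_def q_def dest!: bspec[of _ _ "Inr j"] intro: InrI)
  have "Q_vec P \<omega>L \<nu>0 \<nu>U \<omega>0 = Q_vec P (\<lambda>_. 0) (\<lambda>_. 0) (\<lambda>_. 0) (\<lambda>_. 0)"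
    unfolding Q_vec_def
    by (intro arg_cong[where f=vec_of_list] arg_cong2[where f="(@)"] map_cong refl) (auto intro: \<omega>L \<nu>0 \<nu>U \<omega>0)
  also have "\<dots> = 0\<^sub>v (sys_dim P + sys_dim P)"
    by (rule eq_vecI) (auto simp: Q_vec_def vec_of_list_index map_replicate_const sys_dim_def nth_append simp del: upt_Suc replicate_Suc)
  finally show ?thesis .
qed

theorem theorem2:
  fixes P :: mejd
    and \<Omega> :: "'a measure"
    and W :: "real \<Rightarrow> 'a \<Rightarrow> real" and N :: "real \<Rightarrow> 'a \<Rightarrow> nat" and Y :: "nat \<Rightarrow> 'a \<Rightarrow> real"
    and h H \<alpha> \<rho> \<gamma> :: real
    and \<beta>\<^sub>\<alpha> \<gamma>\<^sub>\<alpha> \<beta>\<^sub>\<alpha>\<^sub>\<rho> \<gamma>\<^sub>\<alpha>\<^sub>\<rho> :: "nat \<Rightarrow> real"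
  assumes "mejd_parameters P"
    and "mejd_drivers P \<Omega> W N Y"
    and "h < H" and "0 < \<alpha>" and "0 < \<rho>"
    and "0 \<le> \<gamma>" and "\<gamma> < min (eta P 1) (theta P 1)" and "levy_exponent P \<gamma> < \<alpha>"
    and "root_assumption P \<alpha> \<beta>\<^sub>\<alpha> \<gamma>\<^sub>\<alpha>"
    and "root_assumption P (\<alpha> + \<rho>) \<beta>\<^sub>\<alpha>\<^sub>\<rho> \<gamma>\<^sub>\<alpha>\<^sub>\<rho>"
  shows "let c\<^sub>L = \<alpha> / (levy_exponent P \<gamma> - \<alpha>);
             c\<^sub>U = \<alpha> / (levy_exponent P \<gamma> - \<alpha>);
             c\<^sub>0 = \<alpha> / (levy_exponent P \<gamma> - (\<alpha> + \<rho>));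
             D = (\<lambda>x. discounted_payoff h H \<rho> \<gamma> (mejd_process P W N Y x));
             E = (\<lambda>x T. prob_space.expectation \<Omega> (D x T))
         in \<exists>\<omega>\<^sub>L \<omega>\<^sub>0 \<nu>\<^sub>0 \<nu>\<^sub>U :: nat \<Rightarrow> real.
           (\<forall>x.
              (\<forall>T\<ge>0. integrable \<Omega> (D x T)) \<and>
              set_integrable lborel {0..} (\<lambda>T. \<alpha> * exp (- \<alpha> * T) * E x T) \<and>
              (LBINT T:{0..}. \<alpha> * exp (- \<alpha> * T) * E x T) =
                (if x \<le> h then
                   (\<Sum>i=1..num_up P + 1. \<omega>\<^sub>L i * exp (\<beta>\<^sub>\<alpha> i * (x - h))) - c\<^sub>L * exp (\<gamma> * x)
                 else if x < H then
                   - (\<Sum>i=1..num_up P + 1. \<omega>\<^sub>0 i * exp (\<beta>\<^sub>\<alpha>\<^sub>\<rho> i * (x - H)))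
                   - (\<Sum>j=1..num_down P + 1. \<nu>\<^sub>0 j * exp (- \<gamma>\<^sub>\<alpha>\<^sub>\<rho> j * (x - h))) - c\<^sub>0 * exp (\<gamma> * x)
                 else
                   (\<Sum>j=1..num_down P + 1. \<nu>\<^sub>U j * exp (- \<gamma>\<^sub>\<alpha> j * (x - H))) - c\<^sub>U * exp (\<gamma> * x))) \<and>
           B_mat P h H \<beta>\<^sub>\<alpha> \<gamma>\<^sub>\<alpha> \<beta>\<^sub>\<alpha>\<^sub>\<rho> \<gamma>\<^sub>\<alpha>\<^sub>\<rho> *\<^sub>v Q_vec P \<omega>\<^sub>L \<nu>\<^sub>0 \<nu>\<^sub>U \<omega>\<^sub>0 = V_vec P h H \<gamma> c\<^sub>U c\<^sub>0"
proof -
  let ?cU = "\<alpha> / (levy_exponent P \<gamma> - \<alpha>)" and ?c0 = "\<alpha> / (levy_exponent P \<gamma> - (\<alpha> + \<rho>))"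
  let ?B = "B_mat P h H \<beta>\<^sub>\<alpha> \<gamma>\<^sub>\<alpha> \<beta>\<^sub>\<alpha>\<^sub>\<rho> \<gamma>\<^sub>\<alpha>\<^sub>\<rho>" and ?S2 = "sys_dim P + sys_dim P"
  have candidate: "mejd_candidate P \<Omega> W N Y h H \<rho> \<alpha> \<beta>\<^sub>\<alpha> \<gamma>\<^sub>\<alpha> \<beta>\<^sub>\<alpha>\<^sub>\<rho> \<gamma>\<^sub>\<alpha>\<^sub>\<rho> \<gamma> \<kappa> \<omega>\<^sub>L \<nu>\<^sub>0 \<nu>\<^sub>U \<omega>\<^sub>0 ?cU ?c0"
    if "?B *\<^sub>v Q_vec P \<omega>\<^sub>L \<nu>\<^sub>0 \<nu>\<^sub>U \<omega>\<^sub>0 = \<kappa> \<cdot>\<^sub>v V_vec P h H \<gamma> ?cU ?c0" for \<kappa> \<omega>\<^sub>L \<nu>\<^sub>0 \<nu>\<^sub>U \<omega>\<^sub>0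
    using assms that by unfold_locales auto
  have "\<exists>v. v \<in> carrier_vec ?S2 \<and> ?B *\<^sub>v v = V_vec P h H \<gamma> ?cU ?c0"
  proof (rule mat_solve_of_trivial_kernel[OF B_mat_carrier V_vec_carrier])
    fix v assume v: "v \<in> carrier_vec ?S2" "?B *\<^sub>v v = 0\<^sub>v ?S2"
    then obtain \<omega>\<^sub>L \<nu>\<^sub>0 \<nu>\<^sub>U \<omega>\<^sub>0 where Q: "v = Q_vec P \<omega>\<^sub>L \<nu>\<^sub>0 \<nu>\<^sub>U \<omega>\<^sub>0" using Q_vec_surj by blast
    have "0 \<cdot>\<^sub>v V_vec P h H \<gamma> ?cU ?c0 = 0\<^sub>v ?S2"
      using carrier_vecD[OF V_vec_carrier] by (intro eq_vecI) auto
    then interpret mejd_candidate P \<Omega> W N Y h H \<rho> \<alpha> \<beta>\<^sub>\<alpha> \<gamma>\<^sub>\<alpha> \<beta>\<^sub>\<alpha>\<^sub>\<rho> \<gamma>\<^sub>\<alpha>\<^sub>\<rho> \<gamma> 0 \<omega>\<^sub>L \<nu>\<^sub>0 \<nu>\<^sub>U \<omega>\<^sub>0 ?cU ?c0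
      by (intro candidate) (use v Q in simp)
    show "v = 0\<^sub>v ?S2" unfolding Q by (rule trivial_kernel) simp
  qed
  then obtain \<omega>\<^sub>L \<nu>\<^sub>0 \<nu>\<^sub>U \<omega>\<^sub>0 where solution: "?B *\<^sub>v Q_vec P \<omega>\<^sub>L \<nu>\<^sub>0 \<nu>\<^sub>U \<omega>\<^sub>0 = V_vec P h H \<gamma> ?cU ?c0"
    using Q_vec_surj by blast
  interpret mejd_candidate P \<Omega> W N Y h H \<rho> \<alpha> \<beta>\<^sub>\<alpha> \<gamma>\<^sub>\<alpha> \<beta>\<^sub>\<alpha>\<^sub>\<rho> \<gamma>\<^sub>\<alpha>\<^sub>\<rho> \<gamma> 1 \<omega>\<^sub>L \<nu>\<^sub>0 \<nu>\<^sub>U \<omega>\<^sub>0 ?cU ?c0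
    by (intro candidate) (simp add: solution)
  \<comment> \<open>With \<open>\<kappa> = 1\<close> the exponential coefficient inside the corridor
    is \<open>(cU - c0) - cU = - c0\<close>; outside, \<open>shifted\<close> has no such term and
    \<open>- cU\<close> remains.\<close>
  have formula_eq: "shifted x - ?cU * exp (\<gamma> * x) =
      (if x \<le> h then (\<Sum>i=1..num_up P + 1. \<omega>\<^sub>L i * exp (\<beta>\<^sub>\<alpha> i * (x - h))) - ?cU * exp (\<gamma> * x)
       else if x < H then
         - (\<Sum>i=1..num_up P + 1. \<omega>\<^sub>0 i * exp (\<beta>\<^sub>\<alpha>\<^sub>\<rho> i * (x - H)))
         - (\<Sum>j=1..num_down P + 1. \<nu>\<^sub>0 j * exp (- \<gamma>\<^sub>\<alpha>\<^sub>\<rho> j * (x - h))) - ?c0 * exp (\<gamma> * x)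
       else (\<Sum>j=1..num_down P + 1. \<nu>\<^sub>U j * exp (- \<gamma>\<^sub>\<alpha> j * (x - H))) - ?cU * exp (\<gamma> * x))" for x
    unfolding shifted_def mid_def by (simp add: sum_negf left_diff_distrib del: sum.cl_ivl_Suc)
  show ?thesis
    unfolding Let_def
  proof (intro exI conjI allI impI)
    fix x
    show "integrable \<Omega> (discounted_payoff h H \<rho> \<gamma> (mejd_process P W N Y x) T)" if "0 \<le> T" for T
      by (rule integrable_payoff[OF c_strip that])
    show "set_integrable lborel {0..} (\<lambda>T. \<alpha> * exp (- \<alpha> * T) * expectation (discounted_payoff h H \<rho> \<gamma> (mejd_process P W N Y x) T))"
      by (rule discounted_expectation(1)[OF c_strip G_c])
    show "(LBINT T:{0..}. \<alpha> * exp (- \<alpha> * T) * expectation (discounted_payoff h H \<rho> \<gamma> (mejd_process P W N Y x) T)) =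
      (if x \<le> h then (\<Sum>i=1..num_up P + 1. \<omega>\<^sub>L i * exp (\<beta>\<^sub>\<alpha> i * (x - h))) - ?cU * exp (\<gamma> * x)
       else if x < H then
         - (\<Sum>i=1..num_up P + 1. \<omega>\<^sub>0 i * exp (\<beta>\<^sub>\<alpha>\<^sub>\<rho> i * (x - H)))
         - (\<Sum>j=1..num_down P + 1. \<nu>\<^sub>0 j * exp (- \<gamma>\<^sub>\<alpha>\<^sub>\<rho> j * (x - h))) - ?c0 * exp (\<gamma> * x)
       else (\<Sum>j=1..num_down P + 1. \<nu>\<^sub>U j * exp (- \<gamma>\<^sub>\<alpha> j * (x - H))) - ?cU * exp (\<gamma> * x))"
      unfolding discounted_expectation(2)[OF c_strip G_c] formula_eq[symmetric] using candidate_solution[of x] by simp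
    show "?B *\<^sub>v Q_vec P \<omega>\<^sub>L \<nu>\<^sub>0 \<nu>\<^sub>U \<omega>\<^sub>0 = V_vec P h H \<gamma> ?cU ?c0" by (rule solution)
  qed
qed

end
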